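(* With probability one, for all $\tau_0>0$ and $p_0>0$: if $p_0$ is a singularity of the curve $f(\cdot,\tau_0)$, then $p_0$ is a cusp singularity of $f(\cdot,\tau_0)$.
   Context: Let $W$ be a standard two-dimensional Brownian motion on $[0,\infty)$, viewed as complex valued, extended by $W(s)=0$ for $s\le0$. For $p\in\mathbb{R}$ and $\tau>0$ let $$f(p,\tau)=\mathbb{E}_{Z_\tau}W(p-Z_\tau),$$ where $Z_\tau$ is a real normal variable with mean $0$ and variance $\tau$ independent of $W$ and the expectation is over $Z_\tau$ only, with $W$ fixed. (Fixing $\tau$ and varying $p$ gives the path of a particle of the Conga line.) Attention is restricted to $p>0$, $\tau>0$. A singularity of a curve $\gamma:\mathbb{R}\to\mathbb{C}$ is a point $t_0$ with $|\gamma'(t_0)|=0$. A singularity $t_0$ of $\gamma$ is a cusp singularity if $\gamma$ is analytic in a neighbourhood of $t_0$ and there is a translation and rotation of co-ordinates of the plane taking $\gamma(t_0)$ to the origin under which $\gamma$ is represented by $\gamma^*=(\gamma_1^*,\gamma_2^* )$ with power series expansions $$\gamma_1^*(t)=\sum_{i=2}^\infty a_i(t-t_0)^i,\qquad \gamma_2^*(t)=\sum_{i=3}^\infty b_i(t-t_0)^i,\qquad a_2\ne0,\ b_3\ne0,$$ for $t\in[t_0-\delta,t_0+\delta]$ for some $\delta>0$. *)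

theory Defs
  imports "HOL-Probability.Probability"
begin

text \<open>Only the times \<open>t \<ge> 0\<close> are constrained; values of the process at negative times play no role.\<close>

definition standard_brownian_motion :: "'w measure \<Rightarrow> (real \<Rightarrow> 'w \<Rightarrow> real) \<Rightarrow> bool" where
  "standard_brownian_motion M B \<longleftrightarrow>
     prob_space M \<and>
     (\<forall>t\<ge>0. B t \<in> borel_measurable M) \<and>
     (AE \<omega> in M. B 0 \<omega> = 0) \<and>
     (\<forall>(n::nat) (t :: nat \<Rightarrow> real). 0 \<le> t 0 \<and> (\<forall>i<n. t i < t (Suc i)) \<longrightarrow>
        prob_space.indep_vars M (\<lambda>_. borel) (\<lambda>i \<omega>. B (t (Suc i)) \<omega> - B (t i) \<omega>) {..<n}) \<and>
     (\<forall>s t. 0 \<le> s \<and> s < t \<longrightarrow>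
        distributed M lborel (\<lambda>\<omega>. B t \<omega> - B s \<omega>) (normal_density 0 (sqrt (t - s)))) \<and>
     (AE \<omega> in M. continuous_on {0..} (\<lambda>t. B t \<omega>))"

text \<open>The two coordinates are independent as processes, i.e. as random elements of the
  product space of real functions on \<open>[0,\<infinity>)\<close>.\<close>

definition standard_planar_brownian_motion :: "'w measure \<Rightarrow> (real \<Rightarrow> 'w \<Rightarrow> complex) \<Rightarrow> bool" where
  "standard_planar_brownian_motion M W \<longleftrightarrow>
     standard_brownian_motion M (\<lambda>t \<omega>. Re (W t \<omega>)) \<and>
     standard_brownian_motion M (\<lambda>t \<omega>. Im (W t \<omega>)) \<and>
     prob_space.indep_var M
       (PiM {0..} (\<lambda>_. borel)) (\<lambda>\<omega>. \<lambda>t\<in>{0..}. Re (W t \<omega>))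
       (PiM {0..} (\<lambda>_. borel)) (\<lambda>\<omega>. \<lambda>t\<in>{0..}. Im (W t \<omega>))"

definition zero_extension :: "(real \<Rightarrow> complex) \<Rightarrow> real \<Rightarrow> complex" where
  "zero_extension w s = (if s \<le> 0 then 0 else w s)"

text \<open>Here \<open>w\<close> is a fixed path \<open>\<lambda>t. W t \<omega>\<close>: the integral is over the law of \<open>Z\<^sub>\<tau>\<close> only.
  The second parameter of \<^const>\<open>normal_density\<close> is the standard deviation, not the variance.\<close>

definition conga :: "(real \<Rightarrow> complex) \<Rightarrow> real \<Rightarrow> real \<Rightarrow> complex" where
  "conga w p \<tau> =
     (LINT z|density lborel (normal_density 0 (sqrt \<tau>)). zero_extension w (p - z))"

definition real_analytic_on :: "(real \<Rightarrow> complex) \<Rightarrow> real set \<Rightarrow> bool" where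
  "real_analytic_on \<gamma> S \<longleftrightarrow>
     (\<forall>x\<in>S. \<exists>\<delta>>0. \<exists>c :: nat \<Rightarrow> complex.
        \<forall>t\<in>ball x \<delta>. (\<lambda>i. c i * of_real ((t - x) ^ i)) sums \<gamma> t)"

definition curve_singularity :: "(real \<Rightarrow> complex) \<Rightarrow> real \<Rightarrow> bool" where
  "curve_singularity \<gamma> t\<^sub>0 \<longleftrightarrow>
     \<gamma> differentiable (at t\<^sub>0) \<and> norm (vector_derivative \<gamma> (at t\<^sub>0)) = 0"

text \<open>The change of coordinates is \<open>z \<mapsto> cis \<theta> * (z - \<gamma> t\<^sub>0)\<close>. The shifted indices in the series
  express that they start at degree 2 and degree 3, respectively.\<close>

definition cusp_singularity :: "(real \<Rightarrow> complex) \<Rightarrow> real \<Rightarrow> bool" where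
  "cusp_singularity \<gamma> t\<^sub>0 \<longleftrightarrow>
     curve_singularity \<gamma> t\<^sub>0 \<and>
     (\<exists>\<epsilon>>0. real_analytic_on \<gamma> (ball t\<^sub>0 \<epsilon>)) \<and>
     (\<exists>\<theta>::real. \<exists>(a :: nat \<Rightarrow> real) (b :: nat \<Rightarrow> real). \<exists>\<delta>>0.
        a 2 \<noteq> 0 \<and> b 3 \<noteq> 0 \<and>
        (\<forall>t\<in>{t\<^sub>0 - \<delta>..t\<^sub>0 + \<delta>}.
           (\<lambda>i. a (i + 2) * (t - t\<^sub>0) ^ (i + 2)) sums Re (cis \<theta> * (\<gamma> t - \<gamma> t\<^sub>0)) \<and>
           (\<lambda>i. b (i + 3) * (t - t\<^sub>0) ^ (i + 3)) sums Im (cis \<theta> * (\<gamma> t - \<gamma> t\<^sub>0))))"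

end

theory Submission
  imports Defs "HOL-Real_Asymp.Real_Asymp"
begin

text \<open>Why every singularity is a cusp. Fix \<open>\<tau>\<close>, put \<open>\<sigma> = 1 / \<tau>\<close>, and let \<open>m\<^sub>j\<close> be the integral of
  \<open>(p - s)\<^sup>j exp (- \<sigma> (p - s)\<^sup>2 / 2)\<close> against the extended path. The curve is a Gaussian convolution,
  hence an everywhere convergent power series about each \<open>p\<close>; its coefficients of degree 1 and 2 are
  non-zero real multiples of \<open>m\<^sub>1\<close> and \<open>\<sigma> m\<^sub>2 - m\<^sub>0\<close>, and, once \<open>m\<^sub>1 = 0\<close>, the coefficient of degree 3
  is one of \<open>m\<^sub>3\<close> (\<open>conga_power_series\<close>). A singular point, that is \<open>m\<^sub>1 = 0\<close>, is a cusp as soon as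
  the coefficients of degree 2 and 3 are linearly independent over the reals: rotate the first of
  them onto the real axis (\<open>cusp_singularityI\<close>). So a singularity can fail to be a cusp only if some
  angle \<open>\<theta>\<close> satisfies \<open>m\<^sub>1 = 0\<close> and \<open>cos \<theta> m\<^sub>3 + sin \<theta> (\<sigma> m\<^sub>2 - m\<^sub>0) = 0\<close>.

  These are four real equations for the three real unknowns \<open>p, \<sigma>, \<theta>\<close>, so a random field in general
  position should have no solution. To make this precise, cut a box of parameters into about \<open>n\<^sup>3\<close>
  cells of size \<open>1 / n\<close>. The field depends on the parameters in a Lipschitz way
  (\<open>degeneracy_lipschitz\<close>), so a zero forces the field to be \<open>O(1 / n)\<close> at a grid point. If at every
  single parameter the probability of being of size at most \<open>\<epsilon>\<close> is \<open>O(\<epsilon>\<^sup>4)\<close>, uniformly, the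
  union bound is \<open>O(n\<^sup>3 n\<^sup>-\<^sup>4)\<close>, which tends to 0 (\<open>no_zero_of_lipschitz_field\<close>).

  The bound \<open>O(\<epsilon>\<^sup>4)\<close> is read off from characteristic functions. If \<open>G\<close> vanishes at infinity, the
  integral of a Brownian path \<open>B\<close> against \<open>G'\<close> is, by partial integration, minus the Wiener integral of
  \<open>G\<close>, a centred Gaussian variable with variance \<open>\<integral> G\<^sup>2\<close>
  (\<open>brownian_functional_char_bound\<close>). Averaging the characteristic function of a pair of such
  variables over a Gaussian of width \<open>1 / \<epsilon>\<close> bounds the expectation of
  \<open>exp (- (X\<^sup>2 + Y\<^sup>2) / (2 \<epsilon>\<^sup>2))\<close> by \<open>\<epsilon>\<^sup>2 / m\<close>, where \<open>m\<close> is a lower bound for the covariance form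
  (\<open>small_ball_from_characteristic_function\<close>). The two coordinates of the
  planar motion are independent and each contributes a factor \<open>\<epsilon>\<^sup>2\<close>. Finally, \<open>m\<close> can be chosen
  uniformly on compact boxes, because the primitives of the two kernels are a Gaussian times linearly
  independent polynomials (\<open>primitives_uniformly_nondegenerate\<close>).\<close>

section \<open>Riemann--Stieltjes functionals of a path\<close>

lemma integral_uniform_partition:
  fixes h :: "real \<Rightarrow> real" and d :: real
  assumes "continuous_on {0..real n * d} h" and d: "d \<ge> 0"
  shows "integral {0..real n * d} h = (\<Sum>j<n. integral {real j * d..real (Suc j) * d} h)"
  using assms(1)
proof (induction n)
  case (Suc n)
  have le: "real n * d \<le> real (Suc n) * d"
    using d by (intro mult_right_mono) auto
  have "integral {0..real (Suc n) * d} h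
      = integral {0..real n * d} h + integral {real n * d..real (Suc n) * d} h"
    using Suc.prems le d
    by (intro Henstock_Kurzweil_Integration.integral_combine[symmetric]
          integrable_continuous_interval) auto
  moreover have "continuous_on {0..real n * d} h"
    by (rule continuous_on_subset[OF Suc.prems]) (use le in auto)
  ultimately show ?case using Suc.IH by simp
qed simp

text \<open>The tags are arbitrary because two different choices are needed: left end points for the path itself,
  where the sums are linear in finitely many values of the path, and right end points for the variance of
  those sums. The proof compares both sides cell by cell, using uniform continuity of \<open>f\<close>.\<close>

lemma riemann_stieltjes_sum_tendsto:
  fixes f G g :: "real \<Rightarrow> real" and \<xi> :: "nat \<Rightarrow> nat \<Rightarrow> real"
  assumes T: "T > 0" and f: "continuous_on {0..T} f" and g: "continuous_on {0..T} g"
    and G: "\<And>s. s \<in> {0..T} \<Longrightarrow> (G has_real_derivative g s) (at s)"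
    and tag: "\<And>n j. j < n \<Longrightarrow> \<xi> n j \<in> {T * real j / real n..T * real (Suc j) / real n}"
  shows "(\<lambda>n. \<Sum>j<n. f (\<xi> n j) * (G (T * real (Suc j) / real n) - G (T * real j / real n)))
           \<longlonglongrightarrow> integral {0..T} (\<lambda>s. f s * g s)"
proof (rule LIMSEQ_I)
  fix r :: real assume r: "r > 0"
  have "bounded (g ` {0..T})"
    by (intro compact_imp_bounded compact_continuous_image g) auto
  then obtain K where K: "K > 0" "\<And>s. s \<in> {0..T} \<Longrightarrow> \<bar>g s\<bar> \<le> K"
    by (auto simp: bounded_pos)
  \<comment> \<open>An oscillation of \<open>f\<close> below \<open>e\<close> on each cell changes the sum by at most \<open>e K T = r / 2\<close>.\<close>
  define e where "e = r / (2 * (K * T))"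
  have e: "e > 0" using r K T by (simp add: e_def)
  have "uniformly_continuous_on {0..T} f"
    by (intro compact_uniformly_continuous f) auto
  then obtain \<delta> where \<delta>: "\<delta> > 0"
    "\<And>x y. x \<in> {0..T} \<Longrightarrow> y \<in> {0..T} \<Longrightarrow> dist y x < \<delta> \<Longrightarrow> dist (f y) (f x) < e"
    unfolding uniformly_continuous_on_def using e by metis
  obtain N :: nat where N: "real N > T / \<delta>" using reals_Archimedean2 by blast
  show "\<exists>no. \<forall>n\<ge>no. norm ((\<Sum>j<n. f (\<xi> n j) * (G (T * real (Suc j) / real n) - G (T * real j / real n)))
       - integral {0..T} (\<lambda>s. f s * g s)) < r"
  proof (intro exI[of _ "Suc N"] allI impI)
    fix n assume n: "n \<ge> Suc N"
    define d where "d = T / real n"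
    have n0: "n > 0" using n by simp
    have d: "d > 0" "real n * d = T" using T n0 by (auto simp: d_def)
    have "T / \<delta> < real n" using N n by linarith
    then have d\<delta>: "d < \<delta>" using n0 \<delta> T by (simp add: d_def field_simps)
    have cell: "{real j * d..real (Suc j) * d} \<subseteq> {0..T}" if "j < n" for j
    proof -
      have "real (Suc j) * d \<le> real n * d"
        using that d by (intro mult_right_mono) auto
      then show ?thesis using d by auto
    qed
    have incr: "G (real (Suc j) * d) - G (real j * d)
        = integral {real j * d..real (Suc j) * d} g" if "j < n" for j
    proof -
      have "(g has_integral (G (real (Suc j) * d) - G (real j * d))) {real j * d..real (Suc j) * d}"
      proof (rule fundamental_theorem_of_calculus)
        fix x assume "x \<in> {real j * d..real (Suc j) * d}"
        then have "(G has_real_derivative g x) (at x)" using cell[OF that] G by blast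
        then show "(G has_vector_derivative g x) (at x within {real j * d..real (Suc j) * d})"
          using has_real_derivative_iff_has_vector_derivative has_vector_derivative_at_within by blast
      qed (use d in \<open>auto simp: mult_right_mono\<close>)
      then show ?thesis by (simp add: integral_unique)
    qed
    have rw: "T * real j / real n = real j * d" for j by (simp add: d_def)
    have "integral {0..T} (\<lambda>s. f s * g s)
        = (\<Sum>j<n. integral {real j * d..real (Suc j) * d} (\<lambda>s. f s * g s))"
      using integral_uniform_partition[of n d "\<lambda>s. f s * g s"] d f g
      by (simp add: continuous_on_mult)
    then have "(\<Sum>j<n. f (\<xi> n j) * (G (T * real (Suc j) / real n) - G (T * real j / real n)))
       - integral {0..T} (\<lambda>s. f s * g s)
       = (\<Sum>j<n. f (\<xi> n j) * integral {real j * d..real (Suc j) * d} g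
             - integral {real j * d..real (Suc j) * d} (\<lambda>s. f s * g s))"
      unfolding rw sum_subtractf using incr by simp
    also have "\<dots> = (\<Sum>j<n. integral {real j * d..real (Suc j) * d} (\<lambda>s. (f (\<xi> n j) - f s) * g s))"
    proof (rule sum.cong)
      fix j assume "j \<in> {..<n}"
      then have c: "continuous_on {real j * d..real (Suc j) * d} f"
        "continuous_on {real j * d..real (Suc j) * d} g"
        using cell continuous_on_subset f g by blast+
      have "integral {real j * d..real (Suc j) * d} (\<lambda>s. (f (\<xi> n j) - f s) * g s)
          = integral {real j * d..real (Suc j) * d} (\<lambda>s. f (\<xi> n j) * g s)
            - integral {real j * d..real (Suc j) * d} (\<lambda>s. f s * g s)"
        unfolding left_diff_distrib
        by (intro Henstock_Kurzweil_Integration.integral_diff integrable_continuous_interval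
              continuous_intros c)
      then show "f (\<xi> n j) * integral {real j * d..real (Suc j) * d} g
             - integral {real j * d..real (Suc j) * d} (\<lambda>s. f s * g s)
           = integral {real j * d..real (Suc j) * d} (\<lambda>s. (f (\<xi> n j) - f s) * g s)"
        by simp
    qed simp
    also have "norm \<dots> \<le> (\<Sum>j<n. e * K * d)"
    proof (rule sum_norm_le)
      fix j assume "j \<in> {..<n}"
      then have j: "j < n" by simp
      have c: "continuous_on {real j * d..real (Suc j) * d} f"
        "continuous_on {real j * d..real (Suc j) * d} g"
        using cell[OF j] continuous_on_subset f g by blast+
      have "norm (integral {real j * d..real (Suc j) * d} (\<lambda>s. (f (\<xi> n j) - f s) * g s))
          \<le> e * K * (real (Suc j) * d - real j * d)"
      proof (rule integral_bound)
        fix s assume s: "s \<in> {real j * d..real (Suc j) * d}"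
        have x: "\<xi> n j \<in> {real j * d..real (Suc j) * d}" using tag[OF j] unfolding rw .
        have "dist (\<xi> n j) s \<le> d"
          using s x by (auto simp: dist_real_def algebra_simps)
        then have "dist (f (\<xi> n j)) (f s) < e"
          using \<delta>(2) s x cell[OF j] d\<delta> by (meson le_less_trans subsetD)
        moreover have "\<bar>g s\<bar> \<le> K" using K s cell[OF j] by blast
        ultimately show "norm ((f (\<xi> n j) - f s) * g s) \<le> e * K"
          unfolding norm_mult by (intro mult_mono) (auto simp: dist_real_def)
      next
        show "continuous_on {real j * d..real (Suc j) * d} (\<lambda>s. (f (\<xi> n j) - f s) * g s)"
          by (intro continuous_intros c)
      qed (use d in \<open>auto intro!: mult_right_mono\<close>)
      then show "norm (integral {real j * d..real (Suc j) * d} (\<lambda>s. (f (\<xi> n j) - f s) * g s)) \<le> e * K * d"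
        by (simp add: algebra_simps)
    qed
    also have "\<dots> = e * K * T" using d by (simp add: mult.left_commute mult.assoc)
    also have "\<dots> = r / 2" using K T by (simp add: e_def)
    also have "\<dots> < r" using r by simp
    finally show "norm ((\<Sum>j<n. f (\<xi> n j) * (G (T * real (Suc j) / real n) - G (T * real j / real n)))
       - integral {0..T} (\<lambda>s. f s * g s)) < r" .
  qed
qed

definition stieltjes_sum :: "(real \<Rightarrow> real) \<Rightarrow> nat \<Rightarrow> nat \<Rightarrow> (real \<Rightarrow> real) \<Rightarrow> real" where
  "stieltjes_sum G T n x =
     (\<Sum>j<n. x (real T * real j / real n) * (G (real T * real (Suc j) / real n) - G (real T * real j / real n)))"

text \<open>The integral of \<open>x\<close> against \<open>dG\<close> over the half-line, written as a limit of finite sums. In this form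
  it is a measurable function on the product space of all paths, with no reference to continuity, which is
  what independence of the two coordinate processes requires. The outer limit runs over the
  positive horizons \<open>Suc T\<close>, so that the grid is never degenerate.\<close>

definition path_functional :: "(real \<Rightarrow> real) \<Rightarrow> (real \<Rightarrow> real) \<Rightarrow> real" where
  "path_functional G x = lim (\<lambda>T. lim (\<lambda>n. stieltjes_sum G (Suc T) n x))"

lemma measurable_stieltjes_sum:
  "stieltjes_sum G T n \<in> borel_measurable (PiM {0..} (\<lambda>_. borel))"
  unfolding stieltjes_sum_def by (intro borel_measurable_sum borel_measurable_times
    measurable_component_singleton borel_measurable_const) simp

lemma measurable_path_functional:
  "path_functional G \<in> borel_measurable (PiM {0..} (\<lambda>_. borel))"
  unfolding path_functional_def using measurable_stieltjes_sum by measurable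

lemma stieltjes_sum_restrict:
  "stieltjes_sum G T n (restrict x {0..}) = stieltjes_sum G T n x"
  unfolding stieltjes_sum_def by (intro sum.cong) auto

lemma path_functional_restrict:
  "path_functional G (restrict x {0..}) = path_functional G x"
  unfolding path_functional_def stieltjes_sum_restrict ..

lemma stieltjes_sum_tendsto:
  assumes x: "continuous_on {0..} x" and g: "continuous_on UNIV g"
    and G: "\<And>s. (G has_real_derivative g s) (at s)"
  shows "(\<lambda>n. stieltjes_sum G (Suc T) n x) \<longlonglongrightarrow> (LINT s:{0..real (Suc T)}|lborel. x s * g s)"
proof -
  have cx: "continuous_on {0..real (Suc T)} x" by (rule continuous_on_subset[OF x]) auto
  have cg: "continuous_on {0..real (Suc T)} g" by (rule continuous_on_subset[OF g]) auto
  have "set_integrable lborel {0..real (Suc T)} (\<lambda>s. x s * g s)"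
    using cx cg unfolding set_integrable_def
    by (intro borel_integrable_compact continuous_on_mult) auto
  then have "(LINT s:{0..real (Suc T)}|lborel. x s * g s) = integral {0..real (Suc T)} (\<lambda>s. x s * g s)"
    by (rule set_borel_integral_eq_integral)
  then show ?thesis
    unfolding stieltjes_sum_def
    using riemann_stieltjes_sum_tendsto[OF _ cx cg, of G "\<lambda>n j. real (Suc T) * real j / real n"] G
    by (auto simp: divide_right_mono mult_left_mono)
qed

lemma path_functional_eq:
  assumes x: "continuous_on {0..} x" and g: "continuous_on UNIV g"
    and G: "\<And>s. (G has_real_derivative g s) (at s)"
    and int: "set_integrable lborel {0..} (\<lambda>s. x s * g s)"
  shows "(\<lambda>T. LINT s:{0..real (Suc T)}|lborel. x s * g s) \<longlonglongrightarrow> path_functional G x"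
    and "path_functional G x = (LINT s:{0..}|lborel. x s * g s)"
proof -
  let ?h = "\<lambda>s. indicator {0..} s *\<^sub>R (x s * g s)"
  have "((\<lambda>y. LINT s|lborel. indicator {..y} s *\<^sub>R ?h s) \<longlongrightarrow> (LINT s|lborel. ?h s)) at_top"
    using int by (intro tendsto_integral_at_top) (auto simp: set_integrable_def)
  moreover have "filterlim (\<lambda>T. real (Suc T)) at_top sequentially"
    using filterlim_Suc filterlim_compose filterlim_real_sequentially by blast
  ultimately have "(\<lambda>T. LINT s|lborel. indicator {..real (Suc T)} s *\<^sub>R ?h s) \<longlonglongrightarrow> (LINT s|lborel. ?h s)"
    by (rule filterlim_compose)
  moreover have "indicator {..real (Suc T)} s *\<^sub>R ?h s = indicator {0..real (Suc T)} s *\<^sub>R (x s * g s)" for T s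
    by (auto simp: indicator_def)
  ultimately have 1: "(\<lambda>T. LINT s:{0..real (Suc T)}|lborel. x s * g s) \<longlonglongrightarrow> (LINT s:{0..}|lborel. x s * g s)"
    unfolding set_lebesgue_integral_def by (simp only:)
  have "lim (\<lambda>n. stieltjes_sum G (Suc T) n x) = (LINT s:{0..real (Suc T)}|lborel. x s * g s)" for T
    by (intro limI stieltjes_sum_tendsto x g G)
  with 1 show "path_functional G x = (LINT s:{0..}|lborel. x s * g s)"
    unfolding path_functional_def by (simp add: limI)
  with 1 show "(\<lambda>T. LINT s:{0..real (Suc T)}|lborel. x s * g s) \<longlonglongrightarrow> path_functional G x"
    by simp
qed

section \<open>Characteristic functions of Brownian functionals\<close>

lemma brownian_path_measurable:
  assumes "standard_brownian_motion M B"
  shows "(\<lambda>\<omega>. restrict (\<lambda>t. B t \<omega>) {0..}) \<in> measurable M (PiM {0..} (\<lambda>_. borel))"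
  using assms by (intro measurable_restrict) (auto simp: standard_brownian_motion_def)

lemma path_functional_random_variable:
  assumes "standard_brownian_motion M B"
  shows "(\<lambda>\<omega>. path_functional G (\<lambda>t. B t \<omega>)) \<in> borel_measurable M"
  using measurable_compose[OF brownian_path_measurable[OF assms] measurable_path_functional[of G]]
  by (simp add: path_functional_restrict)

lemma brownian_increment_char:
  assumes bm: "standard_brownian_motion M B" and st: "0 \<le> s" "s < t"
  shows "(LINT \<omega>|M. exp (\<i> * of_real (c * (B t \<omega> - B s \<omega>)))) = of_real (exp (- (c\<^sup>2 * (t - s)) / 2))"
proof -
  interpret prob_space M using bm by (simp add: standard_brownian_motion_def)
  have B [measurable]: "B t \<in> borel_measurable M" "B s \<in> borel_measurable M"
    using bm st by (auto simp: standard_brownian_motion_def)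
  let ?\<sigma> = "sqrt (t - s)"
  have \<sigma>: "?\<sigma> > 0" using st by simp
  define Z where "Z \<omega> = (B t \<omega> - B s \<omega> - 0) / ?\<sigma>" for \<omega>
  have [measurable]: "Z \<in> borel_measurable M" unfolding Z_def by measurable
  have "distributed M lborel (\<lambda>\<omega>. B t \<omega> - B s \<omega>) (normal_density 0 ?\<sigma>)"
    using bm st by (auto simp: standard_brownian_motion_def)
  then have "distributed M lborel Z std_normal_density"
    unfolding Z_def by (rule iffD1[OF normal_standard_normal_convert[OF \<sigma>]])
  then have "distr M borel Z = std_normal_distribution"
    using distributed_distr_eq_density[of M lborel Z] by (simp cong: distr_cong)
  moreover have "char (distr M borel Z) (c * ?\<sigma>)
      = (LINT \<omega>|M. exp (\<i> * of_real (c * (B t \<omega> - B s \<omega>))))"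
    using \<sigma> by (simp add: char_def integral_distr Z_def)
  ultimately show ?thesis
    using st by (simp add: char_std_normal_distribution power_mult_distrib)
qed

text \<open>Abel summation turns values of the path into increments, which are independent for Brownian motion.\<close>

lemma stieltjes_sum_by_parts:
  "stieltjes_sum G T n x =
     (\<Sum>j<n. (G (real T * real n / real n) - G (real T * real (Suc j) / real n))
              * (x (real T * real (Suc j) / real n) - x (real T * real j / real n)))
     + x 0 * (G (real T * real n / real n) - G 0)"
proof -
  define y where "y j = x (real T * real j / real n)" for j
  define h where "h j = G (real T * real j / real n)" for j
  have "(\<Sum>j<m. y j * (h (Suc j) - h j)) =
      (\<Sum>j<m. (h n - h (Suc j)) * (y (Suc j) - y j)) + y 0 * (h n - h 0) - y m * (h n - h m)" for m
    by (induction m) (auto simp: algebra_simps)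
  from this[of n] have "(\<Sum>j<n. y j * (h (Suc j) - h j)) =
      (\<Sum>j<n. (h n - h (Suc j)) * (y (Suc j) - y j)) + y 0 * (h n - h 0)" by simp
  then show ?thesis by (simp add: stieltjes_sum_def y_def h_def)
qed

text \<open>After summation by parts the sum is a linear combination of independent centred normal increments,
  so its characteristic function is a product of Gaussian factors.\<close>

lemma brownian_stieltjes_sum_char:
  assumes bm: "standard_brownian_motion M B" and T: "T > 0"
  shows "(LINT \<omega>|M. exp (\<i> * of_real (stieltjes_sum G T n (\<lambda>t. B t \<omega>))))
    = of_real (exp (- (\<Sum>j<n. (G (real T) - G (real T * real (Suc j) / real n))\<^sup>2
           * (real T * real (Suc j) / real n - real T * real j / real n)) / 2))"
proof (cases "n = 0")
  case True
  interpret prob_space M using bm by (simp add: standard_brownian_motion_def)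
  show ?thesis using True prob_space by (simp add: stieltjes_sum_def)
next
  case False
  interpret prob_space M using bm by (simp add: standard_brownian_motion_def)
  define t where "t j = real T * real j / real n" for j
  define c where "c j = G (real T) - G (t (Suc j))" for j
  define X where "X j \<omega> = c j * (B (t (Suc j)) \<omega> - B (t j) \<omega>)" for j \<omega>
  have t: "0 \<le> t j" "t j < t (Suc j)" for j using T False by (auto simp: t_def divide_strict_right_mono)
  have B [measurable]: "B (t j) \<in> borel_measurable M" for j
    using bm t by (auto simp: standard_brownian_motion_def)
  have Xm [measurable]: "X j \<in> borel_measurable M" for j unfolding X_def by measurable
  have "indep_vars (\<lambda>_. borel) (\<lambda>i \<omega>. B (t (Suc i)) \<omega> - B (t i) \<omega>) {..<n}"
    using bm t unfolding standard_brownian_motion_def by blast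
  then have ind: "indep_vars (\<lambda>_. borel) X {..<n}"
    unfolding X_def by (rule indep_vars_compose2) simp
  have "AE \<omega> in M. B 0 \<omega> = 0" using bm by (auto simp: standard_brownian_motion_def)
  then have eq: "AE \<omega> in M. stieltjes_sum G T n (\<lambda>t. B t \<omega>) = (\<Sum>j<n. X j \<omega>)"
  proof eventually_elim
    case (elim \<omega>)
    then show ?case using False by (simp add: stieltjes_sum_by_parts X_def c_def t_def)
  qed
  have meas: "(\<lambda>\<omega>. stieltjes_sum G T n (\<lambda>t. B t \<omega>)) \<in> borel_measurable M"
    using measurable_compose[OF brownian_path_measurable[OF bm] measurable_stieltjes_sum[of G T n]]
    by (simp add: stieltjes_sum_restrict)
  have "(LINT \<omega>|M. exp (\<i> * of_real (stieltjes_sum G T n (\<lambda>t. B t \<omega>))))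
      = (LINT \<omega>|M. exp (\<i> * of_real (\<Sum>j<n. X j \<omega>)))"
    using eq meas by (intro integral_cong_AE) auto
  also have "\<dots> = char (distr M borel (\<lambda>\<omega>. \<Sum>j<n. X j \<omega>)) 1"
    by (simp add: char_def integral_distr)
  also have "\<dots> = (\<Prod>j<n. char (distr M borel (X j)) 1)" by (rule char_distr_sum[OF ind])
  also have "\<dots> = (\<Prod>j<n. of_real (exp (- ((c j)\<^sup>2 * (t (Suc j) - t j)) / 2)))"
  proof (rule prod.cong)
    fix j
    have "char (distr M borel (X j)) 1
        = (LINT \<omega>|M. exp (\<i> * of_real (c j * (B (t (Suc j)) \<omega> - B (t j) \<omega>))))"
      by (simp add: char_def integral_distr X_def)
    then show "char (distr M borel (X j)) 1 = of_real (exp (- ((c j)\<^sup>2 * (t (Suc j) - t j)) / 2))"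
      using brownian_increment_char[OF bm t, of "c j" j] by simp
  qed simp
  also have "\<dots> = of_real (exp (\<Sum>j<n. - ((c j)\<^sup>2 * (t (Suc j) - t j)) / 2))"
    by (simp add: exp_sum del: of_real_exp)
  also have "(\<Sum>j<n. - ((c j)\<^sup>2 * (t (Suc j) - t j)) / 2) = - (\<Sum>j<n. (c j)\<^sup>2 * (t (Suc j) - t j)) / 2"
    by (simp add: sum_negf sum_divide_distrib)
  finally show ?thesis by (simp only: c_def t_def)
qed

text \<open>Letting the mesh tend to 0 and then the horizon \<open>T\<close> tend to infinity, the variance of the approximating
  sums tends first to the integral of \<open>(G(T) - G)\<^sup>2\<close> over \<open>[0, T]\<close>. Only the part over \<open>[0, 1]\<close> is kept:
  it already suffices for non-degeneracy, and there the limit in \<open>T\<close> needs nothing but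
  \<open>G(T) \<longlonglongrightarrow> 0\<close>.\<close>

lemma brownian_functional_char_bound:
  assumes bm: "standard_brownian_motion M B"
    and g: "continuous_on UNIV g" and G: "\<And>s. (G has_real_derivative g s) (at s)"
    and G0: "(G \<longlongrightarrow> 0) at_top"
    and int: "AE \<omega> in M. set_integrable lborel {0..} (\<lambda>s. B s \<omega> * g s)"
  shows "norm (LINT \<omega>|M. exp (\<i> * of_real (path_functional G (\<lambda>t. B t \<omega>))))
    \<le> exp (- integral {0..1} (\<lambda>s. (G s)\<^sup>2) / 2)"
proof -
  interpret prob_space M using bm by (simp add: standard_brownian_motion_def)
  have cont: "AE \<omega> in M. continuous_on {0..} (\<lambda>t. B t \<omega>)"
    using bm by (auto simp: standard_brownian_motion_def)
  have cG: "continuous_on S G" for S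
    using G DERIV_isCont continuous_at_imp_continuous_on by blast
  \<comment> \<open>The functional truncated at the horizon \<open>Suc T\<close>.\<close>
  define \<Phi> where "\<Phi> T x = lim (\<lambda>n. stieltjes_sum G (Suc T) n x)" for T x
  have smeas: "(\<lambda>\<omega>. stieltjes_sum G T n (\<lambda>t. B t \<omega>)) \<in> borel_measurable M" for T n
    using measurable_compose[OF brownian_path_measurable[OF bm] measurable_stieltjes_sum[of G T n]]
    by (simp add: stieltjes_sum_restrict)
  then have pmeas: "(\<lambda>\<omega>. \<Phi> T (\<lambda>t. B t \<omega>)) \<in> borel_measurable M" for T
    unfolding \<Phi>_def by measurable
  note fmeas = path_functional_random_variable[OF bm, of G]
  have limn: "AE \<omega> in M. \<forall>T. (\<lambda>n. stieltjes_sum G (Suc T) n (\<lambda>t. B t \<omega>)) \<longlonglongrightarrow> \<Phi> T (\<lambda>t. B t \<omega>)"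
    using cont
  proof eventually_elim
    case (elim \<omega>)
    show ?case
      using stieltjes_sum_tendsto[OF elim g G] unfolding \<Phi>_def by (metis limI)
  qed
  have limT: "AE \<omega> in M. (\<lambda>T. \<Phi> T (\<lambda>t. B t \<omega>)) \<longlonglongrightarrow> path_functional G (\<lambda>t. B t \<omega>)"
    using cont int
  proof eventually_elim
    case (elim \<omega>)
    have "\<Phi> T (\<lambda>t. B t \<omega>) = (LINT s:{0..real (Suc T)}|lborel. B s \<omega> * g s)" for T
      unfolding \<Phi>_def by (intro limI stieltjes_sum_tendsto elim g G)
    then show ?case using path_functional_eq(1)[OF elim(1) g G elim(2)] by simp
  qed
  have char_T: "norm (LINT \<omega>|M. exp (\<i> * of_real (\<Phi> T (\<lambda>t. B t \<omega>))))
      \<le> exp (- integral {0..1} (\<lambda>s. (G (real (Suc T)) - G s)\<^sup>2) / 2)" for T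
  proof -
    let ?v = "\<lambda>s. (G (real (Suc T)) - G s)\<^sup>2"
    have cv: "continuous_on S ?v" for S by (intro continuous_intros cG)
    have "(\<lambda>n. LINT \<omega>|M. exp (\<i> * of_real (stieltjes_sum G (Suc T) n (\<lambda>t. B t \<omega>))))
        \<longlonglongrightarrow> (LINT \<omega>|M. exp (\<i> * of_real (\<Phi> T (\<lambda>t. B t \<omega>))))"
    proof (rule integral_dominated_convergence[where w="\<lambda>_. 1"])
      show "AE \<omega> in M. (\<lambda>n. exp (\<i> * of_real (stieltjes_sum G (Suc T) n (\<lambda>t. B t \<omega>))))
          \<longlonglongrightarrow> exp (\<i> * of_real (\<Phi> T (\<lambda>t. B t \<omega>)))"
        using limn by eventually_elim (intro tendsto_intros, blast)
    qed (use smeas pmeas in auto)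
    moreover have "(\<lambda>n. of_real (exp (- (\<Sum>j<n. ?v (real (Suc T) * real (Suc j) / real n)
           * (real (Suc T) * real (Suc j) / real n - real (Suc T) * real j / real n)) / 2)))
        \<longlonglongrightarrow> (of_real (exp (- integral {0..real (Suc T)} (\<lambda>s. ?v s * 1) / 2)) :: complex)"
      by (intro tendsto_of_real tendsto_exp tendsto_divide tendsto_minus tendsto_const
            riemann_stieltjes_sum_tendsto cv) (auto simp: divide_right_mono mult_left_mono)
    ultimately have "(LINT \<omega>|M. exp (\<i> * of_real (\<Phi> T (\<lambda>t. B t \<omega>))))
        = of_real (exp (- integral {0..real (Suc T)} ?v / 2))"
      unfolding brownian_stieltjes_sum_char[OF bm zero_less_Suc] by (simp only: mult_1_right LIMSEQ_unique)
    moreover have "integral {0..1} ?v \<le> integral {0..real (Suc T)} ?v"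
      by (intro integral_subset_le integrable_continuous_interval cv) auto
    ultimately show ?thesis by (simp del: of_real_exp)
  qed
  have "(\<lambda>T. norm (LINT \<omega>|M. exp (\<i> * of_real (\<Phi> T (\<lambda>t. B t \<omega>)))))
      \<longlonglongrightarrow> norm (LINT \<omega>|M. exp (\<i> * of_real (path_functional G (\<lambda>t. B t \<omega>))))"
  proof (rule tendsto_norm, rule integral_dominated_convergence[where w="\<lambda>_. 1"])
    show "AE \<omega> in M. (\<lambda>T. exp (\<i> * of_real (\<Phi> T (\<lambda>t. B t \<omega>))))
        \<longlonglongrightarrow> exp (\<i> * of_real (path_functional G (\<lambda>t. B t \<omega>)))"
      using limT by eventually_elim (intro tendsto_intros)
  qed (use fmeas pmeas in auto)
  moreover have "(\<lambda>T. exp (- integral {0..1} (\<lambda>s. (G (real (Suc T)) - G s)\<^sup>2) / 2))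
      \<longlonglongrightarrow> exp (- integral {0..1} (\<lambda>s. (G s)\<^sup>2) / 2)"
  proof -
    \<comment> \<open>Expanding the square shows the dependence on \<open>c = G (Suc T)\<close>, which tends to 0.\<close>
    have "integral {0..1} (\<lambda>s. (c - G s)\<^sup>2)
        = c\<^sup>2 - 2 * c * integral {0..1} G + integral {0..1} (\<lambda>s. (G s)\<^sup>2)" for c
    proof -
      have "((\<lambda>s. c\<^sup>2 - 2 * c * G s + (G s)\<^sup>2) has_integral
          c\<^sup>2 * (1 - 0) - 2 * c * integral {0..1} G + integral {0..1} (\<lambda>s. (G s)\<^sup>2)) {0..1}"
        using has_integral_const_real[of "c\<^sup>2" 0 1]
        by (intro has_integral_add has_integral_diff has_integral_mult_right integrable_integral
              integrable_continuous_interval continuous_intros cG) auto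
      then show ?thesis by (simp add: integral_unique power2_diff algebra_simps)
    qed
    moreover have "(\<lambda>T. G (real (Suc T))) \<longlonglongrightarrow> 0"
      using filterlim_compose[OF G0, of "\<lambda>T. real (Suc T)" sequentially]
        filterlim_compose[OF filterlim_real_sequentially filterlim_Suc] by auto
    ultimately show ?thesis by (auto intro!: tendsto_eq_intros)
  qed
  ultimately show ?thesis using char_T by (intro LIMSEQ_le[of _ _ _ ]) auto
qed

section \<open>Gaussian integrability of Brownian paths\<close>

lemma integrable_gaussian_power:
  fixes \<delta> :: real
  assumes "\<delta> > 0"
  shows "integrable lborel (\<lambda>s. exp (- \<delta> * s\<^sup>2) * \<bar>s\<bar>^k)"
proof -
  define \<sigma> where "\<sigma> = sqrt (1 / (2 * \<delta>))"
  have \<sigma>0: "\<sigma> > 0" using assms by (simp add: \<sigma>_def)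
  have \<sigma>2: "\<sigma>\<^sup>2 = 1 / (2 * \<delta>)" using assms by (simp add: \<sigma>_def)
  have "exp (- \<delta> * s\<^sup>2) * \<bar>s\<bar>^k = sqrt (2 * pi * \<sigma>\<^sup>2) * (normal_density 0 \<sigma> s * \<bar>s - 0\<bar>^k)" for s
    using assms by (simp add: normal_density_def \<sigma>2)
  then show ?thesis
    using integrable_mult_right[of "sqrt (2 * pi * \<sigma>\<^sup>2)", OF integrable_normal_moment_abs[of \<sigma> 0 k]]
      \<sigma>0 by (simp only:)
qed

lemma brownian_first_moment_bound:
  assumes bm: "standard_brownian_motion M B" and t: "t \<ge> 0"
  shows "(\<integral>\<^sup>+\<omega>. ennreal \<bar>B t \<omega>\<bar> \<partial>M) \<le> ennreal (1 + t)"
proof (cases "t = 0")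
  case True
  have "AE \<omega> in M. B 0 \<omega> = 0" using bm by (auto simp: standard_brownian_motion_def)
  then have "AE \<omega> in M. ennreal \<bar>B t \<omega>\<bar> = 0" using True by auto
  then have "(\<integral>\<^sup>+\<omega>. ennreal \<bar>B t \<omega>\<bar> \<partial>M) = (\<integral>\<^sup>+\<omega>. 0 \<partial>M)" by (rule nn_integral_cong_AE)
  then show ?thesis by simp
next
  case False
  with t have t: "t > 0" by simp
  let ?d = "normal_density 0 (sqrt t)"
  have D: "distributed M lborel (\<lambda>\<omega>. B t \<omega> - B 0 \<omega>) ?d"
  proof -
    have "distributed M lborel (\<lambda>\<omega>. B t \<omega> - B 0 \<omega>) (normal_density 0 (sqrt (t - 0)))"
      using bm t unfolding standard_brownian_motion_def by blast
    then show ?thesis by simp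
  qed
  have "AE \<omega> in M. B 0 \<omega> = 0" using bm by (auto simp: standard_brownian_motion_def)
  then have "AE \<omega> in M. ennreal \<bar>B t \<omega>\<bar> = ennreal \<bar>B t \<omega> - B 0 \<omega>\<bar>" by eventually_elim simp
  then have "(\<integral>\<^sup>+\<omega>. ennreal \<bar>B t \<omega>\<bar> \<partial>M) = (\<integral>\<^sup>+\<omega>. ennreal \<bar>B t \<omega> - B 0 \<omega>\<bar> \<partial>M)"
    by (rule nn_integral_cong_AE)
  also have "\<dots> = (\<integral>\<^sup>+x. ennreal (?d x) * ennreal \<bar>x\<bar> \<partial>lborel)"
    by (rule distributed_nn_integral[OF D, symmetric]) simp
  also have "\<dots> \<le> (\<integral>\<^sup>+x. ennreal (?d x + ?d x * (x - 0)^(2 * 1)) \<partial>lborel)"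
  proof (intro nn_integral_mono)
    fix x :: real
    \<comment> \<open>The first absolute moment is bounded crudely through the second moment.\<close>
    have "2 * \<bar>x\<bar> \<le> 1 + x\<^sup>2" using zero_le_power2[of "\<bar>x\<bar> - 1"] by (simp add: power2_diff)
    then have "\<bar>x\<bar> \<le> 1 + x\<^sup>2" using zero_le_power2[of x] by linarith
    then have "?d x * \<bar>x\<bar> \<le> ?d x * (1 + x\<^sup>2)" by (intro mult_left_mono) (auto simp: normal_density_nonneg)
    then show "ennreal (?d x) * ennreal \<bar>x\<bar> \<le> ennreal (?d x + ?d x * (x - 0)^(2 * 1))"
      by (simp add: ennreal_mult[symmetric] normal_density_nonneg distrib_left ennreal_leI
          del: ennreal_plus)
  qed
  also have "\<dots> = ennreal (1 + t)"
  proof (rule nn_integral_eq_integrable[THEN iffD2])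
    have "has_bochner_integral lborel ?d 1"
      using t by (simp add: has_bochner_integral_iff integrable_normal_density integral_normal_density)
    moreover have "has_bochner_integral lborel (\<lambda>x. ?d x * (x - 0)^(2 * 1)) t"
      using normal_moment_even[of "sqrt t" 0 1] t by (simp add: fact_numeral)
    ultimately have "has_bochner_integral lborel (\<lambda>x. ?d x + ?d x * (x - 0)^(2 * 1)) (1 + t)"
      by (rule has_bochner_integral_add)
    then show "integrable lborel (\<lambda>x. ?d x + ?d x * (x - 0)^(2 * 1)) \<and>
        integral\<^sup>L lborel (\<lambda>x. ?d x + ?d x * (x - 0)^(2 * 1)) = 1 + t"
      by (simp add: has_bochner_integral_iff)
  qed (use t in \<open>auto simp: normal_density_nonneg\<close>)
  finally show ?thesis .
qed

text \<open>The expectation of the integral of \<open>exp (- \<delta> s\<^sup>2) \<bar>B s\<bar>\<close> should be finite by Tonelli's theorem. Since the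
  process is only known to be measurable at each fixed time, the theorem is applied to step functions in time,
  which are jointly measurable; continuity of the paths and Fatou's lemma, used once over \<open>\<omega>\<close> and once over \<open>s\<close>,
  then give the result for \<open>B\<close>. The values \<open>\<delta> = 1 / Suc m\<close> suffice because the weights decrease in \<open>\<delta>\<close>.\<close>

lemma brownian_gaussian_integrable:
  assumes bm: "standard_brownian_motion M B"
  shows "AE \<omega> in M. \<forall>\<delta>>0. set_integrable lborel {0..} (\<lambda>s. exp (- \<delta> * s\<^sup>2) * B s \<omega>)"
proof -
  interpret prob_space M using bm by (simp add: standard_brownian_motion_def)
  interpret P: pair_sigma_finite lborel M ..
  \<comment> \<open>The last point of the grid of mesh \<open>1 / Suc n\<close> before \<open>s\<close>.\<close>
  define step where "step n s = real (nat \<lfloor>s * real (Suc n)\<rfloor>) / real (Suc n)" for n s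
  have step_le: "0 \<le> step n s" "step n s \<le> s" if "s \<ge> 0" for n s
    using that by (auto simp: step_def divide_le_eq)
  have step_lim: "(\<lambda>n. step n s) \<longlonglongrightarrow> s" if "s \<ge> 0" for s
  proof (rule tendsto_sandwich[of "\<lambda>n. s - inverse (real (Suc n))" _ _ "\<lambda>_. s"])
    have "s - inverse (real (Suc n)) \<le> step n s" for n
    proof -
      have "s * real (Suc n) - 1 \<le> real (nat \<lfloor>s * real (Suc n)\<rfloor>)" by linarith
      then have "(s * real (Suc n) - 1) / real (Suc n) \<le> step n s"
        unfolding step_def by (intro divide_right_mono) auto
      then show ?thesis by (simp add: diff_divide_distrib inverse_eq_divide)
    qed
    then show "\<forall>\<^sub>F n in sequentially. s - inverse (real (Suc n)) \<le> step n s" by simp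
    show "(\<lambda>n. s - inverse (real (Suc n))) \<longlonglongrightarrow> s"
      using tendsto_diff[OF tendsto_const LIMSEQ_inverse_real_of_nat, of s] by simp
  qed (use step_le that in auto)
  have fixed: "AE \<omega> in M. set_integrable lborel {0..} (\<lambda>s. exp (- \<delta> * s\<^sup>2) * B s \<omega>)" if \<delta>: "\<delta> > 0" for \<delta>
  proof -
    define h where "h n s \<omega> = indicator {0..} s * (ennreal (exp (- \<delta> * s\<^sup>2)) * ennreal \<bar>B (step n s) \<omega>\<bar>)" for n s \<omega>
    have Bk: "B (real k / real (Suc n)) \<in> borel_measurable M" for k n
      using bm by (auto simp: standard_brownian_motion_def)
    have "(\<lambda>p. (\<lambda>k p. \<bar>B (real k / real (Suc n)) (snd p)\<bar>) (nat \<lfloor>fst p * real (Suc n)\<rfloor>) p)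
        \<in> borel_measurable (lborel \<Otimes>\<^sub>M M)" for n
    proof (rule measurable_compose_countable[where g="\<lambda>p. nat \<lfloor>fst p * real (Suc n)\<rfloor>"])
      show "(\<lambda>p. \<bar>B (real k / real (Suc n)) (snd p)\<bar>) \<in> borel_measurable (lborel \<Otimes>\<^sub>M M)" for k
        using measurable_compose[OF measurable_snd Bk] by measurable
    qed measurable
    then have [measurable]: "(\<lambda>p. \<bar>B (step n (fst p)) (snd p)\<bar>) \<in> borel_measurable (lborel \<Otimes>\<^sub>M M)" for n
      by (simp add: step_def)
    have hm [measurable]: "(\<lambda>(s, \<omega>). h n s \<omega>) \<in> borel_measurable (lborel \<Otimes>\<^sub>M M)" for n
      unfolding h_def case_prod_beta by measurable
    have hint [measurable]: "(\<lambda>\<omega>. \<integral>\<^sup>+s. h n s \<omega> \<partial>lborel) \<in> borel_measurable M" for n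
      by (rule lborel.borel_measurable_nn_integral)
        (use measurable_compose[OF measurable_pair_swap' hm[of n]] in \<open>simp add: case_prod_beta\<close>)
    define C where "C = (\<integral>\<^sup>+s. ennreal (exp (- \<delta> * s\<^sup>2) * \<bar>s\<bar>^0 + exp (- \<delta> * s\<^sup>2) * \<bar>s\<bar>^1) \<partial>lborel)"
    have C: "C < \<infinity>"
    proof -
      have "integrable lborel (\<lambda>s. exp (- \<delta> * s\<^sup>2) * \<bar>s\<bar>^0 + exp (- \<delta> * s\<^sup>2) * \<bar>s\<bar>^1)"
        by (intro Bochner_Integration.integrable_add integrable_gaussian_power \<delta>)
      then show ?thesis unfolding C_def by (subst nn_integral_eq_integral) auto
    qed
    have bound: "(\<integral>\<^sup>+\<omega>. (\<integral>\<^sup>+s. h n s \<omega> \<partial>lborel) \<partial>M) \<le> C" for n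
    proof -
      have "(\<integral>\<^sup>+\<omega>. (\<integral>\<^sup>+s. h n s \<omega> \<partial>lborel) \<partial>M) = (\<integral>\<^sup>+s. (\<integral>\<^sup>+\<omega>. h n s \<omega> \<partial>M) \<partial>lborel)"
        by (rule P.Fubini') simp
      also have "\<dots> \<le> C" unfolding C_def
      proof (rule nn_integral_mono)
        fix s :: real
        show "(\<integral>\<^sup>+\<omega>. h n s \<omega> \<partial>M) \<le> ennreal (exp (- \<delta> * s\<^sup>2) * \<bar>s\<bar>^0 + exp (- \<delta> * s\<^sup>2) * \<bar>s\<bar>^1)"
        proof (cases "s \<ge> 0")
          case True
          have [measurable]: "B (step n s) \<in> borel_measurable M" unfolding step_def by (rule Bk)
          have "(\<integral>\<^sup>+\<omega>. h n s \<omega> \<partial>M) = ennreal (exp (- \<delta> * s\<^sup>2)) * (\<integral>\<^sup>+\<omega>. ennreal \<bar>B (step n s) \<omega>\<bar> \<partial>M)"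
            using True by (simp add: h_def nn_integral_cmult)
          also have "\<dots> \<le> ennreal (exp (- \<delta> * s\<^sup>2)) * ennreal (1 + s)"
            using order_trans[OF brownian_first_moment_bound[OF bm step_le(1)[OF True]] ennreal_leI]
              step_le(2)[OF True] by (intro mult_left_mono) auto
          finally show ?thesis using True by (simp add: ennreal_mult[symmetric] distrib_left)
        qed (simp add: h_def)
      qed
      finally show ?thesis .
    qed
    have "(\<integral>\<^sup>+\<omega>. liminf (\<lambda>n. \<integral>\<^sup>+s. h n s \<omega> \<partial>lborel) \<partial>M) \<le> liminf (\<lambda>n. \<integral>\<^sup>+\<omega>. (\<integral>\<^sup>+s. h n s \<omega> \<partial>lborel) \<partial>M)"
      by (rule nn_integral_liminf) (rule hint)
    also have "\<dots> \<le> liminf (\<lambda>n. C)" by (intro Liminf_mono) (simp add: bound)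
    also have "\<dots> = C" by (rule lim_imp_Liminf) auto
    finally have "(\<integral>\<^sup>+\<omega>. liminf (\<lambda>n. \<integral>\<^sup>+s. h n s \<omega> \<partial>lborel) \<partial>M) \<noteq> \<infinity>"
      using C by (metis infinity_ennreal_def leD top.not_eq_extremum)
    then have "AE \<omega> in M. liminf (\<lambda>n. \<integral>\<^sup>+s. h n s \<omega> \<partial>lborel) \<noteq> \<infinity>"
      by (intro nn_integral_PInf_AE borel_measurable_liminf) (rule hint)
    moreover have "AE \<omega> in M. continuous_on {0..} (\<lambda>t. B t \<omega>)"
      using bm by (auto simp: standard_brownian_motion_def)
    ultimately show ?thesis using AE_space
    proof eventually_elim
      case (elim \<omega>)
      have hs [measurable]: "(\<lambda>s. h n s \<omega>) \<in> borel_measurable lborel" for n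
        using measurable_compose[OF measurable_Pair2'[OF elim(3)] hm[of n]] by simp
      have meas: "(\<lambda>s. indicator {0..} s *\<^sub>R (exp (- \<delta> * s\<^sup>2) * B s \<omega>)) \<in> borel_measurable borel"
        by (intro borel_measurable_continuous_on_indicator continuous_intros elim) auto
      have "(\<integral>\<^sup>+s. ennreal (norm (indicator {0..} s *\<^sub>R (exp (- \<delta> * s\<^sup>2) * B s \<omega>))) \<partial>lborel)
          \<le> (\<integral>\<^sup>+s. liminf (\<lambda>n. h n s \<omega>) \<partial>lborel)"
      proof (rule nn_integral_mono)
        fix s :: real
        show "ennreal (norm (indicator {0..} s *\<^sub>R (exp (- \<delta> * s\<^sup>2) * B s \<omega>))) \<le> liminf (\<lambda>n. h n s \<omega>)"
        proof (cases "s \<ge> 0")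
          case True
          have "(\<lambda>n. B (step n s) \<omega>) \<longlonglongrightarrow> B s \<omega>"
            using True step_le[OF True]
            by (intro continuous_on_tendsto_compose[OF elim(2) step_lim]) auto
          then have "(\<lambda>n. ennreal (exp (- \<delta> * s\<^sup>2) * \<bar>B (step n s) \<omega>\<bar>)) \<longlonglongrightarrow> ennreal (exp (- \<delta> * s\<^sup>2) * \<bar>B s \<omega>\<bar>)"
            by (intro tendsto_intros)
          then have "(\<lambda>n. h n s \<omega>) \<longlonglongrightarrow> ennreal (norm (indicator {0..} s *\<^sub>R (exp (- \<delta> * s\<^sup>2) * B s \<omega>)))"
            using True by (simp add: h_def ennreal_mult[symmetric] abs_mult)
          then show ?thesis by (simp add: lim_imp_Liminf)
        qed simp
      qed
      also have "\<dots> \<le> liminf (\<lambda>n. \<integral>\<^sup>+s. h n s \<omega> \<partial>lborel)"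
        by (rule nn_integral_liminf) simp
      also have "\<dots> < \<infinity>" using elim(1) by (simp add: top.not_eq_extremum)
      finally show ?case unfolding set_integrable_def
        using meas by (intro integrableI_bounded) auto
    qed
  qed
  have "AE \<omega> in M. \<forall>m. set_integrable lborel {0..} (\<lambda>s. exp (- (1 / real (Suc m)) * s\<^sup>2) * B s \<omega>)"
    unfolding AE_all_countable by (intro allI fixed) simp
  then show ?thesis
  proof eventually_elim
    case (elim \<omega>)
    show ?case
    proof (intro allI impI)
      fix \<delta> :: real assume \<delta>: "\<delta> > 0"
      obtain m where m: "1 / real (Suc m) < \<delta>" using \<delta> nat_approx_posE by blast
      have intm: "integrable lborel (\<lambda>s. indicator {0..} s *\<^sub>R (exp (- (1 / real (Suc m)) * s\<^sup>2) * B s \<omega>))"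
        using elim unfolding set_integrable_def by blast
      then have "integrable lborel (\<lambda>s. exp (- (\<delta> - 1 / real (Suc m)) * s\<^sup>2) *
           (indicator {0..} s *\<^sub>R (exp (- (1 / real (Suc m)) * s\<^sup>2) * B s \<omega>)))"
      proof (rule Bochner_Integration.integrable_bound)
        have "(\<lambda>s. indicator {0..} s *\<^sub>R (exp (- (1 / real (Suc m)) * s\<^sup>2) * B s \<omega>)) \<in> borel_measurable lborel"
          by (rule borel_measurable_integrable[OF intm])
        then show "(\<lambda>s. exp (- (\<delta> - 1 / real (Suc m)) * s\<^sup>2) *
           (indicator {0..} s *\<^sub>R (exp (- (1 / real (Suc m)) * s\<^sup>2) * B s \<omega>))) \<in> borel_measurable lborel"
          by measurable
        have "exp (- (\<delta> - 1 / real (Suc m)) * s\<^sup>2) \<le> 1" for s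
          using m by (simp add: mult_nonpos_nonneg)
        then show "AE s in lborel. norm (exp (- (\<delta> - 1 / real (Suc m)) * s\<^sup>2) *
           (indicator {0..} s *\<^sub>R (exp (- (1 / real (Suc m)) * s\<^sup>2) * B s \<omega>)))
           \<le> norm (indicator {0..} s *\<^sub>R (exp (- (1 / real (Suc m)) * s\<^sup>2) * B s \<omega>))"
          unfolding norm_mult by (intro AE_I2 mult_left_le_one_le) auto
      qed
      moreover have "exp (- (\<delta> - 1 / real (Suc m)) * s\<^sup>2) *
           (indicator {0..} s *\<^sub>R (exp (- (1 / real (Suc m)) * s\<^sup>2) * B s \<omega>))
          = indicator {0..} s *\<^sub>R (exp (- \<delta> * s\<^sup>2) * B s \<omega>)" for s
      proof -
        have "exp (- \<delta> * s\<^sup>2) = exp (- (\<delta> - 1 / real (Suc m)) * s\<^sup>2) * exp (- (1 / real (Suc m)) * s\<^sup>2)"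
          unfolding exp_add[symmetric] by (simp add: algebra_simps)
        then show ?thesis by simp
      qed
      ultimately show "set_integrable lborel {0..} (\<lambda>s. exp (- \<delta> * s\<^sup>2) * B s \<omega>)"
        unfolding set_integrable_def by (simp only:)
    qed
  qed
qed

section \<open>Small-ball estimates\<close>

lemma std_normal_integral_iexp:
  "(LINT u|std_normal_distribution. exp (\<i> * of_real (u * x))) = of_real (exp (- x\<^sup>2 / 2))"
  using fun_cong[OF char_std_normal_distribution, of x] by (simp add: char_def mult.commute)

text \<open>Up to the factor \<open>1 / sqrt (1 + a)\<close>, the integrand is again a normal density.\<close>

lemma std_normal_integral_gaussian:
  assumes a: "a \<ge> 0"
  shows "(LINT u|std_normal_distribution. exp (- a * u\<^sup>2 / 2)) = 1 / sqrt (1 + a)"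
proof -
  have eq: "std_normal_density u * exp (- a * u\<^sup>2 / 2)
      = normal_density 0 (1 / sqrt (1 + a)) u / sqrt (1 + a)" for u
  proof -
    have "exp (- u\<^sup>2 / 2) * exp (- a * u\<^sup>2 / 2) = exp (- (u - 0)\<^sup>2 / (2 * (1 / sqrt (1 + a))\<^sup>2))"
      using a by (simp add: exp_add[symmetric] power_divide field_simps)
    moreover have "sqrt (2 * pi * (1 / sqrt (1 + a))\<^sup>2) * sqrt (1 + a) = sqrt (2 * pi)"
      using a by (simp add: real_sqrt_mult real_sqrt_divide power_divide)
    ultimately show ?thesis
      unfolding normal_density_def std_normal_density_def by (simp add: field_simps)
  qed
  have "(LINT u|std_normal_distribution. exp (- a * u\<^sup>2 / 2))
      = (LINT u|lborel. std_normal_density u * exp (- a * u\<^sup>2 / 2))"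
    by (subst integral_density) (auto simp: normal_density_nonneg)
  also have "\<dots> = (LINT u|lborel. normal_density 0 (1 / sqrt (1 + a)) u) / sqrt (1 + a)"
    unfolding eq by simp
  also have "(LINT u|lborel. normal_density 0 (1 / sqrt (1 + a)) u) = 1"
    using a by (intro integral_normal_density) auto
  finally show ?thesis .
qed

text \<open>The Gaussian \<open>exp (- x\<^sup>2 / (2 \<epsilon>\<^sup>2))\<close> is the average of \<open>exp (i u x / \<epsilon>)\<close> over a standard normal \<open>u\<close>. Exchanging
  the two expectations leaves the average of the characteristic function of \<open>(X, Y)\<close> at \<open>(u, v) / \<epsilon>\<close>, which is at
  most \<open>1 / (1 + m / \<epsilon>\<^sup>2)\<close>.\<close>

lemma (in prob_space) small_ball_from_characteristic_function:
  fixes X Y :: "'a \<Rightarrow> real"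
  assumes [measurable]: "random_variable borel X" "random_variable borel Y"
    and m: "m > 0" and e: "\<epsilon> > 0"
    and char: "\<And>u v. norm (expectation (\<lambda>\<omega>. exp (\<i> * of_real (u * X \<omega> + v * Y \<omega>))))
                      \<le> exp (- (m * (u\<^sup>2 + v\<^sup>2)) / 2)"
  shows "expectation (\<lambda>\<omega>. exp (- ((X \<omega>)\<^sup>2 + (Y \<omega>)\<^sup>2) / (2 * \<epsilon>\<^sup>2))) \<le> \<epsilon>\<^sup>2 / m"
proof -
  let ?N = "std_normal_distribution"
  interpret N: real_distribution ?N by (rule real_dist_normal_dist)
  interpret NN: pair_prob_space ?N ?N ..
  interpret P: pair_prob_space "?N \<Otimes>\<^sub>M ?N" M ..
  have [measurable_cong]: "sets ?N = sets borel" by simp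
  \<comment> \<open>The exponential at \<open>(X, Y)\<close> with standard normal frequencies \<open>z\<close>, scaled by \<open>1 / \<epsilon>\<close>.\<close>
  define F :: "real \<times> real \<Rightarrow> 'a \<Rightarrow> complex" where
    "F z \<omega> = exp (\<i> * of_real (fst z / \<epsilon> * X \<omega> + snd z / \<epsilon> * Y \<omega>))" for z \<omega>
  have [measurable]: "(\<lambda>(z, \<omega>). F z \<omega>) \<in> borel_measurable ((?N \<Otimes>\<^sub>M ?N) \<Otimes>\<^sub>M M)"
    unfolding F_def by measurable
  have intF: "integrable ((?N \<Otimes>\<^sub>M ?N) \<Otimes>\<^sub>M M) (\<lambda>(z, \<omega>). F z \<omega>)"
    by (rule P.integrable_const_bound[where B=1]) (auto simp: F_def)
  have gauss: "(LINT z|(?N \<Otimes>\<^sub>M ?N). F z \<omega>)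
      = of_real (exp (- ((X \<omega>)\<^sup>2 + (Y \<omega>)\<^sup>2) / (2 * \<epsilon>\<^sup>2)))" for \<omega>
  proof -
    have split: "F (u, v) \<omega> = exp (\<i> * of_real (u * (X \<omega> / \<epsilon>))) * exp (\<i> * of_real (v * (Y \<omega> / \<epsilon>)))" for u v
      by (simp add: F_def exp_add[symmetric] algebra_simps)
    have "integrable (?N \<Otimes>\<^sub>M ?N) (\<lambda>z. F z \<omega>)"
      by (rule NN.integrable_const_bound[where B=1]) (auto simp: F_def)
    then have "(LINT z|(?N \<Otimes>\<^sub>M ?N). F z \<omega>) = (LINT u|?N. LINT v|?N. F (u, v) \<omega>)"
      by (rule NN.integral_fst'[symmetric])
    also have "\<dots> = of_real (exp (- (X \<omega> / \<epsilon>)\<^sup>2 / 2)) * of_real (exp (- (Y \<omega> / \<epsilon>)\<^sup>2 / 2))"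
      unfolding split by (simp only: integral_mult_right_zero integral_mult_left_zero std_normal_integral_iexp)
    also have "\<dots> = of_real (exp (- ((X \<omega>)\<^sup>2 + (Y \<omega>)\<^sup>2) / (2 * \<epsilon>\<^sup>2)))"
      using e by (simp add: of_real_mult[symmetric] exp_add[symmetric] power_divide field_simps
          del: of_real_mult of_real_exp)
    finally show ?thesis .
  qed
  have "of_real (expectation (\<lambda>\<omega>. exp (- ((X \<omega>)\<^sup>2 + (Y \<omega>)\<^sup>2) / (2 * \<epsilon>\<^sup>2))))
      = (LINT \<omega>|M. LINT z|(?N \<Otimes>\<^sub>M ?N). F z \<omega>)"
    unfolding gauss by simp
  also have "\<dots> = (LINT z|(?N \<Otimes>\<^sub>M ?N). LINT \<omega>|M. F z \<omega>)"
    by (rule P.Fubini_integral) (rule intF)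
  finally have "norm (complex_of_real (expectation (\<lambda>\<omega>. exp (- ((X \<omega>)\<^sup>2 + (Y \<omega>)\<^sup>2) / (2 * \<epsilon>\<^sup>2)))))
      = norm (LINT z|(?N \<Otimes>\<^sub>M ?N). LINT \<omega>|M. F z \<omega>)" by simp
  also have "\<dots> \<le> (LINT z|(?N \<Otimes>\<^sub>M ?N). exp (- (m / \<epsilon>\<^sup>2) * (fst z)\<^sup>2 / 2) * exp (- (m / \<epsilon>\<^sup>2) * (snd z)\<^sup>2 / 2))"
  proof (rule order_trans[OF integral_norm_bound integral_mono])
    show "integrable (?N \<Otimes>\<^sub>M ?N) (\<lambda>z. norm (LINT \<omega>|M. F z \<omega>))"
      using P.integrable_fst'[OF intF] by simp
    show "integrable (?N \<Otimes>\<^sub>M ?N) (\<lambda>z. exp (- (m / \<epsilon>\<^sup>2) * (fst z)\<^sup>2 / 2) * exp (- (m / \<epsilon>\<^sup>2) * (snd z)\<^sup>2 / 2))"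
      using m by (intro NN.integrable_const_bound[where B=1] AE_I2) (auto intro!: mult_le_one)
    fix z
    show "norm (LINT \<omega>|M. F z \<omega>) \<le> exp (- (m / \<epsilon>\<^sup>2) * (fst z)\<^sup>2 / 2) * exp (- (m / \<epsilon>\<^sup>2) * (snd z)\<^sup>2 / 2)"
    proof -
      have "exp (- (m * ((fst z / \<epsilon>)\<^sup>2 + (snd z / \<epsilon>)\<^sup>2)) / 2)
          = exp (- (m / \<epsilon>\<^sup>2) * (fst z)\<^sup>2 / 2) * exp (- (m / \<epsilon>\<^sup>2) * (snd z)\<^sup>2 / 2)"
        unfolding exp_add[symmetric] by (simp add: power_divide field_simps)
      then show ?thesis
        using char[of "fst z / \<epsilon>" "snd z / \<epsilon>"] unfolding F_def by simp
    qed
  qed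
  also have "\<dots> = (LINT u|?N. LINT v|?N. exp (- (m / \<epsilon>\<^sup>2) * u\<^sup>2 / 2) * exp (- (m / \<epsilon>\<^sup>2) * v\<^sup>2 / 2))"
  proof (subst NN.integral_fst'[symmetric])
    show "integrable (?N \<Otimes>\<^sub>M ?N) (\<lambda>z. exp (- (m / \<epsilon>\<^sup>2) * (fst z)\<^sup>2 / 2) * exp (- (m / \<epsilon>\<^sup>2) * (snd z)\<^sup>2 / 2))"
      using m by (intro NN.integrable_const_bound[where B=1] AE_I2) (auto intro!: mult_le_one)
  qed simp
  also have "\<dots> = 1 / sqrt (1 + m / \<epsilon>\<^sup>2) * (1 / sqrt (1 + m / \<epsilon>\<^sup>2))"
    using std_normal_integral_gaussian[of "m / \<epsilon>\<^sup>2"] m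
    by (simp only: integral_mult_right_zero integral_mult_left_zero) simp
  also have "\<dots> = 1 / (1 + m / \<epsilon>\<^sup>2)" using m by (simp add: add_nonneg_nonneg)
  also have "\<dots> \<le> 1 / (m / \<epsilon>\<^sup>2)" by (intro frac_le) (use m e in auto)
  finally show ?thesis by simp
qed

text \<open>Every linear combination of the two functionals is itself a functional of the same kind, so the bound for
  one-dimensional characteristic functions controls the joint one.\<close>

lemma brownian_functional_small_ball:
  assumes bm: "standard_brownian_motion M B"
    and g: "continuous_on UNIV g1" "continuous_on UNIV g2"
    and G: "\<And>s. (G1 has_real_derivative g1 s) (at s)" "\<And>s. (G2 has_real_derivative g2 s) (at s)"
    and G0: "(G1 \<longlongrightarrow> 0) at_top" "(G2 \<longlongrightarrow> 0) at_top"
    and int: "AE \<omega> in M. set_integrable lborel {0..} (\<lambda>s. B s \<omega> * g1 s)"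
      "AE \<omega> in M. set_integrable lborel {0..} (\<lambda>s. B s \<omega> * g2 s)"
    and m: "m > 0" "\<And>u v. m * (u\<^sup>2 + v\<^sup>2) \<le> integral {0..1} (\<lambda>s. (u * G1 s + v * G2 s)\<^sup>2)"
    and e: "\<epsilon> > 0"
  shows "(LINT \<omega>|M. exp (- ((path_functional G1 (\<lambda>t. B t \<omega>))\<^sup>2 + (path_functional G2 (\<lambda>t. B t \<omega>))\<^sup>2)
           / (2 * \<epsilon>\<^sup>2))) \<le> \<epsilon>\<^sup>2 / m"
proof -
  interpret prob_space M using bm by (simp add: standard_brownian_motion_def)
  note rv = path_functional_random_variable[OF bm]
  have cont: "AE \<omega> in M. continuous_on {0..} (\<lambda>t. B t \<omega>)"
    using bm by (auto simp: standard_brownian_motion_def)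
  show ?thesis
  proof (rule small_ball_from_characteristic_function[OF rv rv m(1) e])
    fix u v :: real
    let ?G = "\<lambda>s. u * G1 s + v * G2 s" and ?g = "\<lambda>s. u * g1 s + v * g2 s"
    have g': "continuous_on UNIV ?g" by (intro continuous_intros g)
    have G': "(?G has_real_derivative ?g s) (at s)" for s
      by (auto intro!: derivative_eq_intros G)
    have G0': "(?G \<longlongrightarrow> 0) at_top" using G0 by (auto intro!: tendsto_eq_intros)
    have int': "AE \<omega> in M. set_integrable lborel {0..} (\<lambda>s. B s \<omega> * ?g s)"
      using int
    proof eventually_elim
      case (elim \<omega>)
      have "set_integrable lborel {0..} (\<lambda>s. u * (B s \<omega> * g1 s) + v * (B s \<omega> * g2 s))"
        using elim by (intro set_integral_add set_integrable_mult_right)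
      then show ?case by (simp add: algebra_simps)
    qed
    have eq: "AE \<omega> in M. u * path_functional G1 (\<lambda>t. B t \<omega>) + v * path_functional G2 (\<lambda>t. B t \<omega>)
        = path_functional ?G (\<lambda>t. B t \<omega>)"
      using cont int int'
    proof eventually_elim
      case (elim \<omega>)
      have "(LINT s:{0..}|lborel. B s \<omega> * ?g s)
          = (LINT s:{0..}|lborel. u * (B s \<omega> * g1 s) + v * (B s \<omega> * g2 s))"
        by (simp add: algebra_simps)
      also have "\<dots> = u * (LINT s:{0..}|lborel. B s \<omega> * g1 s) + v * (LINT s:{0..}|lborel. B s \<omega> * g2 s)"
        using elim by (subst set_integral_add) auto
      finally show ?case
        using path_functional_eq(2)[OF elim(1) g(1) G(1) elim(2)]
          path_functional_eq(2)[OF elim(1) g(2) G(2) elim(3)]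
          path_functional_eq(2)[OF elim(1) g' G' elim(4)] by simp
    qed
    have "expectation (\<lambda>\<omega>. exp (\<i> * of_real (u * path_functional G1 (\<lambda>t. B t \<omega>) + v * path_functional G2 (\<lambda>t. B t \<omega>))))
        = expectation (\<lambda>\<omega>. exp (\<i> * of_real (path_functional ?G (\<lambda>t. B t \<omega>))))"
    proof (intro integral_cong_AE)
      show "AE \<omega> in M. exp (\<i> * of_real (u * path_functional G1 (\<lambda>t. B t \<omega>) + v * path_functional G2 (\<lambda>t. B t \<omega>)))
        = exp (\<i> * of_real (path_functional ?G (\<lambda>t. B t \<omega>)))"
        using eq by eventually_elim (simp only:)
    qed (use rv[of G1] rv[of G2] rv[of ?G] in auto)
    also have "norm \<dots> \<le> exp (- integral {0..1} (\<lambda>s. (?G s)\<^sup>2) / 2)"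
      by (rule brownian_functional_char_bound[OF bm g' G' G0' int'])
    also have "\<dots> \<le> exp (- (m * (u\<^sup>2 + v\<^sup>2)) / 2)" using m(2)[of u v] by simp
    finally show "norm (expectation (\<lambda>\<omega>. exp (\<i> * of_real (u * path_functional G1 (\<lambda>t. B t \<omega>) + v * path_functional G2 (\<lambda>t. B t \<omega>)))))
       \<le> exp (- (m * (u\<^sup>2 + v\<^sup>2)) / 2)" .
  qed
qed

text \<open>Independence of the coordinates squares the one-dimensional bound: four real equations cost \<open>\<epsilon>\<^sup>4\<close>.\<close>

lemma planar_brownian_functional_small_ball:
  assumes bm: "standard_planar_brownian_motion M W"
    and g: "continuous_on UNIV g1" "continuous_on UNIV g2"
    and G: "\<And>s. (G1 has_real_derivative g1 s) (at s)" "\<And>s. (G2 has_real_derivative g2 s) (at s)"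
    and G0: "(G1 \<longlongrightarrow> 0) at_top" "(G2 \<longlongrightarrow> 0) at_top"
    and int: "AE \<omega> in M. set_integrable lborel {0..} (\<lambda>s. Re (W s \<omega>) * g1 s)"
      "AE \<omega> in M. set_integrable lborel {0..} (\<lambda>s. Re (W s \<omega>) * g2 s)"
      "AE \<omega> in M. set_integrable lborel {0..} (\<lambda>s. Im (W s \<omega>) * g1 s)"
      "AE \<omega> in M. set_integrable lborel {0..} (\<lambda>s. Im (W s \<omega>) * g2 s)"
    and m: "m > 0" "\<And>u v. m * (u\<^sup>2 + v\<^sup>2) \<le> integral {0..1} (\<lambda>s. (u * G1 s + v * G2 s)\<^sup>2)"
    and e: "\<epsilon> > 0"
  shows "(LINT \<omega>|M. exp (- ((path_functional G1 (\<lambda>t. Re (W t \<omega>)))\<^sup>2 + (path_functional G2 (\<lambda>t. Re (W t \<omega>)))\<^sup>2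
         + (path_functional G1 (\<lambda>t. Im (W t \<omega>)))\<^sup>2 + (path_functional G2 (\<lambda>t. Im (W t \<omega>)))\<^sup>2)
           / (2 * \<epsilon>\<^sup>2))) \<le> 1 / m\<^sup>2 * \<epsilon>^4"
proof -
  have R: "standard_brownian_motion M (\<lambda>t \<omega>. Re (W t \<omega>))"
    and I: "standard_brownian_motion M (\<lambda>t \<omega>. Im (W t \<omega>))"
    using bm by (simp_all add: standard_planar_brownian_motion_def)
  interpret prob_space M using R by (simp add: standard_brownian_motion_def)
  define F where "F x = exp (- ((path_functional G1 x)\<^sup>2 + (path_functional G2 x)\<^sup>2) / (2 * \<epsilon>\<^sup>2))" for x
  have Fm: "F \<in> borel_measurable (PiM {0..} (\<lambda>_. borel))" unfolding F_def
    using measurable_path_functional[of G1] measurable_path_functional[of G2] by measurable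
  have Fr: "F (restrict x {0..}) = F x" for x by (simp add: F_def path_functional_restrict)
  have "indep_var borel (F \<circ> (\<lambda>\<omega>. \<lambda>t\<in>{0..}. Re (W t \<omega>))) borel (F \<circ> (\<lambda>\<omega>. \<lambda>t\<in>{0..}. Im (W t \<omega>)))"
    using bm by (intro indep_var_compose[OF _ Fm Fm]) (simp add: standard_planar_brownian_motion_def)
  then have ind: "indep_var borel (\<lambda>\<omega>. F (\<lambda>t. Re (W t \<omega>))) borel (\<lambda>\<omega>. F (\<lambda>t. Im (W t \<omega>)))"
    by (simp add: comp_def Fr)
  have F1: "\<bar>F x\<bar> \<le> 1" for x
    unfolding F_def by (simp add: divide_nonpos_nonneg)
  have "expectation (\<lambda>\<omega>. F (\<lambda>t. Re (W t \<omega>)) * F (\<lambda>t. Im (W t \<omega>)))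
      = expectation (\<lambda>\<omega>. F (\<lambda>t. Re (W t \<omega>))) * expectation (\<lambda>\<omega>. F (\<lambda>t. Im (W t \<omega>)))"
    using F1 indep_var_rv1[OF ind] indep_var_rv2[OF ind]
    by (intro indep_var_lebesgue_integral ind integrable_const_bound[where B=1]) auto
  also have "\<dots> \<le> (\<epsilon>\<^sup>2 / m) * (\<epsilon>\<^sup>2 / m)"
    using m e brownian_functional_small_ball[OF R g G G0 int(1,2) m e]
      brownian_functional_small_ball[OF I g G G0 int(3,4) m e]
    unfolding F_def by (intro mult_mono) auto
  also have "\<dots> = 1 / m\<^sup>2 * \<epsilon>^4" by (simp add: power2_eq_square power4_eq_xxxx)
  also have "(\<lambda>\<omega>. F (\<lambda>t. Re (W t \<omega>)) * F (\<lambda>t. Im (W t \<omega>))) = (\<lambda>\<omega>. exp (- ((path_functional G1 (\<lambda>t. Re (W t \<omega>)))\<^sup>2 + (path_functional G2 (\<lambda>t. Re (W t \<omega>)))\<^sup>2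
         + (path_functional G1 (\<lambda>t. Im (W t \<omega>)))\<^sup>2 + (path_functional G2 (\<lambda>t. Im (W t \<omega>)))\<^sup>2)
           / (2 * \<epsilon>\<^sup>2)))"
    unfolding F_def exp_add[symmetric] add_divide_distrib[symmetric]
    by (simp only: minus_add_distrib[symmetric] add.assoc)
  finally show ?thesis .
qed

section \<open>Zeros of a random field with more equations than parameters\<close>

text \<open>Markov's inequality for \<open>exp (- Y\<^sup>2 / (2 \<epsilon>\<^sup>2))\<close>, which is at least \<open>exp (- 1 / 2)\<close> on the event in question.\<close>

lemma (in prob_space) prob_le_exp_square:
  fixes Y :: "'a \<Rightarrow> real"
  assumes [measurable]: "random_variable borel Y" and e: "\<epsilon> > 0"
  shows "prob {\<omega> \<in> space M. \<bar>Y \<omega>\<bar> \<le> \<epsilon>} \<le> exp (1/2) * expectation (\<lambda>\<omega>. exp (- (Y \<omega>)\<^sup>2 / (2 * \<epsilon>\<^sup>2)))"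
proof -
  have int: "integrable M (\<lambda>\<omega>. exp (- (Y \<omega>)\<^sup>2 / (2 * \<epsilon>\<^sup>2)))"
    by (rule integrable_const_bound[where B=1]) auto
  have "prob {\<omega> \<in> space M. \<bar>Y \<omega>\<bar> \<le> \<epsilon>} = expectation (indicator {\<omega> \<in> space M. \<bar>Y \<omega>\<bar> \<le> \<epsilon>})"
    by simp
  also have "\<dots> \<le> expectation (\<lambda>\<omega>. exp (1/2) * exp (- (Y \<omega>)\<^sup>2 / (2 * \<epsilon>\<^sup>2)))"
  proof (rule integral_mono)
    show "integrable M (\<lambda>\<omega>. exp (1/2) * exp (- (Y \<omega>)\<^sup>2 / (2 * \<epsilon>\<^sup>2)))"
      using int by simp
    fix \<omega>
    have "1 \<le> exp (1/2) * exp (- (Y \<omega>)\<^sup>2 / (2 * \<epsilon>\<^sup>2))" if "\<bar>Y \<omega>\<bar> \<le> \<epsilon>"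
    proof -
      have "(Y \<omega>)\<^sup>2 \<le> \<epsilon>\<^sup>2" using that by (metis abs_ge_zero power2_abs power_mono)
      then have "0 \<le> 1/2 + - (Y \<omega>)\<^sup>2 / (2 * \<epsilon>\<^sup>2)" using e by (simp add: field_simps)
      then show ?thesis unfolding exp_add[symmetric] by simp
    qed
    then show "indicator {\<omega> \<in> space M. \<bar>Y \<omega>\<bar> \<le> \<epsilon>} \<omega> \<le> exp (1/2) * exp (- (Y \<omega>)\<^sup>2 / (2 * \<epsilon>\<^sup>2))"
      by (auto simp: indicator_def)
    show "integrable M (indicator {\<omega> \<in> space M. \<bar>Y \<omega>\<bar> \<le> \<epsilon>} :: 'a \<Rightarrow> real)"
      by (rule integrable_const_bound[where B=1]) (auto simp: indicator_def)
  qed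
  finally show ?thesis by simp
qed

lemma grid_point_near:
  fixes a b x :: real
  assumes x: "x \<in> {a..b}" and n: "n > 0"
  obtains i where "i \<le> n" "\<bar>x - (a + (b - a) * real i / real n)\<bar> \<le> (b - a) / real n"
    "a + (b - a) * real i / real n \<in> {a..b}"
proof (cases "a = b")
  case True
  with x that[of 0] show ?thesis by auto
next
  case False
  then have ab: "a < b" using x by auto
  define i where "i = nat \<lfloor>(x - a) * real n / (b - a)\<rfloor>"
  have pos: "0 \<le> (x - a) * real n / (b - a)" using x ab by auto
  have i1: "real i \<le> (x - a) * real n / (b - a)" using pos by (simp add: i_def)
  have i2: "(x - a) * real n / (b - a) \<le> real i + 1" using pos by (simp add: i_def)
  have "(x - a) * real n \<le> (b - a) * real n"
    using x by (intro mult_right_mono) auto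
  then have "(x - a) * real n / (b - a) \<le> real n" using ab by (simp add: field_simps)
  then have in_: "i \<le> n" using i1 by linarith
  have 1: "(b - a) * real i / real n \<le> x - a" using i1 ab n by (simp add: field_simps)
  have 2: "x - a \<le> (b - a) * real i / real n + (b - a) / real n"
  proof -
    have "(x - a) * real n \<le> (b - a) * real i + (b - a)"
      using i2 ab by (simp add: pos_divide_le_eq algebra_simps)
    then have "x - a \<le> ((b - a) * real i + (b - a)) / real n"
      using n by (simp add: pos_le_divide_eq)
    then show ?thesis by (simp add: add_divide_distrib)
  qed
  show ?thesis
  proof (rule that[OF in_])
    show "\<bar>x - (a + (b - a) * real i / real n)\<bar> \<le> (b - a) / real n" using 1 2 by linarith
    have "(b - a) * real i / real n \<ge> 0" using ab by simp
    then show "a + (b - a) * real i / real n \<in> {a..b}" using 1 x by auto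
  qed
qed

text \<open>The counting argument. A zero of an \<open>l\<close>-Lipschitz field puts the field below \<open>O(l / n)\<close> at one
  of the \<open>(n + 1)\<^sup>3\<close> grid points, an event of probability at most \<open>O((n + 1)\<^sup>3 n\<^sup>-\<^sup>4)\<close>. The random Lipschitz
  constant is dealt with by treating each integer bound \<open>l\<close> separately. The field is compared at each
  parameter with a random variable \<open>Y\<close> that agrees with it almost surely, because \<open>N q\<close> itself, in applications an integral
  along the path, need not be measurable in \<open>\<omega>\<close>; only countably many such comparisons are used.\<close>

lemma (in prob_space) no_zero_of_lipschitz_field:
  fixes N :: "real \<times> real \<times> real \<Rightarrow> 'a \<Rightarrow> real" and a b :: "real \<times> real \<times> real"
  defines "K \<equiv> {fst a..fst b} \<times> {fst (snd a)..fst (snd b)} \<times> {snd (snd a)..snd (snd b)}"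
  assumes small: "\<And>q. q \<in> K \<Longrightarrow> \<exists>Y \<in> borel_measurable M. (AE \<omega> in M. N q \<omega> = Y \<omega>) \<and>
       (\<forall>\<epsilon>>0. expectation (\<lambda>\<omega>. exp (- (Y \<omega>)\<^sup>2 / (2 * \<epsilon>\<^sup>2))) \<le> C * \<epsilon>^4)"
    and lip: "AE \<omega> in M. \<exists>L. \<forall>q\<in>K. \<forall>q'\<in>K. \<bar>N q \<omega> - N q' \<omega>\<bar> \<le> L * dist q q'"
  shows "AE \<omega> in M. \<forall>q\<in>K. N q \<omega> \<noteq> 0"
proof -
  have "\<forall>q\<in>K. \<exists>Y. Y \<in> borel_measurable M \<and> (AE \<omega> in M. N q \<omega> = Y \<omega>) \<and>
       (\<forall>\<epsilon>>0. expectation (\<lambda>\<omega>. exp (- (Y \<omega>)\<^sup>2 / (2 * \<epsilon>\<^sup>2))) \<le> C * \<epsilon>^4)"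
    using small by blast
  from bchoice[OF this] obtain Y where Y: "\<And>q. q \<in> K \<Longrightarrow> Y q \<in> borel_measurable M"
    "\<And>q. q \<in> K \<Longrightarrow> AE \<omega> in M. N q \<omega> = Y q \<omega>"
    "\<And>q \<epsilon>. q \<in> K \<Longrightarrow> \<epsilon> > 0 \<Longrightarrow> expectation (\<lambda>\<omega>. exp (- (Y q \<omega>)\<^sup>2 / (2 * \<epsilon>\<^sup>2))) \<le> C * \<epsilon>^4"
    by blast
  define pt where "pt n i j k = (fst a + (fst b - fst a) * real i / real n,
      fst (snd a) + (fst (snd b) - fst (snd a)) * real j / real n,
      snd (snd a) + (snd (snd b) - snd (snd a)) * real k / real n)" for n i j k :: nat
  define R where "R = (fst b - fst a) + (fst (snd b) - fst (snd a)) + (snd (snd b) - snd (snd a))"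
  define I where "I n = {(i, j, k). i \<le> n \<and> j \<le> n \<and> k \<le> n \<and> pt n i j k \<in> K}" for n :: nat
  have I_sub: "I n \<subseteq> {..n} \<times> {..n} \<times> {..n}" for n by (auto simp: I_def)
  then have I_fin: "finite (I n)" for n by (rule finite_subset) auto
  have I_card: "card (I n) \<le> (n + 1)^3" for n
    using card_mono[OF _ I_sub[of n]] by (simp add: card_cartesian_product power3_eq_cube algebra_simps)
  define g where "g n t = pt n (fst t) (fst (snd t)) (snd (snd t))" for n and t :: "nat \<times> nat \<times> nat"
  have gK: "g n t \<in> K" if "t \<in> I n" for n t using that by (auto simp: I_def g_def)
  have ev: "{\<omega> \<in> space M. \<bar>Y q \<omega>\<bar> \<le> c} \<in> sets M" if "q \<in> K" for q c
  proof -
    have [measurable]: "Y q \<in> borel_measurable M" using Y(1) that by blast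
    show ?thesis by measurable
  qed
  have near: "\<exists>t\<in>I n. dist q (g n t) \<le> R / real n" if q: "q \<in> K" and n: "n > 0" for q n
  proof -
    obtain x y z where qe: "q = (x, y, z)" by (cases q)
    have x: "x \<in> {fst a..fst b}" and y: "y \<in> {fst (snd a)..fst (snd b)}"
      and z: "z \<in> {snd (snd a)..snd (snd b)}" using q by (auto simp: qe K_def)
    obtain i where i: "i \<le> n" "\<bar>x - fst (pt n i 0 0)\<bar> \<le> (fst b - fst a) / real n"
      "fst (pt n i 0 0) \<in> {fst a..fst b}"
      using grid_point_near[OF x n] by (auto simp: pt_def)
    obtain j where j: "j \<le> n" "\<bar>y - fst (snd (pt n 0 j 0))\<bar> \<le> (fst (snd b) - fst (snd a)) / real n"
      "fst (snd (pt n 0 j 0)) \<in> {fst (snd a)..fst (snd b)}"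
      using grid_point_near[OF y n] by (auto simp: pt_def)
    obtain k where k: "k \<le> n" "\<bar>z - snd (snd (pt n 0 0 k))\<bar> \<le> (snd (snd b) - snd (snd a)) / real n"
      "snd (snd (pt n 0 0 k)) \<in> {snd (snd a)..snd (snd b)}"
      using grid_point_near[OF z n] by (auto simp: pt_def)
    have pte: "pt n i j k = (fst (pt n i 0 0), fst (snd (pt n 0 j 0)), snd (snd (pt n 0 0 k)))"
      by (simp add: pt_def)
    have mem: "pt n i j k \<in> K" using i j k by (simp add: pte K_def)
    have "dist q (pt n i j k) \<le> \<bar>x - fst (pt n i 0 0)\<bar> + dist (y, z) (fst (snd (pt n 0 j 0)), snd (snd (pt n 0 0 k)))"
      unfolding qe pte dist_Pair_Pair dist_real_def by (rule order_trans[OF sqrt_sum_squares_le_sum_abs]) simp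
    also have "dist (y, z) (fst (snd (pt n 0 j 0)), snd (snd (pt n 0 0 k)))
        \<le> \<bar>y - fst (snd (pt n 0 j 0))\<bar> + \<bar>z - snd (snd (pt n 0 0 k))\<bar>"
      unfolding dist_Pair_Pair dist_real_def by (rule order_trans[OF sqrt_sum_squares_le_sum_abs]) simp
    finally have "dist q (pt n i j k) \<le> R / real n"
      using i(2) j(2) k(2) by (simp add: R_def add_divide_distrib)
    then show ?thesis using mem i j k
      by (intro bexI[of _ "(i, j, k)"]) (auto simp: I_def g_def)
  qed
  have bad_null: "AE \<omega> in M. \<not> (\<exists>q\<in>K. N q \<omega> = 0 \<and> (\<forall>q\<in>K. \<forall>q'\<in>K. \<bar>N q \<omega> - N q' \<omega>\<bar> \<le> real l * dist q q'))" for l :: nat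
  proof -
    \<comment> \<open>Every point of \<open>K\<close> lies within \<open>R / n\<close> of the grid; adding 1 keeps \<open>r n\<close> positive even if \<open>l R = 0\<close>.\<close>
    define r where "r n = (real l * R + 1) / real n" for n :: nat
    define B where "B n = (\<Union>t\<in>I n. {\<omega> \<in> space M. \<bar>Y (g n t) \<omega>\<bar> \<le> r n})" for n
    have B_sets [measurable]: "B n \<in> sets M" for n
      unfolding B_def by (intro sets.finite_UN I_fin ev gK)
    show ?thesis
    proof (cases "K = {}")
      case True
      then show ?thesis by simp
    next
      case False
      then have R0: "R \<ge> 0" by (auto simp: R_def K_def)
      have C0: "C \<ge> 0"
      proof -
        obtain q where "q \<in> K" using False by auto
        from Y(3)[OF this, of 1] have "expectation (\<lambda>\<omega>. exp (- (Y q \<omega>)\<^sup>2 / (2 * 1\<^sup>2))) \<le> C" by simp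
        moreover have "0 \<le> expectation (\<lambda>\<omega>. exp (- (Y q \<omega>)\<^sup>2 / (2 * 1\<^sup>2)))" by simp
        ultimately show ?thesis by linarith
      qed
      have r0: "r n > 0" if "n > 0" for n using that R0 by (simp add: r_def add_nonneg_pos)
      have PB: "prob (B n) \<le> (real n + 1)^3 * (exp (1/2) * C * (r n)^4)" if n: "n > 0" for n
      proof -
        have "prob (B n) \<le> (\<Sum>t\<in>I n. prob {\<omega> \<in> space M. \<bar>Y (g n t) \<omega>\<bar> \<le> r n})"
          unfolding B_def by (intro finite_measure_subadditive_finite I_fin image_subsetI ev gK)
        also have "\<dots> \<le> (\<Sum>t\<in>I n. exp (1/2) * C * (r n)^4)"
        proof (rule sum_mono)
          fix t assume t: "t \<in> I n"
          have "prob {\<omega> \<in> space M. \<bar>Y (g n t) \<omega>\<bar> \<le> r n}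
              \<le> exp (1/2) * expectation (\<lambda>\<omega>. exp (- (Y (g n t) \<omega>)\<^sup>2 / (2 * (r n)\<^sup>2)))"
            by (rule prob_le_exp_square[OF Y(1)[OF gK[OF t]] r0[OF n]])
          also have "\<dots> \<le> exp (1/2) * (C * (r n)^4)"
            by (intro mult_left_mono Y(3) gK t r0 n) auto
          finally show "prob {\<omega> \<in> space M. \<bar>Y (g n t) \<omega>\<bar> \<le> r n} \<le> exp (1/2) * C * (r n)^4" by simp
        qed
        also have "\<dots> = real (card (I n)) * (exp (1/2) * C * (r n)^4)" by simp
        also have "\<dots> \<le> real ((n + 1)^3) * (exp (1/2) * C * (r n)^4)"
          using C0 I_card[of n] by (intro mult_right_mono) (simp_all only: of_nat_le_iff, simp)
        finally show ?thesis by (simp add: add.commute)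
      qed
      have lim: "(\<lambda>n. (real n + 1)^3 * (exp (1/2) * C * (r n)^4)) \<longlonglongrightarrow> 0"
      proof -
        have "(\<lambda>n. (1 + inverse (real n))^3 * (exp (1/2) * C * (real l * R + 1)^4) * inverse (real n)) \<longlonglongrightarrow> (1 + 0)^3 * (exp (1/2) * C * (real l * R + 1)^4) * 0"
          by (intro tendsto_intros LIMSEQ_inverse_real_of_nat[THEN LIMSEQ_imp_Suc] lim_inverse_n)
        moreover have "\<forall>\<^sub>F n in sequentially. (1 + inverse (real n))^3 * (exp (1/2) * C * (real l * R + 1)^4) * inverse (real n)
            = (real n + 1)^3 * (exp (1/2) * C * (r n)^4)"
          using eventually_gt_at_top[of 0]
        proof eventually_elim
          case (elim n)
          have "1 + inverse (real n) = (real n + 1) / real n" using elim by (simp add: field_simps)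
          then show ?case using elim
            by (simp add: r_def power_divide power4_eq_xxxx power3_eq_cube field_simps)
        qed
        ultimately show ?thesis by (simp add: tendsto_cong)
      qed
      \<comment> \<open>A measurable null set that contains all sample points with a zero of the \<open>l\<close>-Lipschitz field.\<close>
      define Z where "Z = (\<Inter>n. B (Suc n))"
      have [measurable]: "Z \<in> sets M" unfolding Z_def by measurable
      have "prob Z \<le> 0"
      proof (rule LIMSEQ_le_const[OF LIMSEQ_Suc[OF lim]], intro exI[of _ 0] allI impI)
        fix n
        have "prob Z \<le> prob (B (Suc n))" by (rule finite_measure_mono) (auto simp: Z_def)
        also have "\<dots> \<le> (real (Suc n) + 1)^3 * (exp (1/2) * C * (r (Suc n))^4)" by (rule PB) simp
        finally show "prob Z \<le> (real (Suc n) + 1)^3 * (exp (1/2) * C * (r (Suc n))^4)" .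
      qed
      then have "prob Z = 0" using measure_nonneg[of M Z] by linarith
      then have "AE \<omega> in M. \<omega> \<notin> Z" by (simp add: AE_iff_measurable[OF _ refl] prob_eq_0)
      moreover have "AE \<omega> in M. \<forall>n. \<forall>t\<in>I n. N (g n t) \<omega> = Y (g n t) \<omega>"
        using I_fin Y(2) gK by (simp add: AE_all_countable AE_finite_all)
      ultimately show ?thesis using AE_space
      proof eventually_elim
        case (elim \<omega>)
        show ?case
        proof
          assume "\<exists>q\<in>K. N q \<omega> = 0 \<and> (\<forall>q\<in>K. \<forall>q'\<in>K. \<bar>N q \<omega> - N q' \<omega>\<bar> \<le> real l * dist q q')"
          then obtain q where q: "q \<in> K" "N q \<omega> = 0"
            "\<And>q q'. q \<in> K \<Longrightarrow> q' \<in> K \<Longrightarrow> \<bar>N q \<omega> - N q' \<omega>\<bar> \<le> real l * dist q q'" by blast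
          have "\<omega> \<in> B (Suc n)" for n
          proof -
            obtain t where t: "t \<in> I (Suc n)" "dist q (g (Suc n) t) \<le> R / real (Suc n)"
              using near[OF q(1), of "Suc n"] by auto
            have "\<bar>Y (g (Suc n) t) \<omega>\<bar> = \<bar>N q \<omega> - N (g (Suc n) t) \<omega>\<bar>"
              using elim t q by auto
            also have "\<dots> \<le> real l * dist q (g (Suc n) t)" by (rule q(3)[OF q(1) gK[OF t(1)]])
            also have "\<dots> \<le> real l * (R / real (Suc n))" by (rule mult_left_mono[OF t(2)]) simp
            also have "\<dots> \<le> r (Suc n)" by (simp add: r_def divide_right_mono)
            finally show ?thesis using t elim by (auto simp: B_def)
          qed
          then show False using elim by (auto simp: Z_def)
        qed
      qed
    qed
  qed
  then have "AE \<omega> in M. \<forall>l. \<not> (\<exists>q\<in>K. N q \<omega> = 0 \<and> (\<forall>q\<in>K. \<forall>q'\<in>K. \<bar>N q \<omega> - N q' \<omega>\<bar> \<le> real l * dist q q'))"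
    unfolding AE_all_countable by blast
  then show ?thesis using lip
  proof eventually_elim
    case (elim \<omega>)
    then obtain L where L: "\<And>q q'. q \<in> K \<Longrightarrow> q' \<in> K \<Longrightarrow> \<bar>N q \<omega> - N q' \<omega>\<bar> \<le> L * dist q q'" by blast
    obtain l :: nat where l: "L \<le> real l" using real_arch_simple by blast
    have "\<bar>N q \<omega> - N q' \<omega>\<bar> \<le> real l * dist q q'" if "q \<in> K" "q' \<in> K" for q q'
      using L[OF that] mult_right_mono[OF l zero_le_dist[of q q']] by linarith
    then show ?case using elim(1) by blast
  qed
qed

section \<open>Gaussian moments of a path\<close>

definition gauss_kernel :: "nat \<Rightarrow> real \<Rightarrow> real \<Rightarrow> real" where
  "gauss_kernel j \<sigma> x = x ^ j * exp (- \<sigma> * x\<^sup>2 / 2)"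

text \<open>One half of the exponent absorbs the polynomial factor; in the other half, \<open>(p - s)\<^sup>2 \<ge> s\<^sup>2 / 2 - p\<^sup>2\<close>
  removes the dependence on \<open>p\<close>. The resulting majorant depends on neither \<open>p\<close> nor \<open>\<sigma>\<close>, so one integrable
  function dominates all kernels of a compact range of parameters.\<close>

lemma gauss_kernel_bound:
  fixes R \<sigma>\<^sub>0 :: real
  assumes \<sigma>0: "\<sigma>\<^sub>0 > 0"
  obtains C where "C > 0" "\<And>p s \<sigma>. \<bar>p\<bar> \<le> R \<Longrightarrow> \<sigma> \<ge> \<sigma>\<^sub>0 \<Longrightarrow>
     \<bar>gauss_kernel j \<sigma> (p - s)\<bar> \<le> C * exp (- (\<sigma>\<^sub>0 / 8) * s\<^sup>2)"
proof -
  \<comment> \<open>With \<open>y = \<sigma>\<^sub>0 x\<^sup>2 / 4\<close>, use \<open>\<bar>x\<bar>\<^sup>j \<le> 1 + x\<^sup>2\<^sup>j\<close> and \<open>y\<^sup>j / j! \<le> exp y\<close>.\<close>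
  define A where "A = 1 + fact j * (4 / \<sigma>\<^sub>0) ^ j"
  have A: "A > 0" using \<sigma>0 by (simp add: A_def add_pos_nonneg)
  have poly: "\<bar>x\<bar> ^ j \<le> A * exp (\<sigma>\<^sub>0 * x\<^sup>2 / 4)" for x :: real
  proof -
    define y where "y = \<sigma>\<^sub>0 * x\<^sup>2 / 4"
    have y: "y \<ge> 0" using \<sigma>0 by (simp add: y_def)
    have "\<bar>x\<bar> ^ j \<le> 1 + (x\<^sup>2) ^ j"
    proof (cases "\<bar>x\<bar> \<le> 1")
      case True
      then have "\<bar>x\<bar> ^ j \<le> 1" by (simp add: power_le_one)
      moreover have "0 \<le> (x\<^sup>2) ^ j" by simp
      ultimately show ?thesis by linarith
    next
      case False
      then have "\<bar>x\<bar> \<le> \<bar>x\<bar> ^ 2" by (intro self_le_power) auto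
      then have "\<bar>x\<bar> ^ j \<le> (\<bar>x\<bar> ^ 2) ^ j" by (intro power_mono) auto
      then show ?thesis by simp
    qed
    also have "(x\<^sup>2) ^ j = (4 / \<sigma>\<^sub>0) ^ j * y ^ j"
      using \<sigma>0 by (simp add: y_def power_mult_distrib[symmetric])
    also have "y ^ j \<le> fact j * exp y"
    proof -
      have "(\<Sum>n\<in>{j}. inverse (fact n) * y ^ n) \<le> (\<Sum>n. inverse (fact n) * y ^ n)"
        using y summable_exp[of y] by (intro sum_le_suminf) auto
      then show ?thesis by (simp add: exp_def field_simps)
    qed
    also have "1 + (4 / \<sigma>\<^sub>0) ^ j * (fact j * exp y) \<le> exp y + (4 / \<sigma>\<^sub>0) ^ j * (fact j * exp y)"
      using y by simp
    also have "\<dots> = A * exp y" by (simp add: A_def algebra_simps)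
    finally show ?thesis using \<sigma>0 by (simp add: y_def mult_left_mono)
  qed
  have "\<bar>gauss_kernel j \<sigma> (p - s)\<bar> \<le> (A * exp (\<sigma>\<^sub>0 * R\<^sup>2 / 4)) * exp (- (\<sigma>\<^sub>0 / 8) * s\<^sup>2)"
    if p: "\<bar>p\<bar> \<le> R" and \<sigma>: "\<sigma> \<ge> \<sigma>\<^sub>0" for p s \<sigma>
  proof -
    let ?x = "p - s"
    have "p\<^sup>2 \<le> R\<^sup>2" using p by (metis abs_ge_zero power2_abs power_mono)
    moreover have "s\<^sup>2 / 2 - p\<^sup>2 \<le> ?x\<^sup>2"
      using zero_le_power2[of "2 * p - s"] by (simp add: power2_eq_square algebra_simps)
    ultimately have "s\<^sup>2 / 2 - R\<^sup>2 \<le> ?x\<^sup>2" by linarith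
    then have "\<sigma>\<^sub>0 / 4 * (s\<^sup>2 / 2 - R\<^sup>2) \<le> \<sigma>\<^sub>0 / 4 * ?x\<^sup>2" using \<sigma>0 by (intro mult_left_mono) auto
    moreover have "\<sigma>\<^sub>0 * ?x\<^sup>2 \<le> \<sigma> * ?x\<^sup>2" using \<sigma> by (intro mult_right_mono) auto
    ultimately have ex: "\<sigma>\<^sub>0 * ?x\<^sup>2 / 4 + (- \<sigma> * ?x\<^sup>2 / 2) \<le> \<sigma>\<^sub>0 * R\<^sup>2 / 4 + (- (\<sigma>\<^sub>0 / 8) * s\<^sup>2)"
      by (simp add: algebra_simps)
    have "\<bar>gauss_kernel j \<sigma> ?x\<bar> \<le> A * exp (\<sigma>\<^sub>0 * ?x\<^sup>2 / 4) * exp (- \<sigma> * ?x\<^sup>2 / 2)"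
      unfolding gauss_kernel_def abs_mult power_abs abs_exp_cancel
      using poly[of ?x] by (intro mult_right_mono) auto
    also have "\<dots> = A * exp (\<sigma>\<^sub>0 * ?x\<^sup>2 / 4 + (- \<sigma> * ?x\<^sup>2 / 2))" unfolding exp_add by simp
    also have "\<dots> \<le> A * exp (\<sigma>\<^sub>0 * R\<^sup>2 / 4 + (- (\<sigma>\<^sub>0 / 8) * s\<^sup>2))"
      using ex A by (intro mult_left_mono) auto
    finally show ?thesis unfolding exp_add by simp
  qed
  then show ?thesis using A by (intro that[of "A * exp (\<sigma>\<^sub>0 * R\<^sup>2 / 4)"]) auto
qed

text \<open>Both partial derivatives of a kernel are combinations of kernels of neighbouring degree, to which the
  uniform bound applies.\<close>

lemma gauss_kernel_lipschitz:
  fixes R \<sigma>\<^sub>0 :: real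
  assumes \<sigma>0: "\<sigma>\<^sub>0 > 0"
  obtains C where "\<And>p p' s \<sigma> \<sigma>'. \<bar>p\<bar> \<le> R \<Longrightarrow> \<bar>p'\<bar> \<le> R \<Longrightarrow> \<sigma> \<in> {\<sigma>\<^sub>0..R} \<Longrightarrow> \<sigma>' \<in> {\<sigma>\<^sub>0..R} \<Longrightarrow>
     \<bar>gauss_kernel j \<sigma> (p - s) - gauss_kernel j \<sigma>' (p' - s)\<bar>
       \<le> C * exp (- (\<sigma>\<^sub>0 / 8) * s\<^sup>2) * (\<bar>p - p'\<bar> + \<bar>\<sigma> - \<sigma>'\<bar>)"
proof -
  obtain C1 where C1: "C1 > 0" "\<And>p s \<sigma>. \<bar>p\<bar> \<le> R \<Longrightarrow> \<sigma> \<ge> \<sigma>\<^sub>0 \<Longrightarrow>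
     \<bar>gauss_kernel (j - 1) \<sigma> (p - s)\<bar> \<le> C1 * exp (- (\<sigma>\<^sub>0 / 8) * s\<^sup>2)"
    using gauss_kernel_bound[OF \<sigma>0] by blast
  obtain C2 where C2: "C2 > 0" "\<And>p s \<sigma>. \<bar>p\<bar> \<le> R \<Longrightarrow> \<sigma> \<ge> \<sigma>\<^sub>0 \<Longrightarrow>
     \<bar>gauss_kernel (j + 1) \<sigma> (p - s)\<bar> \<le> C2 * exp (- (\<sigma>\<^sub>0 / 8) * s\<^sup>2)"
    using gauss_kernel_bound[OF \<sigma>0] by blast
  obtain C3 where C3: "C3 > 0" "\<And>p s \<sigma>. \<bar>p\<bar> \<le> R \<Longrightarrow> \<sigma> \<ge> \<sigma>\<^sub>0 \<Longrightarrow>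
     \<bar>gauss_kernel (j + 2) \<sigma> (p - s)\<bar> \<le> C3 * exp (- (\<sigma>\<^sub>0 / 8) * s\<^sup>2)"
    using gauss_kernel_bound[OF \<sigma>0] by blast
  show ?thesis
  proof (rule that[of "real j * C1 + R * C2 + C3"])
    fix p p' s \<sigma> \<sigma>' :: real
    assume p: "\<bar>p\<bar> \<le> R" "\<bar>p'\<bar> \<le> R" and \<sigma>: "\<sigma> \<in> {\<sigma>\<^sub>0..R}" "\<sigma>' \<in> {\<sigma>\<^sub>0..R}"
    let ?e = "exp (- (\<sigma>\<^sub>0 / 8) * s\<^sup>2)"
    have "norm (gauss_kernel j \<sigma> (p - s) - gauss_kernel j \<sigma> (p' - s))
        \<le> ((real j * C1 + R * C2) * ?e) * norm (p - p')"
    proof (rule field_differentiable_bound[where S="{-R..R}" and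
          f'="\<lambda>p. real j * gauss_kernel (j - 1) \<sigma> (p - s) - \<sigma> * gauss_kernel (j + 1) \<sigma> (p - s)"])
      fix q assume q: "q \<in> {-R..R}"
      show "((\<lambda>p. gauss_kernel j \<sigma> (p - s)) has_field_derivative
          real j * gauss_kernel (j - 1) \<sigma> (q - s) - \<sigma> * gauss_kernel (j + 1) \<sigma> (q - s)) (at q within {-R..R})"
        unfolding gauss_kernel_def by (auto intro!: derivative_eq_intros simp: field_simps)
      have "norm (real j * gauss_kernel (j - 1) \<sigma> (q - s) - \<sigma> * gauss_kernel (j + 1) \<sigma> (q - s))
          \<le> real j * \<bar>gauss_kernel (j - 1) \<sigma> (q - s)\<bar> + \<sigma> * \<bar>gauss_kernel (j + 1) \<sigma> (q - s)\<bar>"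
        using \<sigma>0 \<sigma> by (intro order_trans[OF norm_triangle_ineq4]) (auto simp: abs_mult)
      also have "\<dots> \<le> real j * (C1 * ?e) + R * (C2 * ?e)"
        using C1(2)[of q \<sigma> s] C2(2)[of q \<sigma> s] \<sigma> \<sigma>0 q by (intro add_mono mult_mono) auto
      finally show "norm (real j * gauss_kernel (j - 1) \<sigma> (q - s) - \<sigma> * gauss_kernel (j + 1) \<sigma> (q - s))
          \<le> (real j * C1 + R * C2) * ?e" by (simp add: algebra_simps)
    qed (use p in auto)
    moreover have "norm (gauss_kernel j \<sigma> (p' - s) - gauss_kernel j \<sigma>' (p' - s)) \<le> (C3 * ?e) * norm (\<sigma> - \<sigma>')"
    proof (rule field_differentiable_bound[where S="{\<sigma>\<^sub>0..R}" and
          f'="\<lambda>\<sigma>. - gauss_kernel (j + 2) \<sigma> (p' - s) / 2"])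
      fix \<rho> assume \<rho>: "\<rho> \<in> {\<sigma>\<^sub>0..R}"
      show "((\<lambda>\<sigma>. gauss_kernel j \<sigma> (p' - s)) has_field_derivative - gauss_kernel (j + 2) \<rho> (p' - s) / 2)
          (at \<rho> within {\<sigma>\<^sub>0..R})"
        unfolding gauss_kernel_def
        by (auto intro!: derivative_eq_intros simp: power_add power2_eq_square)
      show "norm (- gauss_kernel (j + 2) \<rho> (p' - s) / 2) \<le> C3 * ?e"
        using C3(2)[of p' \<rho> s] p \<rho> by auto
    qed (use \<sigma> in auto)
    ultimately have "\<bar>gauss_kernel j \<sigma> (p - s) - gauss_kernel j \<sigma>' (p' - s)\<bar>
        \<le> ((real j * C1 + R * C2) * ?e) * \<bar>p - p'\<bar> + (C3 * ?e) * \<bar>\<sigma> - \<sigma>'\<bar>"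
      by simp
    also have "\<dots> \<le> ((real j * C1 + R * C2 + C3) * ?e) * \<bar>p - p'\<bar> + ((real j * C1 + R * C2 + C3) * ?e) * \<bar>\<sigma> - \<sigma>'\<bar>"
    proof -
      have "0 \<le> real j * C1" "0 \<le> R * C2" using C1 C2 \<sigma> \<sigma>0 by auto
      then have "real j * C1 + R * C2 \<le> real j * C1 + R * C2 + C3" "C3 \<le> real j * C1 + R * C2 + C3"
        using C3 by auto
      then show ?thesis by (intro add_mono[OF mult_right_mono mult_right_mono] mult_right_mono) auto
    qed
    finally show "\<bar>gauss_kernel j \<sigma> (p - s) - gauss_kernel j \<sigma>' (p' - s)\<bar>
        \<le> (real j * C1 + R * C2 + C3) * ?e * (\<bar>p - p'\<bar> + \<bar>\<sigma> - \<sigma>'\<bar>)"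
      by (simp add: algebra_simps)
  qed
qed

text \<open>Every width is required, since \<open>\<sigma>\<close> ranges over all positive numbers and the uniform bounds give up part of the
  exponent.\<close>

definition gauss_integrable :: "(real \<Rightarrow> complex) \<Rightarrow> bool" where
  "gauss_integrable v \<longleftrightarrow> v \<in> borel_measurable borel \<and>
     (\<forall>\<delta>>0. integrable lborel (\<lambda>s. exp (- \<delta> * s\<^sup>2) *\<^sub>R v s))"

lemma gauss_integrableD:
  "gauss_integrable v \<Longrightarrow> \<delta> > 0 \<Longrightarrow> integrable lborel (\<lambda>s. exp (- \<delta> * s\<^sup>2) *\<^sub>R v s)"
  unfolding gauss_integrable_def by blast

definition moment :: "(real \<Rightarrow> complex) \<Rightarrow> nat \<Rightarrow> real \<Rightarrow> real \<Rightarrow> complex" where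
  "moment v j p \<sigma> = (LINT s|lborel. gauss_kernel j \<sigma> (p - s) *\<^sub>R v s)"

lemma borel_measurable_gauss_kernel [measurable]: "gauss_kernel j \<sigma> \<in> borel_measurable borel"
  unfolding gauss_kernel_def by measurable

lemma integrable_gauss_kernel:
  assumes v: "gauss_integrable v" and \<sigma>: "\<sigma> > 0"
  shows "integrable lborel (\<lambda>s. gauss_kernel j \<sigma> (p - s) *\<^sub>R v s)"
proof -
  have [measurable]: "v \<in> borel_measurable borel" using v by (simp add: gauss_integrable_def)
  obtain C where C: "C > 0" "\<And>s. \<bar>gauss_kernel j \<sigma> (p - s)\<bar> \<le> C * exp (- (\<sigma> / 8) * s\<^sup>2)"
    using gauss_kernel_bound[OF \<sigma>, where R="\<bar>p\<bar>" and j=j] by (metis order_refl)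
  have "integrable lborel (\<lambda>s. C *\<^sub>R (exp (- (\<sigma> / 8) * s\<^sup>2) *\<^sub>R v s))"
    using \<sigma> by (intro integrable_scaleR_right gauss_integrableD[OF v]) simp
  then show ?thesis
  proof (rule Bochner_Integration.integrable_bound)
    show "AE s in lborel. norm (gauss_kernel j \<sigma> (p - s) *\<^sub>R v s) \<le> norm (C *\<^sub>R (exp (- (\<sigma> / 8) * s\<^sup>2) *\<^sub>R v s))"
      using C(2) C(1) by (intro AE_I2) (simp add: mult_right_mono mult.assoc[symmetric])
  qed measurable
qed

lemma moment_bounded:
  assumes v: "gauss_integrable v" and \<sigma>0: "\<sigma>\<^sub>0 > 0"
  obtains B where "B \<ge> 0" "\<And>p \<sigma>. \<bar>p\<bar> \<le> R \<Longrightarrow> \<sigma> \<ge> \<sigma>\<^sub>0 \<Longrightarrow> norm (moment v j p \<sigma>) \<le> B"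
proof -
  obtain C where C: "C > 0" "\<And>p s \<sigma>. \<bar>p\<bar> \<le> R \<Longrightarrow> \<sigma> \<ge> \<sigma>\<^sub>0 \<Longrightarrow>
     \<bar>gauss_kernel j \<sigma> (p - s)\<bar> \<le> C * exp (- (\<sigma>\<^sub>0 / 8) * s\<^sup>2)"
    using gauss_kernel_bound[OF \<sigma>0] by blast
  have int: "integrable lborel (\<lambda>s. exp (- (\<sigma>\<^sub>0 / 8) * s\<^sup>2) *\<^sub>R v s)"
    using \<sigma>0 by (intro gauss_integrableD[OF v]) simp
  have "norm (moment v j p \<sigma>) \<le> C * (LINT s|lborel. norm (exp (- (\<sigma>\<^sub>0 / 8) * s\<^sup>2) *\<^sub>R v s))"
    if "\<bar>p\<bar> \<le> R" "\<sigma> \<ge> \<sigma>\<^sub>0" for p \<sigma>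
  proof -
    have "norm (moment v j p \<sigma>) \<le> (LINT s|lborel. norm (gauss_kernel j \<sigma> (p - s) *\<^sub>R v s))"
      unfolding moment_def by (rule integral_norm_bound)
    also have "\<dots> \<le> (LINT s|lborel. C * norm (exp (- (\<sigma>\<^sub>0 / 8) * s\<^sup>2) *\<^sub>R v s))"
    proof (rule integral_mono)
      show "integrable lborel (\<lambda>s. norm (gauss_kernel j \<sigma> (p - s) *\<^sub>R v s))"
        using that \<sigma>0 by (intro integrable_norm integrable_gauss_kernel v) auto
      show "integrable lborel (\<lambda>s. C * norm (exp (- (\<sigma>\<^sub>0 / 8) * s\<^sup>2) *\<^sub>R v s))"
        by (intro integrable_mult_right integrable_norm int)
      fix s
      show "norm (gauss_kernel j \<sigma> (p - s) *\<^sub>R v s) \<le> C * norm (exp (- (\<sigma>\<^sub>0 / 8) * s\<^sup>2) *\<^sub>R v s)"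
        using mult_right_mono[OF C(2)[OF that, of s], of "norm (v s)"] by (simp add: mult.assoc)
    qed
    finally show ?thesis by simp
  qed
  then show ?thesis using C(1)
    by (intro that[of "C * (LINT s|lborel. norm (exp (- (\<sigma>\<^sub>0 / 8) * s\<^sup>2) *\<^sub>R v s))"]) auto
qed

lemma moment_lipschitz:
  assumes v: "gauss_integrable v" and \<sigma>0: "\<sigma>\<^sub>0 > 0"
  obtains L where "\<And>p p' \<sigma> \<sigma>'. \<bar>p\<bar> \<le> R \<Longrightarrow> \<bar>p'\<bar> \<le> R \<Longrightarrow> \<sigma> \<in> {\<sigma>\<^sub>0..R} \<Longrightarrow> \<sigma>' \<in> {\<sigma>\<^sub>0..R} \<Longrightarrow>
     norm (moment v j p \<sigma> - moment v j p' \<sigma>') \<le> L * (\<bar>p - p'\<bar> + \<bar>\<sigma> - \<sigma>'\<bar>)"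
proof -
  obtain C where C: "\<And>p p' s \<sigma> \<sigma>'. \<bar>p\<bar> \<le> R \<Longrightarrow> \<bar>p'\<bar> \<le> R \<Longrightarrow> \<sigma> \<in> {\<sigma>\<^sub>0..R} \<Longrightarrow> \<sigma>' \<in> {\<sigma>\<^sub>0..R} \<Longrightarrow>
     \<bar>gauss_kernel j \<sigma> (p - s) - gauss_kernel j \<sigma>' (p' - s)\<bar>
       \<le> C * exp (- (\<sigma>\<^sub>0 / 8) * s\<^sup>2) * (\<bar>p - p'\<bar> + \<bar>\<sigma> - \<sigma>'\<bar>)"
    using gauss_kernel_lipschitz[OF \<sigma>0] by blast
  have int: "integrable lborel (\<lambda>s. exp (- (\<sigma>\<^sub>0 / 8) * s\<^sup>2) *\<^sub>R v s)"
    using \<sigma>0 by (intro gauss_integrableD[OF v]) simp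
  let ?I = "LINT s|lborel. norm (exp (- (\<sigma>\<^sub>0 / 8) * s\<^sup>2) *\<^sub>R v s)"
  have "norm (moment v j p \<sigma> - moment v j p' \<sigma>') \<le> (C * ?I) * (\<bar>p - p'\<bar> + \<bar>\<sigma> - \<sigma>'\<bar>)"
    if a: "\<bar>p\<bar> \<le> R" "\<bar>p'\<bar> \<le> R" "\<sigma> \<in> {\<sigma>\<^sub>0..R}" "\<sigma>' \<in> {\<sigma>\<^sub>0..R}" for p p' \<sigma> \<sigma>'
  proof -
    let ?d = "\<bar>p - p'\<bar> + \<bar>\<sigma> - \<sigma>'\<bar>"
    have i: "integrable lborel (\<lambda>s. gauss_kernel j \<sigma> (p - s) *\<^sub>R v s)"
      "integrable lborel (\<lambda>s. gauss_kernel j \<sigma>' (p' - s) *\<^sub>R v s)"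
      using a \<sigma>0 by (auto intro!: integrable_gauss_kernel v)
    have "moment v j p \<sigma> - moment v j p' \<sigma>'
        = (LINT s|lborel. gauss_kernel j \<sigma> (p - s) *\<^sub>R v s - gauss_kernel j \<sigma>' (p' - s) *\<^sub>R v s)"
      unfolding moment_def using i by simp
    also have "norm \<dots> \<le> (LINT s|lborel. norm (gauss_kernel j \<sigma> (p - s) *\<^sub>R v s - gauss_kernel j \<sigma>' (p' - s) *\<^sub>R v s))"
      by (rule integral_norm_bound)
    also have "\<dots> \<le> (LINT s|lborel. (C * ?d) * norm (exp (- (\<sigma>\<^sub>0 / 8) * s\<^sup>2) *\<^sub>R v s))"
    proof (rule integral_mono)
      show "integrable lborel (\<lambda>s. norm (gauss_kernel j \<sigma> (p - s) *\<^sub>R v s - gauss_kernel j \<sigma>' (p' - s) *\<^sub>R v s))"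
        using i by (intro integrable_norm Bochner_Integration.integrable_diff)
      show "integrable lborel (\<lambda>s. (C * ?d) * norm (exp (- (\<sigma>\<^sub>0 / 8) * s\<^sup>2) *\<^sub>R v s))"
        by (intro integrable_mult_right integrable_norm int)
      fix s
      show "norm (gauss_kernel j \<sigma> (p - s) *\<^sub>R v s - gauss_kernel j \<sigma>' (p' - s) *\<^sub>R v s)
          \<le> (C * ?d) * norm (exp (- (\<sigma>\<^sub>0 / 8) * s\<^sup>2) *\<^sub>R v s)"
        unfolding scaleR_left_diff_distrib[symmetric]
        using mult_right_mono[OF C[OF a, of s], of "norm (v s)"] by (simp add: mult_ac)
    qed
    also have "\<dots> = (C * ?d) * ?I" by (rule integral_mult_right_zero)
    finally show ?thesis by (simp only: mult_ac)
  qed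
  then show ?thesis using that by blast
qed

section \<open>Power series of the curve and the cusp criterion\<close>

lemma sums_exp_square:
  fixes a h :: real
  shows "(\<lambda>j. (if even j then a ^ (j div 2) / fact (j div 2) else 0) * h ^ j) sums exp (a * h\<^sup>2)"
proof -
  have "(\<lambda>n. (a * h\<^sup>2) ^ n / fact n) sums exp (a * h\<^sup>2)"
    using exp_converges[of "a * h\<^sup>2"] by (simp add: divide_inverse mult.commute)
  from sums_if[OF sums_zero this]
  have "(\<lambda>j. if even j then (a * h\<^sup>2) ^ (j div 2) / fact (j div 2) else 0) sums exp (a * h\<^sup>2)" by simp
  moreover have "(if even j then (a * h\<^sup>2) ^ (j div 2) / fact (j div 2) else 0)
      = (if even j then a ^ (j div 2) / fact (j div 2) else 0) * h ^ j" for j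
    by (auto simp: power_mult_distrib power_mult[symmetric])
  ultimately show ?thesis by simp
qed

text \<open>Completing the square: a linear exponent is absorbed by half of the quadratic one. This supplies the
  dominating function for the power series in \<open>h\<close>.\<close>

lemma exp_linear_le_gaussian:
  fixes \<sigma> h x :: real
  assumes "\<sigma> > 0"
  shows "exp (\<bar>\<sigma> * h * x\<bar>) * exp (- \<sigma> * x\<^sup>2 / 2) \<le> exp (\<sigma> * h\<^sup>2) * exp (- (\<sigma> / 2) * x\<^sup>2 / 2)"
proof -
  have "\<bar>h\<bar> * \<bar>x\<bar> \<le> h\<^sup>2 + x\<^sup>2 / 4"
    using zero_le_power2[of "\<bar>h\<bar> - \<bar>x\<bar> / 2"] by (simp add: power2_diff power_divide)
  then have "\<sigma> * (\<bar>h\<bar> * \<bar>x\<bar>) \<le> \<sigma> * (h\<^sup>2 + x\<^sup>2 / 4)" using assms by (intro mult_left_mono) auto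
  then have "\<bar>\<sigma> * h * x\<bar> + (- \<sigma> * x\<^sup>2 / 2) \<le> \<sigma> * h\<^sup>2 + (- (\<sigma> / 2) * x\<^sup>2 / 2)"
    using assms by (simp add: abs_mult algebra_simps)
  then show ?thesis unfolding exp_add[symmetric] by simp
qed

text \<open>Expanding \<open>exp (- \<sigma> h (p - s))\<close> in powers of \<open>h\<close> under the integral sign; the terms are moments of the path.\<close>

lemma shifted_gaussian_series:
  assumes v: "gauss_integrable v" and \<sigma>: "\<sigma> > 0"
  shows "summable (\<lambda>i. norm (of_real ((- \<sigma> * h) ^ i / fact i) * moment v i p \<sigma>))"
    and "(\<lambda>i. of_real ((- \<sigma> * h) ^ i / fact i) * moment v i p \<sigma>) sums
      (LINT s|lborel. (exp (- \<sigma> * h * (p - s)) * exp (- \<sigma> * (p - s)\<^sup>2 / 2)) *\<^sub>R v s)"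
proof -
  define f where "f i s = ((- \<sigma> * h) ^ i / fact i) *\<^sub>R (gauss_kernel i \<sigma> (p - s) *\<^sub>R v s)" for i s
  have fint: "integrable lborel (f i)" for i
    unfolding f_def by (intro integrable_scaleR_right integrable_gauss_kernel v \<sigma>)
  have feq: "f i s = ((- \<sigma> * h * (p - s)) ^ i / fact i) *\<^sub>R (exp (- \<sigma> * (p - s)\<^sup>2 / 2) *\<^sub>R v s)" for i s
    unfolding f_def gauss_kernel_def power_mult_distrib[of "- \<sigma> * h" "p - s"] by (simp add: mult_ac)
  have fsums: "(\<lambda>i. f i s) sums (exp (- \<sigma> * h * (p - s)) *\<^sub>R (exp (- \<sigma> * (p - s)\<^sup>2 / 2) *\<^sub>R v s))" for s
    unfolding feq using exp_converges[of "- \<sigma> * h * (p - s)"]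
    by (intro sums_scaleR_left) (simp add: divide_inverse mult.commute)
  have fnorm: "norm (f i s) = (\<bar>\<sigma> * h * (p - s)\<bar> ^ i / fact i) * (exp (- \<sigma> * (p - s)\<^sup>2 / 2) * norm (v s))" for i s
    unfolding feq by (simp add: power_abs abs_mult)
  have fsumsn: "(\<lambda>i. norm (f i s)) sums (exp \<bar>\<sigma> * h * (p - s)\<bar> * (exp (- \<sigma> * (p - s)\<^sup>2 / 2) * norm (v s)))" for s
    unfolding fnorm using exp_converges[of "\<bar>\<sigma> * h * (p - s)\<bar>"]
    by (intro sums_mult2) (simp add: divide_inverse mult.commute)
  let ?D = "\<lambda>s. exp (\<sigma> * h\<^sup>2) * norm (gauss_kernel 0 (\<sigma> / 2) (p - s) *\<^sub>R v s)"
  have Dint: "integrable lborel ?D"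
    using \<sigma> by (intro integrable_mult_right integrable_norm integrable_gauss_kernel v) auto
  have Dbound: "exp \<bar>\<sigma> * h * (p - s)\<bar> * (exp (- \<sigma> * (p - s)\<^sup>2 / 2) * norm (v s)) \<le> ?D s" for s
    using mult_right_mono[OF exp_linear_le_gaussian[OF \<sigma>, of h "p - s"], of "norm (v s)"]
    by (simp add: gauss_kernel_def mult.assoc)
  have sumint: "summable (\<lambda>i. LINT s|lborel. norm (f i s))"
  proof (rule summableI_nonneg_bounded)
    fix n
    have "(\<Sum>i<n. LINT s|lborel. norm (f i s)) = (LINT s|lborel. (\<Sum>i<n. norm (f i s)))"
      using fint by (intro Bochner_Integration.integral_sum[symmetric] integrable_norm)
    also have "\<dots> \<le> (LINT s|lborel. ?D s)"
    proof (rule integral_mono)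
      show "integrable lborel (\<lambda>s. \<Sum>i<n. norm (f i s))"
        using fint by (intro Bochner_Integration.integrable_sum integrable_norm)
      fix s
      have "(\<Sum>i<n. norm (f i s)) \<le> (\<Sum>i. norm (f i s))"
        using fsumsn[of s] by (intro sum_le_suminf) (auto simp: sums_iff)
      then show "(\<Sum>i<n. norm (f i s)) \<le> ?D s"
        using fsumsn[of s] Dbound[of s] by (simp add: sums_iff)
    qed (rule Dint)
    finally show "(\<Sum>i<n. LINT s|lborel. norm (f i s)) \<le> (LINT s|lborel. ?D s)" .
  qed simp
  have int_f: "(LINT s|lborel. f i s) = of_real ((- \<sigma> * h) ^ i / fact i) * moment v i p \<sigma>" for i
    unfolding f_def moment_def integral_scaleR_right by (rule scaleR_conv_of_real)
  have "(\<lambda>i. LINT s|lborel. f i s) sums (LINT s|lborel. (\<Sum>i. f i s))"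
    using fsumsn sumint by (intro sums_integral fint AE_I2) (auto simp: sums_iff)
  moreover have "(\<Sum>i. f i s) = (exp (- \<sigma> * h * (p - s)) * exp (- \<sigma> * (p - s)\<^sup>2 / 2)) *\<^sub>R v s" for s
    using fsums[of s] by (simp add: sums_iff)
  ultimately show "(\<lambda>i. of_real ((- \<sigma> * h) ^ i / fact i) * moment v i p \<sigma>) sums
      (LINT s|lborel. (exp (- \<sigma> * h * (p - s)) * exp (- \<sigma> * (p - s)\<^sup>2 / 2)) *\<^sub>R v s)"
    unfolding int_f by (simp only:)
  have "summable (\<lambda>i. norm (LINT s|lborel. f i s))"
    by (rule summable_comparison_test'[OF sumint, of 0]) (simp add: integral_norm_bound)
  then show "summable (\<lambda>i. norm (of_real ((- \<sigma> * h) ^ i / fact i) * moment v i p \<sigma>))"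
    unfolding int_f .
qed

lemma conga_eq_moment:
  assumes v: "gauss_integrable (zero_extension w)" and \<tau>: "\<tau> > 0"
  shows "conga w p \<tau> = (1 / sqrt (2 * pi * \<tau>)) *\<^sub>R moment (zero_extension w) 0 p (1 / \<tau>)"
proof -
  let ?v = "zero_extension w"
  let ?d = "normal_density 0 (sqrt \<tau>)"
  have [measurable]: "?v \<in> borel_measurable borel" using v by (simp add: gauss_integrable_def)
  have "conga w p \<tau> = (LINT z|lborel. ?d z *\<^sub>R ?v (p - z))"
    unfolding conga_def by (subst integral_density) (auto simp: normal_density_nonneg)
  also have "\<dots> = (LINT s|lborel. ?d (p - s) *\<^sub>R ?v s)"
    by (subst lborel_integral_real_affine[of "-1" _ p]) auto
  also have "\<dots> = (LINT s|lborel. (1 / sqrt (2 * pi * \<tau>)) *\<^sub>R (gauss_kernel 0 (1 / \<tau>) (p - s) *\<^sub>R ?v s))"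
    using \<tau> by (intro Bochner_Integration.integral_cong) (auto simp: normal_density_def gauss_kernel_def)
  finally show ?thesis unfolding moment_def by (simp only: integral_scaleR_right)
qed

text \<open>Since \<open>(p + h - s)\<^sup>2 = (p - s)\<^sup>2 + 2 h (p - s) + h\<^sup>2\<close>, the shifted Gaussian factors into \<open>exp (- \<sigma> h\<^sup>2 / 2)\<close> and the
  kernel of \<open>shifted_gaussian_series\<close>; the coefficients come from the Cauchy product of the two series. The radius of
  convergence is infinite.\<close>

lemma conga_power_series:
  assumes v: "gauss_integrable (zero_extension w)" and \<tau>: "\<tau> > 0"
  defines "\<sigma> \<equiv> 1 / \<tau>" and "K \<equiv> 1 / sqrt (2 * pi * \<tau>)"
  obtains c :: "nat \<Rightarrow> complex" where
    "\<And>h. (\<lambda>i. c i * of_real (h ^ i)) sums conga w (p + h) \<tau>"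
    "c 1 = of_real (- K * \<sigma>) * moment (zero_extension w) 1 p \<sigma>"
    "c 2 = of_real (K * \<sigma> / 2) * (of_real \<sigma> * moment (zero_extension w) 2 p \<sigma> - moment (zero_extension w) 0 p \<sigma>)"
    "c 3 = of_real (K * \<sigma>\<^sup>2 / 2) * moment (zero_extension w) 1 p \<sigma>
         - of_real (K * \<sigma>^3 / 6) * moment (zero_extension w) 3 p \<sigma>"
proof -
  let ?v = "zero_extension w"
  have \<sigma>: "\<sigma> > 0" using \<tau> by (simp add: \<sigma>_def)
  \<comment> \<open>Coefficients of \<open>exp (- \<sigma> h\<^sup>2 / 2)\<close> and of the series in the moments, as power series in \<open>h\<close>.\<close>
  define e where "e j = (if even j then (- \<sigma> / 2) ^ (j div 2) / fact (j div 2) else 0 :: real)" for j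
  define d where "d i = of_real ((- \<sigma>) ^ i / fact i) * moment ?v i p \<sigma>" for i
  define c where "c k = of_real K * (\<Sum>i\<le>k. of_real (e i) * d (k - i))" for k
  have "(\<lambda>i. c i * of_real (h ^ i)) sums conga w (p + h) \<tau>" for h
  proof -
    let ?a = "\<lambda>i. of_real (e i * h ^ i) :: complex"
    let ?b = "\<lambda>i. d i * of_real (h ^ i)"
    let ?S = "LINT s|lborel. (exp (- \<sigma> * h * (p - s)) * exp (- \<sigma> * (p - s)\<^sup>2 / 2)) *\<^sub>R ?v s"
    have beq: "?b i = of_real ((- \<sigma> * h) ^ i / fact i) * moment ?v i p \<sigma>" for i
      unfolding d_def power_mult_distrib by (simp add: mult_ac)
    have b: "?b sums ?S" "summable (\<lambda>i. norm (?b i))"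
      unfolding beq using shifted_gaussian_series[OF v \<sigma>] by blast+
    have "(\<lambda>i. e i * h ^ i) sums exp (- \<sigma> / 2 * h\<^sup>2)"
      unfolding e_def by (rule sums_exp_square)
    then have a: "?a sums of_real (exp (- \<sigma> / 2 * h\<^sup>2))" by (rule sums_of_real)
    have "summable (\<lambda>i. \<bar>e i * h ^ i\<bar>)"
    proof -
      have "\<bar>e i * h ^ i\<bar> = (if even i then (\<sigma> / 2) ^ (i div 2) / fact (i div 2) else 0) * \<bar>h\<bar> ^ i" for i
        using \<sigma> by (simp add: e_def abs_mult power_abs)
      then show ?thesis using sums_summable[OF sums_exp_square[of "\<sigma> / 2" "\<bar>h\<bar>"]] by simp
    qed
    then have a': "summable (\<lambda>i. norm (?a i))" by (simp only: norm_of_real)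
    have "(\<lambda>k. \<Sum>i\<le>k. ?a i * ?b (k - i)) sums (suminf ?a * suminf ?b)"
      by (rule Cauchy_product_sums[OF a' b(2)])
    then have "(\<lambda>k. \<Sum>i\<le>k. ?a i * ?b (k - i)) sums (of_real (exp (- \<sigma> / 2 * h\<^sup>2)) * ?S)"
      using a b(1) by (simp add: sums_iff)
    then have "(\<lambda>k. of_real K * (\<Sum>i\<le>k. ?a i * ?b (k - i))) sums (of_real K * (of_real (exp (- \<sigma> / 2 * h\<^sup>2)) * ?S))"
      by (rule sums_mult)
    moreover have "of_real K * (\<Sum>i\<le>k. ?a i * ?b (k - i)) = c k * of_real (h ^ k)" for k
    proof -
      have "?a i * ?b (k - i) = of_real (e i) * d (k - i) * of_real (h ^ k)" if "i \<le> k" for i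
      proof -
        have "complex_of_real (h ^ i) * of_real (h ^ (k - i)) = of_real (h ^ k)"
          unfolding of_real_mult[symmetric] power_add[symmetric] using that by simp
        moreover have "?a i * ?b (k - i) = of_real (e i) * d (k - i) * (of_real (h ^ i) * of_real (h ^ (k - i)))"
          unfolding of_real_mult by (simp only: mult_ac)
        ultimately show ?thesis by (simp only:)
      qed
      then have "(\<Sum>i\<le>k. ?a i * ?b (k - i)) = (\<Sum>i\<le>k. of_real (e i) * d (k - i)) * of_real (h ^ k)"
        unfolding sum_distrib_right by (intro sum.cong) auto
      then show ?thesis by (simp add: c_def)
    qed
    moreover have "of_real K * (of_real (exp (- \<sigma> / 2 * h\<^sup>2)) * ?S) = conga w (p + h) \<tau>"
    proof -
      have "exp (- \<sigma> / 2 * h\<^sup>2) * (exp (- \<sigma> * h * (p - s)) * exp (- \<sigma> * (p - s)\<^sup>2 / 2))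
          = gauss_kernel 0 \<sigma> (p + h - s)" for s
      proof -
        have "- \<sigma> / 2 * h\<^sup>2 + (- \<sigma> * h * (p - s) + - \<sigma> * (p - s)\<^sup>2 / 2) = - \<sigma> * (p + h - s)\<^sup>2 / 2"
          by (simp add: power2_eq_square field_simps)
        then show ?thesis unfolding exp_add[symmetric] by (simp add: gauss_kernel_def)
      qed
      then have "of_real (exp (- \<sigma> / 2 * h\<^sup>2)) * ?S = moment ?v 0 (p + h) \<sigma>"
        unfolding moment_def scaleR_conv_of_real[symmetric]
        by (simp only: integral_scaleR_right[symmetric] scaleR_scaleR)
      then show ?thesis
        unfolding conga_eq_moment[OF v \<tau>] K_def \<sigma>_def by (simp only: scaleR_conv_of_real)
    qed
    ultimately show ?thesis by (simp only:)
  qed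
  moreover have "e 0 = 1" "e 1 = 0" "e 2 = - \<sigma> / 2" "e 3 = 0" by (simp_all add: e_def)
  moreover have "d 0 = moment ?v 0 p \<sigma>" "d 1 = - of_real \<sigma> * moment ?v 1 p \<sigma>"
    "d 2 = of_real (\<sigma>\<^sup>2 / 2) * moment ?v 2 p \<sigma>" "d 3 = - of_real (\<sigma>^3 / 6) * moment ?v 3 p \<sigma>"
    by (simp_all add: d_def fact_numeral)
  moreover have "c 1 = of_real K * (of_real (e 0) * d 1 + of_real (e 1) * d 0)"
    by (simp add: c_def)
  moreover have "c 2 = of_real K * (of_real (e 0) * d 2 + of_real (e 1) * d 1 + of_real (e 2) * d 0)"
    by (simp add: c_def eval_nat_numeral)
  moreover have "c 3 = of_real K * (of_real (e 0) * d 3 + of_real (e 1) * d 2 + of_real (e 2) * d 1 + of_real (e 3) * d 0)"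
    by (simp add: c_def eval_nat_numeral)
  ultimately show ?thesis
    by (intro that[of c]) (simp_all add: algebra_simps power2_eq_square)
qed

text \<open>The series converges at all real, hence at all complex arguments, so the derivative is that of an entire
  function restricted to the real line.\<close>

lemma power_series_has_vector_derivative:
  fixes c :: "nat \<Rightarrow> complex" and \<gamma> :: "real \<Rightarrow> complex"
  assumes s: "\<And>h. (\<lambda>i. c i * of_real (h ^ i)) sums \<gamma> (p + h)"
  shows "(\<gamma> has_vector_derivative c 1) (at p)"
proof -
  define F where "F z = (\<Sum>n. c n * z ^ n)" for z
  have sm: "summable (\<lambda>n. c n * y ^ n)" for y :: complex
    using sums_summable[OF s[of "norm y + 1"]] 
    by (intro powser_inside[of c "of_real (norm y + 1)" y]) (auto simp del: of_real_add)
  have "(F has_field_derivative (\<Sum>n. diffs c n * 0 ^ n)) (at 0)"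
    unfolding F_def by (rule termdiffs_strong_converges_everywhere[OF sm])
  then have "(F has_field_derivative c 1) (at (of_real p - of_real p))"
    by (simp add: powser_zero diffs_def)
  then have "((\<lambda>z. F (z - of_real p)) has_field_derivative c 1 * 1) (at (of_real p))"
    by (rule DERIV_chain2) (auto intro!: derivative_eq_intros)
  then have "((\<lambda>t. F (of_real t - of_real p)) has_vector_derivative c 1) (at p)"
    by (intro has_vector_derivative_real_field) simp
  moreover have "F (of_real t - of_real p) = \<gamma> t" for t
    using s[of "t - p"] by (simp add: F_def sums_iff)
  ultimately show ?thesis by simp
qed

text \<open>Rotating by minus the argument of \<open>c 2\<close> makes the quadratic term real and positive, so that the second coordinate
  starts at degree 3. Its cubic coefficient is then \<open>Im (c 3 * cnj (c 2)) / \<bar>c 2\<bar>\<close>, which vanishes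
  exactly when \<open>c 2\<close> and \<open>c 3\<close> are linearly dependent over the reals.\<close>

lemma cusp_singularityI:
  fixes c :: "nat \<Rightarrow> complex" and \<gamma> :: "real \<Rightarrow> complex"
  assumes sing: "curve_singularity \<gamma> p" and an: "real_analytic_on \<gamma> UNIV"
    and s: "\<And>h. (\<lambda>i. c i * of_real (h ^ i)) sums \<gamma> (p + h)"
    and c1: "c 1 = 0" and c23: "Im (c 3 * cnj (c 2)) \<noteq> 0"
  shows "cusp_singularity \<gamma> p"
proof -
  have c2: "c 2 \<noteq> 0" using c23 by auto
  have "(\<lambda>i. c i * of_real (0 ^ i)) sums c 0" using powser_sums_zero[of c] by simp
  from sums_unique2[OF s[of 0] this] have c0: "\<gamma> p = c 0" by simp
  define \<theta> where "\<theta> = - Arg (c 2)"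
  have rot: "cis \<theta> = cnj (c 2) / of_real (norm (c 2))"
  proof -
    have "cis \<theta> = cnj (cis (Arg (c 2)))" by (simp add: \<theta>_def cis_cnj)
    also have "cis (Arg (c 2)) = c 2 / of_real (norm (c 2))" using c2 by (simp add: cis_Arg sgn_eq)
    finally show ?thesis by simp
  qed
  have a2: "cis \<theta> * c 2 = of_real (norm (c 2))"
    using c2 complex_norm_square[of "c 2"]
    by (simp add: rot power2_eq_square mult.commute field_simps)
  have b3: "Im (cis \<theta> * c 3) = Im (c 3 * cnj (c 2)) / norm (c 2)"
    by (simp add: rot mult.commute Im_divide_of_real)
  define a where "a i = Re (cis \<theta> * c i)" for i
  define b where "b i = Im (cis \<theta> * c i)" for i
  have main: "(\<lambda>i. a (i + 2) * (t - p) ^ (i + 2)) sums Re (cis \<theta> * (\<gamma> t - \<gamma> p)) \<and>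
      (\<lambda>i. b (i + 3) * (t - p) ^ (i + 3)) sums Im (cis \<theta> * (\<gamma> t - \<gamma> p))" for t
  proof -
    have "(\<lambda>i. cis \<theta> * (c i * of_real ((t - p) ^ i))) sums (cis \<theta> * \<gamma> t)"
      using s[of "t - p"] by (intro sums_mult) simp
    then have full: "(\<lambda>i. cis \<theta> * c i * of_real ((t - p) ^ i)) sums (cis \<theta> * (\<gamma> t - \<gamma> p) + cis \<theta> * c 0)"
      by (simp add: c0 algebra_simps)
    have re: "Re (z * of_real r) = Re z * r" "Im (z * of_real r) = Im z * r" for z r by simp_all
    have R: "(\<lambda>i. a i * (t - p) ^ i) sums (Re (cis \<theta> * (\<gamma> t - \<gamma> p)) + a 0)"
      using sums_Re[OF full] unfolding a_def by (simp only: re plus_complex.sel)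
    have I: "(\<lambda>i. b i * (t - p) ^ i) sums (Im (cis \<theta> * (\<gamma> t - \<gamma> p)) + b 0)"
      using sums_Im[OF full] unfolding b_def by (simp only: re plus_complex.sel)
    have "a 1 = 0" "b 1 = 0" "b 2 = 0" using c1 a2 by (simp_all add: a_def b_def)
    then have low: "(\<Sum>i<2. a i * (t - p) ^ i) = a 0" "(\<Sum>i<3. b i * (t - p) ^ i) = b 0"
      by (simp_all add: eval_nat_numeral)
    show ?thesis
      using R I unfolding sums_iff_shift[of "\<lambda>i. a i * (t - p) ^ i" 2]
        sums_iff_shift[of "\<lambda>i. b i * (t - p) ^ i" 3] low by blast
  qed
  have "a 2 \<noteq> 0" using a2 c2 by (simp add: a_def)
  moreover have "b 3 \<noteq> 0" using b3 c2 c23 by (simp add: b_def)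
  moreover have "\<exists>\<epsilon>>0. real_analytic_on \<gamma> (ball p \<epsilon>)"
    using an by (intro exI[of _ 1]) (auto simp: real_analytic_on_def)
  ultimately show ?thesis
    unfolding cusp_singularity_def using sing main zero_less_one by blast
qed

section \<open>The degeneracy field\<close>

text \<open>Parameters are triples \<open>(p, \<sigma>, \<theta>)\<close>. Integrated against the path, the two kernels give \<open>m\<^sub>1\<close> and
  \<open>cos \<theta> m\<^sub>3 + sin \<theta> (\<sigma> m\<^sub>2 - m\<^sub>0)\<close>. The angle encodes a real linear dependence projectively, so that the case of
  a vanishing quadratic coefficient needs no separate treatment and the angles range over a compact interval.\<close>

definition kernel1 :: "real \<times> real \<times> real \<Rightarrow> real \<Rightarrow> real" where
  "kernel1 = (\<lambda>(p, \<sigma>, \<theta>) s. gauss_kernel 1 \<sigma> (p - s))"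

definition kernel2 :: "real \<times> real \<times> real \<Rightarrow> real \<Rightarrow> real" where
  "kernel2 = (\<lambda>(p, \<sigma>, \<theta>) s. cos \<theta> * gauss_kernel 3 \<sigma> (p - s)
     + sin \<theta> * (\<sigma> * gauss_kernel 2 \<sigma> (p - s) - gauss_kernel 0 \<sigma> (p - s)))"

text \<open>Primitives in \<open>s\<close> of the kernels that vanish at infinity, as partial integration requires.\<close>

definition primitive1 :: "real \<times> real \<times> real \<Rightarrow> real \<Rightarrow> real" where
  "primitive1 = (\<lambda>(p, \<sigma>, \<theta>) s. exp (- \<sigma> * (p - s)\<^sup>2 / 2) / \<sigma>)"

definition primitive2 :: "real \<times> real \<times> real \<Rightarrow> real \<Rightarrow> real" where
  "primitive2 = (\<lambda>(p, \<sigma>, \<theta>) s. exp (- \<sigma> * (p - s)\<^sup>2 / 2) *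
     (cos \<theta> * ((p - s)\<^sup>2 / \<sigma> + 2 / \<sigma>\<^sup>2) + sin \<theta> * (p - s)))"

text \<open>A singular point at which the hypothesis of \<open>cusp_singularityI\<close> fails gives a zero of this field for some angle.\<close>

definition degeneracy :: "(real \<Rightarrow> complex) \<Rightarrow> real \<times> real \<times> real \<Rightarrow> complex \<times> complex" where
  "degeneracy v q = (LINT s|lborel. kernel1 q s *\<^sub>R v s, LINT s|lborel. kernel2 q s *\<^sub>R v s)"

lemma continuous_on_kernels: "continuous_on S (kernel1 q)" "continuous_on S (kernel2 q)"
  by (cases q; auto simp: kernel1_def kernel2_def gauss_kernel_def intro!: continuous_intros)+

lemma primitive1_derivative:
  assumes "fst (snd q) > 0"
  shows "(primitive1 q has_real_derivative kernel1 q s) (at s)"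
  using assms by (cases q)
    (auto simp: primitive1_def kernel1_def gauss_kernel_def field_simps intro!: derivative_eq_intros)

lemma primitive2_derivative:
  assumes "fst (snd q) > 0"
  shows "(primitive2 q has_real_derivative kernel2 q s) (at s)"
proof -
  obtain p \<sigma> \<theta> where q: "q = (p, \<sigma>, \<theta>)" by (cases q)
  have \<sigma>: "\<sigma> > 0" using assms by (simp add: q)
  define E where "E s = exp (- \<sigma> * (p - s)\<^sup>2 / 2)" for s
  have E: "(E has_real_derivative \<sigma> * (p - s) * E s) (at s)"
    unfolding E_def by (auto intro!: derivative_eq_intros simp: field_simps)
  have D: "((\<lambda>s. E s * (cos \<theta> * ((p - s)\<^sup>2 / \<sigma> + 2 / \<sigma>\<^sup>2) + sin \<theta> * (p - s))) has_real_derivative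
      \<sigma> * (p - s) * E s * (cos \<theta> * ((p - s)\<^sup>2 / \<sigma> + 2 / \<sigma>\<^sup>2) + sin \<theta> * (p - s))
      + (cos \<theta> * (- 2 * (p - s) / \<sigma>) - sin \<theta>) * E s) (at s)"
    using \<sigma> by (auto intro!: derivative_eq_intros E simp: field_simps)
  have poly: "\<sigma> * x * e * (c * (x\<^sup>2 / \<sigma> + 2 / \<sigma>\<^sup>2) + d * x) + (c * (- 2 * x / \<sigma>) - d) * e
      = c * (x ^ 3 * e) + d * (\<sigma> * (x ^ 2 * e) - e)" for x e c d :: real
    using \<sigma> by (simp add: field_simps power2_eq_square power3_eq_cube)
  show ?thesis
    using D unfolding poly by (simp add: q primitive2_def kernel2_def gauss_kernel_def E_def)
qed

lemma primitives_vanish_at_top: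
  assumes "fst (snd q) > 0"
  shows "(primitive1 q \<longlongrightarrow> 0) at_top" "(primitive2 q \<longlongrightarrow> 0) at_top"
proof -
  obtain p \<sigma> \<theta> where q: "q = (p, \<sigma>, \<theta>)" by (cases q)
  have \<sigma>: "\<sigma> > 0" using assms by (simp add: q)
  have l: "((\<lambda>s. exp (- \<sigma> * (p - s)\<^sup>2 / 2)) \<longlongrightarrow> 0) at_top"
    "((\<lambda>s. exp (- \<sigma> * (p - s)\<^sup>2 / 2) * (p - s)) \<longlongrightarrow> 0) at_top"
    "((\<lambda>s. exp (- \<sigma> * (p - s)\<^sup>2 / 2) * (p - s)\<^sup>2) \<longlongrightarrow> 0) at_top"
    using \<sigma> by real_asymp+
  show "(primitive1 q \<longlongrightarrow> 0) at_top"
    unfolding q primitive1_def using tendsto_divide[OF l(1) tendsto_const[of \<sigma>]] \<sigma> by simp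
  have "((\<lambda>s. cos \<theta> / \<sigma> * (exp (- \<sigma> * (p - s)\<^sup>2 / 2) * (p - s)\<^sup>2)
      + cos \<theta> * 2 / \<sigma>\<^sup>2 * exp (- \<sigma> * (p - s)\<^sup>2 / 2)
      + sin \<theta> * (exp (- \<sigma> * (p - s)\<^sup>2 / 2) * (p - s))) \<longlongrightarrow> cos \<theta> / \<sigma> * 0 + cos \<theta> * 2 / \<sigma>\<^sup>2 * 0 + sin \<theta> * 0) at_top"
    by (intro tendsto_intros l)
  then show "(primitive2 q \<longlongrightarrow> 0) at_top"
    unfolding q primitive2_def by (simp add: algebra_simps)
qed

text \<open>Divided by the common Gaussian factor, the combination is a quadratic polynomial in \<open>s\<close>. Its values at \<open>0\<close>, \<open>1/2\<close>
  and \<open>1\<close> determine the coefficients.\<close>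

lemma primitives_independent:
  assumes \<sigma>: "fst (snd q) > 0" and z: "\<And>s. s \<in> {0..1} \<Longrightarrow> a * primitive1 q s + b * primitive2 q s = 0"
  shows "a = 0 \<and> b = 0"
proof -
  obtain p \<sigma> \<theta> where q: "q = (p, \<sigma>, \<theta>)" by (cases q)
  have \<sigma>: "\<sigma> > 0" using \<sigma> by (simp add: q)
  have "a / \<sigma> + b * (cos \<theta> * ((p - s)\<^sup>2 / \<sigma> + 2 / \<sigma>\<^sup>2) + sin \<theta> * (p - s)) = 0" if "s \<in> {0..1}" for s
  proof -
    have "exp (- \<sigma> * (p - s)\<^sup>2 / 2) * (a / \<sigma> + b * (cos \<theta> * ((p - s)\<^sup>2 / \<sigma> + 2 / \<sigma>\<^sup>2) + sin \<theta> * (p - s))) = 0"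
      using z[OF that] by (simp add: q primitive1_def primitive2_def algebra_simps)
    then show ?thesis by simp
  qed
  from this[of 0] this[of "1/2"] this[of 1]
  have e: "a / \<sigma> + b * (cos \<theta> * (p\<^sup>2 / \<sigma> + 2 / \<sigma>\<^sup>2) + sin \<theta> * p) = 0"
    "a / \<sigma> + b * (cos \<theta> * ((p - 1/2)\<^sup>2 / \<sigma> + 2 / \<sigma>\<^sup>2) + sin \<theta> * (p - 1/2)) = 0"
    "a / \<sigma> + b * (cos \<theta> * ((p - 1)\<^sup>2 / \<sigma> + 2 / \<sigma>\<^sup>2) + sin \<theta> * (p - 1)) = 0" by auto
  \<comment> \<open>the second difference isolates the quadratic coefficient\<close>
  have "b * cos \<theta> / (2 * \<sigma>) = (a / \<sigma> + b * (cos \<theta> * (p\<^sup>2 / \<sigma> + 2 / \<sigma>\<^sup>2) + sin \<theta> * p))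
     - 2 * (a / \<sigma> + b * (cos \<theta> * ((p - 1/2)\<^sup>2 / \<sigma> + 2 / \<sigma>\<^sup>2) + sin \<theta> * (p - 1/2)))
     + (a / \<sigma> + b * (cos \<theta> * ((p - 1)\<^sup>2 / \<sigma> + 2 / \<sigma>\<^sup>2) + sin \<theta> * (p - 1)))"
    using \<sigma> by (simp add: field_simps power2_eq_square)
  then have bc: "b * cos \<theta> = 0" using e \<sigma> by simp
  have e0: "a / \<sigma> + b * sin \<theta> * p = 0" "a / \<sigma> + b * sin \<theta> * (p - 1) = 0"
    using e(1,3) bc by (simp_all add: distrib_left mult.assoc[symmetric])
  have bs: "b * sin \<theta> = 0" using e0 by (simp add: algebra_simps)
  have "b\<^sup>2 = (b * cos \<theta>)\<^sup>2 + (b * sin \<theta>)\<^sup>2"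
    by (simp add: power_mult_distrib distrib_left[symmetric])
  then have "b = 0" using bc bs by simp
  then show ?thesis using e0 \<sigma> by simp
qed

text \<open>The covariance form is positive at every parameter by linear independence. It is continuous in the parameter and in the
  direction of \<open>(u, v)\<close>, so it has a positive minimum over the compact set of parameters and unit directions; homogeneity
  extends the bound to all \<open>(u, v)\<close>.\<close>

lemma primitives_uniformly_nondegenerate:
  fixes a b :: "real \<times> real \<times> real"
  defines "K \<equiv> {fst a..fst b} \<times> {fst (snd a)..fst (snd b)} \<times> {snd (snd a)..snd (snd b)}"
  assumes pos: "fst (snd a) > 0"
  obtains m where "m > 0" "\<And>q u v. q \<in> K \<Longrightarrow>
    m * (u\<^sup>2 + v\<^sup>2) \<le> integral {0..1} (\<lambda>s. (u * primitive1 q s + v * primitive2 q s)\<^sup>2)"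
proof (cases "K = {}")
  case True
  then show ?thesis by (intro that[of 1]) auto
next
  case False
  \<comment> \<open>The covariance form on unit vectors, with the direction of \<open>(u, v)\<close> given by its angle.\<close>
  define J where "J z = integral (cbox 0 1) (\<lambda>s. (cos (snd z) * primitive1 (fst z) s + sin (snd z) * primitive2 (fst z) s)\<^sup>2)"
    for z :: "(real \<times> real \<times> real) \<times> real"
  let ?S = "K \<times> {0..2 * pi}"
  have \<sigma>: "fst (snd q) > 0" if "q \<in> K" for q using that pos by (auto simp: K_def)
  have compact: "compact ?S" unfolding K_def by (intro compact_Times) auto
  have "continuous_on (?S \<times> cbox 0 1) (\<lambda>(z, s). (cos (snd z) * primitive1 (fst z) s + sin (snd z) * primitive2 (fst z) s)\<^sup>2)"
    unfolding primitive1_def primitive2_def case_prod_beta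
    by (intro continuous_intros) (use \<sigma> in \<open>fastforce+\<close>)
  then have cont: "continuous_on ?S J" unfolding J_def by (rule integral_continuous_on_param)
  obtain q where "q \<in> K" using False by auto
  then have "(q, 0) \<in> ?S" by simp
  then have "?S \<noteq> {}" by blast
  then obtain z0 where z0: "z0 \<in> ?S" "\<And>z. z \<in> ?S \<Longrightarrow> J z0 \<le> J z"
    using continuous_attains_inf[OF compact _ cont] by blast
  have cprim: "continuous_on {0..1} (primitive1 q)" "continuous_on {0..1} (primitive2 q)" if "q \<in> K" for q
    using DERIV_isCont[OF primitive1_derivative[OF \<sigma>[OF that]]]
      DERIV_isCont[OF primitive2_derivative[OF \<sigma>[OF that]]]
    by (simp_all add: continuous_at_imp_continuous_on)
  have "J z0 \<noteq> 0"
  proof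
    assume J0: "J z0 = 0"
    have q0: "fst z0 \<in> K" using z0 by auto
    have "\<forall>s\<in>{0..1}. (cos (snd z0) * primitive1 (fst z0) s + sin (snd z0) * primitive2 (fst z0) s)\<^sup>2 = 0"
      using J0 unfolding J_def box_real
      by (subst (asm) integral_eq_0_iff) (auto intro!: continuous_intros cprim q0)
    then have "cos (snd z0) = 0 \<and> sin (snd z0) = 0"
      using \<sigma>[OF q0] by (intro primitives_independent[of "fst z0"]) auto
    then show False using sin_cos_squared_add[of "snd z0"] by simp
  qed
  moreover have "J z0 \<ge> 0"
    unfolding J_def by (cases "(\<lambda>s. (cos (snd z0) * primitive1 (fst z0) s + sin (snd z0) * primitive2 (fst z0) s)\<^sup>2) integrable_on cbox 0 1")
      (auto intro: Henstock_Kurzweil_Integration.integral_nonneg simp: not_integrable_integral)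
  ultimately have J0: "J z0 > 0" by simp
  show ?thesis
  proof (rule that[OF J0])
    fix q u v assume q: "q \<in> K"
    define r where "r = sqrt (u\<^sup>2 + v\<^sup>2)"
    obtain \<phi> where \<phi>: "0 \<le> \<phi>" "\<phi> \<le> 2 * pi" "u = r * cos \<phi>" "v = r * sin \<phi>"
    proof (cases "r = 0")
      case True
      then have "u = 0" "v = 0" by (auto simp: r_def sum_power2_eq_zero_iff)
      then show ?thesis using that[of 0] True by simp
    next
      case False
      have "(u / r)\<^sup>2 + (v / r)\<^sup>2 = (u\<^sup>2 + v\<^sup>2) / r\<^sup>2" by (simp add: power_divide add_divide_distrib)
      also have "\<dots> = 1" using False by (simp add: r_def)
      finally obtain \<phi> where "0 \<le> \<phi>" "\<phi> < 2 * pi" "u / r = cos \<phi>" "v / r = sin \<phi>"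
        using sincos_total_2pi by metis
      then show ?thesis using that[of \<phi>] False by (simp add: field_simps)
    qed
    have "J z0 * (u\<^sup>2 + v\<^sup>2) = r\<^sup>2 * J z0" by (simp add: r_def)
    also have "\<dots> \<le> r\<^sup>2 * J (q, \<phi>)" using z0(2)[of "(q, \<phi>)"] q \<phi> by (intro mult_left_mono) auto
    also have "\<dots> = integral {0..1} (\<lambda>s. r\<^sup>2 * (cos \<phi> * primitive1 q s + sin \<phi> * primitive2 q s)\<^sup>2)"
      by (simp add: J_def)
    also have "(\<lambda>s. r\<^sup>2 * (cos \<phi> * primitive1 q s + sin \<phi> * primitive2 q s)\<^sup>2)
        = (\<lambda>s. (u * primitive1 q s + v * primitive2 q s)\<^sup>2)"
      by (simp add: \<phi>(3,4) power_mult_distrib[symmetric] distrib_left mult.assoc)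
    finally show "J z0 * (u\<^sup>2 + v\<^sup>2) \<le> integral {0..1} (\<lambda>s. (u * primitive1 q s + v * primitive2 q s)\<^sup>2)" .
  qed
qed

lemma integrable_kernels:
  assumes v: "gauss_integrable v" and \<sigma>: "fst (snd q) > 0"
  shows "integrable lborel (\<lambda>s. kernel1 q s *\<^sub>R v s)" "integrable lborel (\<lambda>s. kernel2 q s *\<^sub>R v s)"
proof -
  obtain p \<sigma> \<theta> where q: "q = (p, \<sigma>, \<theta>)" by (cases q)
  have \<sigma>: "\<sigma> > 0" using \<sigma> by (simp add: q)
  note i = integrable_gauss_kernel[OF v \<sigma>]
  show "integrable lborel (\<lambda>s. kernel1 q s *\<^sub>R v s)" unfolding q kernel1_def prod.case by (rule i)
  have "integrable lborel (\<lambda>s. cos \<theta> *\<^sub>R (gauss_kernel 3 \<sigma> (p - s) *\<^sub>R v s)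
      + sin \<theta> *\<^sub>R (\<sigma> *\<^sub>R (gauss_kernel 2 \<sigma> (p - s) *\<^sub>R v s) - gauss_kernel 0 \<sigma> (p - s) *\<^sub>R v s))"
    by (intro Bochner_Integration.integrable_add Bochner_Integration.integrable_diff integrable_scaleR_right i)
  then show "integrable lborel (\<lambda>s. kernel2 q s *\<^sub>R v s)"
    by (simp add: q kernel2_def scaleR_left_distrib scaleR_left_diff_distrib scaleR_right_diff_distrib
        right_diff_distrib)
qed

lemma degeneracy_eq_moments:
  assumes v: "gauss_integrable v" and \<sigma>: "\<sigma> > 0"
  shows "degeneracy v (p, \<sigma>, \<theta>) = (moment v 1 p \<sigma>,
     cos \<theta> *\<^sub>R moment v 3 p \<sigma> + sin \<theta> *\<^sub>R (\<sigma> *\<^sub>R moment v 2 p \<sigma> - moment v 0 p \<sigma>))"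
proof -
  note i = integrable_gauss_kernel[OF v \<sigma>]
  have "(LINT s|lborel. kernel2 (p, \<sigma>, \<theta>) s *\<^sub>R v s)
     = (LINT s|lborel. cos \<theta> *\<^sub>R (gauss_kernel 3 \<sigma> (p - s) *\<^sub>R v s)
      + sin \<theta> *\<^sub>R (\<sigma> *\<^sub>R (gauss_kernel 2 \<sigma> (p - s) *\<^sub>R v s) - gauss_kernel 0 \<sigma> (p - s) *\<^sub>R v s))"
    by (simp add: kernel2_def scaleR_left_distrib scaleR_left_diff_distrib scaleR_right_diff_distrib
        right_diff_distrib)
  also have "\<dots> = cos \<theta> *\<^sub>R moment v 3 p \<sigma> + sin \<theta> *\<^sub>R (\<sigma> *\<^sub>R moment v 2 p \<sigma> - moment v 0 p \<sigma>)"
    unfolding moment_def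
    by (subst Bochner_Integration.integral_add Bochner_Integration.integral_diff integral_scaleR_right
        | intro i integrable_scaleR_right Bochner_Integration.integrable_diff refl)+
  finally show ?thesis by (simp add: degeneracy_def kernel1_def moment_def)
qed

text \<open>Boundedness is included because products of Lipschitz functions are Lipschitz only when the factors are bounded.\<close>

definition bounded_lipschitz_on :: "'a::metric_space set \<Rightarrow> ('a \<Rightarrow> 'b::real_normed_vector) \<Rightarrow> bool" where
  "bounded_lipschitz_on K f \<longleftrightarrow> (\<exists>B. \<forall>q\<in>K. norm (f q) \<le> B) \<and>
     (\<exists>L. \<forall>q\<in>K. \<forall>q'\<in>K. norm (f q - f q') \<le> L * dist q q')"

lemma bounded_lipschitz_on_add:
  assumes "bounded_lipschitz_on K f" "bounded_lipschitz_on K g"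
  shows "bounded_lipschitz_on K (\<lambda>q. f q + g q)"
proof -
  obtain A B L M where *: "\<And>q. q \<in> K \<Longrightarrow> norm (f q) \<le> A" "\<And>q. q \<in> K \<Longrightarrow> norm (g q) \<le> B"
    "\<And>q q'. q \<in> K \<Longrightarrow> q' \<in> K \<Longrightarrow> norm (f q - f q') \<le> L * dist q q'"
    "\<And>q q'. q \<in> K \<Longrightarrow> q' \<in> K \<Longrightarrow> norm (g q - g q') \<le> M * dist q q'"
    using assms unfolding bounded_lipschitz_on_def by metis
  have "norm (f q + g q) \<le> A + B" if "q \<in> K" for q
    using norm_triangle_ineq[of "f q" "g q"] *(1,2)[OF that] by linarith
  moreover have "norm (f q + g q - (f q' + g q')) \<le> (L + M) * dist q q'" if "q \<in> K" "q' \<in> K" for q q'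
    using norm_triangle_ineq[of "f q - f q'" "g q - g q'"] *(3,4)[OF that]
    by (simp add: algebra_simps)
  ultimately show ?thesis unfolding bounded_lipschitz_on_def by blast
qed

lemma bounded_lipschitz_on_scaleR:
  assumes "bounded_lipschitz_on K f" "bounded_lipschitz_on K g"
  shows "bounded_lipschitz_on K (\<lambda>q. f q *\<^sub>R g q)"
proof -
  obtain A B L M where *: "\<And>q. q \<in> K \<Longrightarrow> norm (f q) \<le> A" "\<And>q. q \<in> K \<Longrightarrow> norm (g q) \<le> B"
    "\<And>q q'. q \<in> K \<Longrightarrow> q' \<in> K \<Longrightarrow> norm (f q - f q') \<le> L * dist q q'"
    "\<And>q q'. q \<in> K \<Longrightarrow> q' \<in> K \<Longrightarrow> norm (g q - g q') \<le> M * dist q q'"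
    using assms unfolding bounded_lipschitz_on_def by metis
  have "norm (f q *\<^sub>R g q) \<le> A * B" if "q \<in> K" for q
    unfolding norm_scaleR real_norm_def[symmetric] using *(1,2)[OF that] order_trans[OF norm_ge_zero]
    by (intro mult_mono) auto
  moreover have "norm (f q *\<^sub>R g q - f q' *\<^sub>R g q') \<le> (A * M + L * B) * dist q q'"
    if q: "q \<in> K" "q' \<in> K" for q q'
  proof -
    have "f q *\<^sub>R g q - f q' *\<^sub>R g q' = f q *\<^sub>R (g q - g q') + (f q - f q') *\<^sub>R g q'"
      by (simp add: algebra_simps)
    also have "norm \<dots> \<le> norm (f q) * norm (g q - g q') + norm (f q - f q') * norm (g q')"
      by (rule order_trans[OF norm_triangle_ineq]) simp
    also have "\<dots> \<le> A * (M * dist q q') + (L * dist q q') * B"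
      using *(1)[OF q(1)] *(2)[OF q(2)] *(3,4)[OF q] order_trans[OF norm_ge_zero]
      by (intro add_mono mult_mono) auto
    finally show ?thesis by (simp add: algebra_simps)
  qed
  ultimately show ?thesis unfolding bounded_lipschitz_on_def by blast
qed

lemma bounded_lipschitz_on_moment:
  fixes a b :: "real \<times> real \<times> real"
  defines "K \<equiv> {fst a..fst b} \<times> {fst (snd a)..fst (snd b)} \<times> {snd (snd a)..snd (snd b)}"
  assumes v: "gauss_integrable v" and pos: "fst (snd a) > 0"
  shows "bounded_lipschitz_on K (\<lambda>q. moment v j (fst q) (fst (snd q)))"
proof -
  define R where "R = \<bar>fst a\<bar> + \<bar>fst b\<bar> + \<bar>fst (snd b)\<bar>"
  have R: "\<bar>fst q\<bar> \<le> R" "fst (snd q) \<in> {fst (snd a)..R}" if "q \<in> K" for q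
    using that by (auto simp: K_def R_def)
  obtain B where B: "\<And>p \<sigma>. \<bar>p\<bar> \<le> R \<Longrightarrow> \<sigma> \<ge> fst (snd a) \<Longrightarrow> norm (moment v j p \<sigma>) \<le> B"
    using moment_bounded[OF v pos] by blast
  obtain L where L: "\<And>p p' \<sigma> \<sigma>'. \<bar>p\<bar> \<le> R \<Longrightarrow> \<bar>p'\<bar> \<le> R \<Longrightarrow> \<sigma> \<in> {fst (snd a)..R} \<Longrightarrow> \<sigma>' \<in> {fst (snd a)..R} \<Longrightarrow>
     norm (moment v j p \<sigma> - moment v j p' \<sigma>') \<le> L * (\<bar>p - p'\<bar> + \<bar>\<sigma> - \<sigma>'\<bar>)"
    using moment_lipschitz[OF v pos] by blast
  have "norm (moment v j (fst q) (fst (snd q)) - moment v j (fst q') (fst (snd q'))) \<le> (\<bar>L\<bar> * 2) * dist q q'"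
    if "q \<in> K" "q' \<in> K" for q q'
  proof -
    have "\<bar>fst q - fst q'\<bar> \<le> dist q q'" using dist_fst_le[of q q'] by (simp add: dist_real_def)
    moreover have "\<bar>fst (snd q) - fst (snd q')\<bar> \<le> dist q q'"
      using dist_fst_le[of "snd q" "snd q'"] dist_snd_le[of q q'] by (simp add: dist_real_def)
    ultimately have "\<bar>fst q - fst q'\<bar> + \<bar>fst (snd q) - fst (snd q')\<bar> \<le> 2 * dist q q'" by linarith
    then have "\<bar>L\<bar> * (\<bar>fst q - fst q'\<bar> + \<bar>fst (snd q) - fst (snd q')\<bar>) \<le> \<bar>L\<bar> * (2 * dist q q')"
      by (intro mult_left_mono) auto
    moreover have "L * (\<bar>fst q - fst q'\<bar> + \<bar>fst (snd q) - fst (snd q')\<bar>)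
        \<le> \<bar>L\<bar> * (\<bar>fst q - fst q'\<bar> + \<bar>fst (snd q) - fst (snd q')\<bar>)"
      by (intro mult_right_mono) auto
    ultimately show ?thesis
      using L[OF R(1)[OF that(1)] R(1)[OF that(2)] R(2)[OF that(1)] R(2)[OF that(2)]] by linarith
  qed
  moreover have "norm (moment v j (fst q) (fst (snd q))) \<le> B" if "q \<in> K" for q
    using B R[OF that] by auto
  ultimately show ?thesis unfolding bounded_lipschitz_on_def by blast
qed

lemma degeneracy_lipschitz:
  fixes a b :: "real \<times> real \<times> real"
  defines "K \<equiv> {fst a..fst b} \<times> {fst (snd a)..fst (snd b)} \<times> {snd (snd a)..snd (snd b)}"
  assumes v: "gauss_integrable v" and pos: "fst (snd a) > 0"
  shows "\<exists>L. \<forall>q\<in>K. \<forall>q'\<in>K. \<bar>norm (degeneracy v q) - norm (degeneracy v q')\<bar> \<le> L * dist q q'"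
proof -
  let ?m = "\<lambda>j q. moment v j (fst q) (fst (snd q))"
  let ?A = "\<lambda>q. ?m 1 q"
  let ?B = "\<lambda>q. cos (snd (snd q)) *\<^sub>R ?m 3 q + sin (snd (snd q)) *\<^sub>R (fst (snd q) *\<^sub>R ?m 2 q + (-1) *\<^sub>R ?m 0 q)"
  have m: "bounded_lipschitz_on K (?m j)" for j
    unfolding K_def by (rule bounded_lipschitz_on_moment[OF v pos])
  have t: "\<bar>snd (snd q) - snd (snd q')\<bar> \<le> dist q q'" "\<bar>fst (snd q) - fst (snd q')\<bar> \<le> dist q q'"
    for q q' :: "real \<times> real \<times> real"
    using dist_snd_le[of "snd q" "snd q'"] dist_fst_le[of "snd q" "snd q'"] dist_snd_le[of q q']
    by (simp_all add: dist_real_def)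
  have "bounded_lipschitz_on K (\<lambda>q. cos (snd (snd q)))"
  proof -
    have "\<bar>cos x - cos y\<bar> \<le> 1 * \<bar>x - y\<bar>" for x y :: real
      using field_differentiable_bound[of UNIV cos "\<lambda>x. - sin x" 1 x y] DERIV_cos by auto
    then have "norm (cos (snd (snd q)) - cos (snd (snd q'))) \<le> 1 * dist q q'" for q q' :: "real \<times> real \<times> real"
      using t(1)[of q q'] order_trans by fastforce
    then show ?thesis unfolding bounded_lipschitz_on_def by (intro conjI exI[of _ 1]) (auto simp del: mult_1)
  qed
  moreover have "bounded_lipschitz_on K (\<lambda>q. sin (snd (snd q)))"
  proof -
    have "\<bar>sin x - sin y\<bar> \<le> 1 * \<bar>x - y\<bar>" for x y :: real
      using field_differentiable_bound[of UNIV sin "\<lambda>x. cos x" 1 x y] DERIV_sin by auto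
    then have "norm (sin (snd (snd q)) - sin (snd (snd q'))) \<le> 1 * dist q q'" for q q' :: "real \<times> real \<times> real"
      using t(1)[of q q'] order_trans by fastforce
    then show ?thesis unfolding bounded_lipschitz_on_def by (intro conjI exI[of _ 1]) (auto simp del: mult_1)
  qed
  moreover have "bounded_lipschitz_on K (\<lambda>q. fst (snd q))"
  proof -
    have "norm (fst (snd q)) \<le> \<bar>fst (snd b)\<bar>" if "q \<in> K" for q using that pos by (auto simp: K_def)
    then show ?thesis unfolding bounded_lipschitz_on_def using t(2)
      by (intro conjI exI[of _ "\<bar>fst (snd b)\<bar>"] exI[of _ 1]) auto
  qed
  moreover have "bounded_lipschitz_on K (\<lambda>q. -1 :: real)"
    unfolding bounded_lipschitz_on_def by (intro conjI exI[of _ 1]) auto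
  ultimately have B: "bounded_lipschitz_on K ?B"
    by (intro bounded_lipschitz_on_add bounded_lipschitz_on_scaleR m)
  obtain L where L: "\<And>q q'. q \<in> K \<Longrightarrow> q' \<in> K \<Longrightarrow> norm (?A q - ?A q') \<le> L * dist q q'"
    using m[of 1] unfolding bounded_lipschitz_on_def by blast
  obtain L' where L': "\<And>q q'. q \<in> K \<Longrightarrow> q' \<in> K \<Longrightarrow> norm (?B q - ?B q') \<le> L' * dist q q'"
    using B unfolding bounded_lipschitz_on_def by blast
  have eq: "degeneracy v q = (?A q, ?B q)" if "q \<in> K" for q
  proof -
    have "fst (snd q) > 0" using that pos by (auto simp: K_def)
    from degeneracy_eq_moments[OF v this, of "fst q" "snd (snd q)"] show ?thesis by simp
  qed
  have "\<bar>norm (degeneracy v q) - norm (degeneracy v q')\<bar> \<le> (L + L') * dist q q'" if q: "q \<in> K" "q' \<in> K" for q q'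
  proof -
    have "\<bar>norm (degeneracy v q) - norm (degeneracy v q')\<bar> \<le> norm (degeneracy v q - degeneracy v q')"
      by (rule norm_triangle_ineq3)
    also have "\<dots> = norm (?A q - ?A q', ?B q - ?B q')" by (simp add: eq q)
    also have "\<dots> \<le> norm (?A q - ?A q') + norm (?B q - ?B q')" by (rule norm_Pair_le)
    also have "\<dots> \<le> (L + L') * dist q q'" using L[OF q] L'[OF q] by (simp add: distrib_right)
    finally show ?thesis .
  qed
  then show ?thesis by blast
qed

section \<open>Brownian paths seen through the degeneracy field\<close>

text \<open>The properties of a sample path on which the deterministic part of the argument rests. The condition
  \<open>w 0 = 0\<close> makes the extension by zero continuous from both sides and equal to the restriction to the closed half-line.\<close>

definition good_path :: "(real \<Rightarrow> complex) \<Rightarrow> bool" where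
  "good_path w \<longleftrightarrow> w 0 = 0 \<and> continuous_on {0..} w \<and> gauss_integrable (zero_extension w)"

lemma zero_extension_indicator: "w 0 = 0 \<Longrightarrow> zero_extension w s = indicator {0..} s *\<^sub>R w s"
  by (auto simp: zero_extension_def indicator_def)

lemma planar_brownian_good_path:
  assumes bm: "standard_planar_brownian_motion M W"
  shows "AE \<omega> in M. good_path (\<lambda>t. W t \<omega>)"
proof -
  have R: "standard_brownian_motion M (\<lambda>t \<omega>. Re (W t \<omega>))"
    and I: "standard_brownian_motion M (\<lambda>t \<omega>. Im (W t \<omega>))"
    using bm by (simp_all add: standard_planar_brownian_motion_def)
  have "AE \<omega> in M. Re (W 0 \<omega>) = 0" "AE \<omega> in M. Im (W 0 \<omega>) = 0"
    "AE \<omega> in M. continuous_on {0..} (\<lambda>t. Re (W t \<omega>))" "AE \<omega> in M. continuous_on {0..} (\<lambda>t. Im (W t \<omega>))"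
    using R I by (auto simp: standard_brownian_motion_def)
  with brownian_gaussian_integrable[OF R] brownian_gaussian_integrable[OF I]
  show ?thesis
  proof eventually_elim
    case (elim \<omega>)
    let ?w = "\<lambda>t. W t \<omega>"
    have w0: "?w 0 = 0" using elim by (simp add: complex_eq_iff)
    have cont: "continuous_on {0..} ?w"
      using elim continuous_on_Complex[of "{0..}" "\<lambda>t. Re (?w t)" "\<lambda>t. Im (?w t)"] by simp
    have meas: "zero_extension ?w \<in> borel_measurable borel"
    proof -
      have "zero_extension ?w = (\<lambda>s. indicator {0..} s *\<^sub>R ?w s)"
        by (rule ext) (rule zero_extension_indicator[of ?w, OF w0])
      then show ?thesis using borel_measurable_continuous_on_indicator[OF _ cont] by simp
    qed
    have "integrable lborel (\<lambda>s. exp (- \<delta> * s\<^sup>2) *\<^sub>R zero_extension ?w s)" if "\<delta> > 0" for \<delta>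
    proof -
      let ?r = "\<lambda>s. indicator {0..} s *\<^sub>R (exp (- \<delta> * s\<^sup>2) * Re (?w s))"
      let ?i = "\<lambda>s. indicator {0..} s *\<^sub>R (exp (- \<delta> * s\<^sup>2) * Im (?w s))"
      have "integrable lborel ?r" "integrable lborel ?i"
        using elim(1,2) that unfolding set_integrable_def by blast+
      then have "integrable lborel (\<lambda>s. complex_of_real (?r s) + \<i> * complex_of_real (?i s))"
        by (intro Bochner_Integration.integrable_add integrable_mult_right integrable_of_real)
      moreover have "complex_of_real (?r s) + \<i> * complex_of_real (?i s) = exp (- \<delta> * s\<^sup>2) *\<^sub>R zero_extension ?w s" for s
        unfolding zero_extension_indicator[of ?w, OF w0] by (auto simp: complex_eq_iff)
      ultimately show ?thesis by (simp only:)
    qed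
    then show ?case using w0 cont meas by (auto simp: good_path_def gauss_integrable_def)
  qed
qed

text \<open>Identifies integrals along a sample path with values of a functional that is measurable on path space. For Brownian motion
  this replaces the integrals by random variables up to a null set.\<close>

lemma good_path_functional:
  assumes w: "good_path w" and g: "continuous_on UNIV g"
    and G: "\<And>s. (G has_real_derivative g s) (at s)"
    and int: "integrable lborel (\<lambda>s. g s *\<^sub>R zero_extension w s)"
  shows "set_integrable lborel {0..} (\<lambda>s. Re (w s) * g s)"
    and "set_integrable lborel {0..} (\<lambda>s. Im (w s) * g s)"
    and "(LINT s|lborel. g s *\<^sub>R zero_extension w s)
         = Complex (path_functional G (\<lambda>t. Re (w t))) (path_functional G (\<lambda>t. Im (w t)))"
proof -
  have w0: "w 0 = 0" and c: "continuous_on {0..} w" using w by (auto simp: good_path_def)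
  have re: "Re (g s *\<^sub>R zero_extension w s) = indicator {0..} s *\<^sub>R (Re (w s) * g s)"
    and im: "Im (g s *\<^sub>R zero_extension w s) = indicator {0..} s *\<^sub>R (Im (w s) * g s)" for s
    unfolding zero_extension_indicator[of w, OF w0] by auto
  show ri: "set_integrable lborel {0..} (\<lambda>s. Re (w s) * g s)"
    unfolding set_integrable_def re[symmetric] using int by (rule integrable_Re)
  show ii: "set_integrable lborel {0..} (\<lambda>s. Im (w s) * g s)"
    unfolding set_integrable_def im[symmetric] using int by (rule integrable_Im)
  have "path_functional G (\<lambda>t. Re (w t)) = Re (LINT s|lborel. g s *\<^sub>R zero_extension w s)"
    using path_functional_eq(2)[OF continuous_on_Re[OF c] g G ri] integral_Re[OF int]
    unfolding set_lebesgue_integral_def re by simp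
  moreover have "path_functional G (\<lambda>t. Im (w t)) = Im (LINT s|lborel. g s *\<^sub>R zero_extension w s)"
    using path_functional_eq(2)[OF continuous_on_Im[OF c] g G ii] integral_Im[OF int]
    unfolding set_lebesgue_integral_def im by simp
  ultimately show "(LINT s|lborel. g s *\<^sub>R zero_extension w s)
         = Complex (path_functional G (\<lambda>t. Re (w t))) (path_functional G (\<lambda>t. Im (w t)))"
    by (simp add: complex_eq_iff)
qed

section \<open>Almost sure absence of degenerate points\<close>

text \<open>The counting argument applied to the norm of the degeneracy field. The exponent 4 in the small-ball
  bound exceeds the number 3 of parameters.\<close>

lemma no_degeneracy_on_box:
  fixes a b :: "real \<times> real \<times> real"
  defines "K \<equiv> {fst a..fst b} \<times> {fst (snd a)..fst (snd b)} \<times> {snd (snd a)..snd (snd b)}"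
  assumes bm: "standard_planar_brownian_motion M W" and pos: "fst (snd a) > 0"
  shows "AE \<omega> in M. \<forall>q\<in>K. degeneracy (zero_extension (\<lambda>t. W t \<omega>)) q \<noteq> 0"
proof -
  have R: "standard_brownian_motion M (\<lambda>t \<omega>. Re (W t \<omega>))"
    and I: "standard_brownian_motion M (\<lambda>t \<omega>. Im (W t \<omega>))"
    using bm by (simp_all add: standard_planar_brownian_motion_def)
  interpret prob_space M using R by (simp add: standard_brownian_motion_def)
  note good = planar_brownian_good_path[OF bm]
  obtain m where m: "m > 0" "\<And>q u v. q \<in> K \<Longrightarrow>
    m * (u\<^sup>2 + v\<^sup>2) \<le> integral {0..1} (\<lambda>s. (u * primitive1 q s + v * primitive2 q s)\<^sup>2)"
    using primitives_uniformly_nondegenerate[OF pos, of b] unfolding K_def by blast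
  define N where "N q \<omega> = norm (degeneracy (zero_extension (\<lambda>t. W t \<omega>)) q)" for q \<omega>
  have "AE \<omega> in M. \<forall>q\<in>K. N q \<omega> \<noteq> 0"
    unfolding K_def
  proof (rule no_zero_of_lipschitz_field[where C="1 / m\<^sup>2"], unfold K_def[symmetric])
    show "AE \<omega> in M. \<exists>L. \<forall>q\<in>K. \<forall>q'\<in>K. \<bar>N q \<omega> - N q' \<omega>\<bar> \<le> L * dist q q'"
      using good
    proof eventually_elim
      case (elim \<omega>)
      then show ?case
        unfolding N_def K_def by (intro degeneracy_lipschitz pos) (simp add: good_path_def)
    qed
  next
    fix q assume q: "q \<in> K"
    have \<sigma>: "fst (snd q) > 0" using q pos by (auto simp: K_def)
    let ?G1 = "primitive1 q" and ?G2 = "primitive2 q"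
    define Y where "Y \<omega> = sqrt ((path_functional ?G1 (\<lambda>t. Re (W t \<omega>)))\<^sup>2 + (path_functional ?G2 (\<lambda>t. Re (W t \<omega>)))\<^sup>2
         + (path_functional ?G1 (\<lambda>t. Im (W t \<omega>)))\<^sup>2 + (path_functional ?G2 (\<lambda>t. Im (W t \<omega>)))\<^sup>2)" for \<omega>
    note [measurable] = path_functional_random_variable[OF R] path_functional_random_variable[OF I]
    have "Y \<in> borel_measurable M" unfolding Y_def by measurable
    moreover have "AE \<omega> in M. N q \<omega> = Y \<omega>"
      using good
    proof eventually_elim
      case (elim \<omega>)
      then have v: "gauss_integrable (zero_extension (\<lambda>t. W t \<omega>))" by (simp add: good_path_def)
      show ?case
        unfolding N_def degeneracy_def Y_def
          good_path_functional(3)[OF elim continuous_on_kernels(1) primitive1_derivative[OF \<sigma>] integrable_kernels(1)[OF v \<sigma>]]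
          good_path_functional(3)[OF elim continuous_on_kernels(2) primitive2_derivative[OF \<sigma>] integrable_kernels(2)[OF v \<sigma>]]
        by (simp add: norm_Pair cmod_power2 algebra_simps)
    qed
    moreover have "expectation (\<lambda>\<omega>. exp (- (Y \<omega>)\<^sup>2 / (2 * \<epsilon>\<^sup>2))) \<le> 1 / m\<^sup>2 * \<epsilon>^4" if "\<epsilon> > 0" for \<epsilon>
    proof -
      have int: "AE \<omega> in M. set_integrable lborel {0..} (\<lambda>s. Re (W s \<omega>) * kernel1 q s)"
        "AE \<omega> in M. set_integrable lborel {0..} (\<lambda>s. Re (W s \<omega>) * kernel2 q s)"
        "AE \<omega> in M. set_integrable lborel {0..} (\<lambda>s. Im (W s \<omega>) * kernel1 q s)"
        "AE \<omega> in M. set_integrable lborel {0..} (\<lambda>s. Im (W s \<omega>) * kernel2 q s)"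
        using good by (eventually_elim, use good_path_functional(1,2)[OF _ continuous_on_kernels(1) primitive1_derivative[OF \<sigma>] integrable_kernels(1)[OF _ \<sigma>]]
          good_path_functional(1,2)[OF _ continuous_on_kernels(2) primitive2_derivative[OF \<sigma>] integrable_kernels(2)[OF _ \<sigma>]] in \<open>simp add: good_path_def\<close>)+
      have "(Y \<omega>)\<^sup>2 = (path_functional ?G1 (\<lambda>t. Re (W t \<omega>)))\<^sup>2 + (path_functional ?G2 (\<lambda>t. Re (W t \<omega>)))\<^sup>2
         + (path_functional ?G1 (\<lambda>t. Im (W t \<omega>)))\<^sup>2 + (path_functional ?G2 (\<lambda>t. Im (W t \<omega>)))\<^sup>2" for \<omega>
        by (simp add: Y_def)
      then show ?thesis
        using planar_brownian_functional_small_ball[OF bm continuous_on_kernels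
            primitive1_derivative[OF \<sigma>] primitive2_derivative[OF \<sigma>] primitives_vanish_at_top[OF \<sigma>]
            int m(1) m(2)[OF q] that] by (simp only:)
    qed
    ultimately show "\<exists>Y\<in>borel_measurable M. (AE \<omega> in M. N q \<omega> = Y \<omega>) \<and>
       (\<forall>\<epsilon>>0. expectation (\<lambda>\<omega>. exp (- (Y \<omega>)\<^sup>2 / (2 * \<epsilon>\<^sup>2))) \<le> 1 / m\<^sup>2 * \<epsilon>^4)"
      by blast
  qed
  then show ?thesis by (simp add: N_def)
qed

lemma no_degeneracy:
  assumes bm: "standard_planar_brownian_motion M W"
  shows "AE \<omega> in M. \<forall>p>0. \<forall>\<sigma>>0. \<forall>\<theta>\<in>{-2..2}. degeneracy (zero_extension (\<lambda>t. W t \<omega>)) (p, \<sigma>, \<theta>) \<noteq> 0"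
proof -
  define lo where "lo n = (1 / real (Suc n), 1 / real (Suc n), -2 :: real)" for n
  define hi where "hi n = (real (Suc n), real (Suc n), 2 :: real)" for n
  have "AE \<omega> in M. \<forall>n. \<forall>q\<in>{fst (lo n)..fst (hi n)} \<times> {fst (snd (lo n))..fst (snd (hi n))} \<times> {snd (snd (lo n))..snd (snd (hi n))}.
      degeneracy (zero_extension (\<lambda>t. W t \<omega>)) q \<noteq> 0"
    unfolding AE_all_countable by (intro allI no_degeneracy_on_box[OF bm]) (simp add: lo_def)
  then show ?thesis
  proof eventually_elim
    case (elim \<omega>)
    show ?case
    proof (intro allI impI ballI)
      fix p \<sigma> \<theta> :: real assume p: "p > 0" and \<sigma>: "\<sigma> > 0" and \<theta>: "\<theta> \<in> {-2..2}"
      obtain n :: nat where n: "real n \<ge> p + \<sigma> + 1 / p + 1 / \<sigma>" using real_arch_simple by blast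
      have inv: "0 < 1 / p" "0 < 1 / \<sigma>" using p \<sigma> by auto
      have up: "p \<le> real (Suc n)" "\<sigma> \<le> real (Suc n)" "1 / p \<le> real (Suc n)" "1 / \<sigma> \<le> real (Suc n)"
        unfolding of_nat_Suc using n inv p \<sigma> by linarith+
      then have "1 / real (Suc n) \<le> p" "1 / real (Suc n) \<le> \<sigma>"
        using p \<sigma> by (auto simp: divide_le_eq mult.commute)
      then show "degeneracy (zero_extension (\<lambda>t. W t \<omega>)) (p, \<sigma>, \<theta>) \<noteq> 0"
        using spec[OF elim, of n] up \<theta> by (auto simp: lo_def hi_def)
    qed
  qed
qed

text \<open>If \<open>y \<noteq> 0\<close> then \<open>x = r y\<close> with \<open>r\<close> real, and \<open>\<theta> = - arctan r\<close> works; otherwise \<open>\<theta> = \<pi> / 2\<close>. The interval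
  \<open>[-2, 2]\<close> is a convenient compact one that contains \<open>[- \<pi> / 2, \<pi> / 2]\<close>.\<close>

lemma dependent_combination:
  fixes x y :: complex
  assumes "Im (x * cnj y) = 0"
  obtains \<theta> where "\<theta> \<in> {-2..2}" "cos \<theta> *\<^sub>R x + sin \<theta> *\<^sub>R y = 0"
proof (cases "y = 0")
  case True
  have "- 2 \<le> pi / 2" using pi_gt_zero by linarith
  then have "pi / 2 \<in> {-2..2}" using pi_half_le_two by simp
  then show ?thesis using that[of "pi / 2"] True by simp
next
  case False
  define r where "r = Re (x * cnj y) / (norm y)\<^sup>2"
  have "x * cnj y = of_real (Re (x * cnj y))" using assms by (simp add: complex_eq_iff)
  then have "x * (y * cnj y) = of_real (Re (x * cnj y)) * y" by (simp add: mult_ac)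
  then have x: "x = r *\<^sub>R y"
    using False by (simp add: complex_norm_square[symmetric] r_def scaleR_conv_of_real field_simps)
  define \<theta> where "\<theta> = arctan (- r)"
  have c: "cos \<theta> \<noteq> 0" by (simp add: \<theta>_def)
  have "tan \<theta> = - r" by (simp add: \<theta>_def tan_arctan)
  then have "sin \<theta> = - r * cos \<theta>" using c by (simp add: tan_def field_simps)
  then have "cos \<theta> *\<^sub>R x + sin \<theta> *\<^sub>R y = 0" by (simp add: x)
  moreover have "\<theta> \<in> {-2..2}"
    using arctan_lbound[of "- r"] arctan_ubound[of "- r"] pi_half_le_two by (auto simp: \<theta>_def)
  ultimately show ?thesis using that by blast
qed

text \<open>At a singular point the linear coefficient vanishes, hence \<open>m\<^sub>1 = 0\<close>. If in addition the next two coefficients were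
  dependent, the angle describing their dependence would give a zero of the degeneracy field.\<close>

lemma conga_singularity_is_cusp:
  assumes v: "gauss_integrable (zero_extension w)" and \<tau>: "\<tau> > 0"
    and nondeg: "\<And>\<theta>. \<theta> \<in> {-2..2} \<Longrightarrow> degeneracy (zero_extension w) (p, 1 / \<tau>, \<theta>) \<noteq> 0"
    and sing: "curve_singularity (\<lambda>p. conga w p \<tau>) p"
  shows "cusp_singularity (\<lambda>p. conga w p \<tau>) p"
proof -
  let ?v = "zero_extension w"
  define \<sigma> where "\<sigma> = 1 / \<tau>"
  define K where "K = 1 / sqrt (2 * pi * \<tau>)"
  have \<sigma>: "\<sigma> > 0" and K: "K > 0" using \<tau> by (auto simp: \<sigma>_def K_def)
  obtain c :: "nat \<Rightarrow> complex" where c: "\<And>h. (\<lambda>i. c i * of_real (h ^ i)) sums conga w (p + h) \<tau>"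
    and c1: "c 1 = of_real (- K * \<sigma>) * moment ?v 1 p \<sigma>"
    and c2: "c 2 = of_real (K * \<sigma> / 2) * (of_real \<sigma> * moment ?v 2 p \<sigma> - moment ?v 0 p \<sigma>)"
    and c3: "c 3 = of_real (K * \<sigma>\<^sup>2 / 2) * moment ?v 1 p \<sigma> - of_real (K * \<sigma>^3 / 6) * moment ?v 3 p \<sigma>"
    using conga_power_series[OF v \<tau>, of p] unfolding \<sigma>_def K_def by blast
  have "vector_derivative (\<lambda>p. conga w p \<tau>) (at p) = c 1"
    using power_series_has_vector_derivative[of c "\<lambda>p. conga w p \<tau>" p, OF c] by (rule vector_derivative_at)
  then have c10: "c 1 = 0" using sing by (simp add: curve_singularity_def)
  then have m1: "moment ?v 1 p \<sigma> = 0" using c1 K \<sigma> by simp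
  show ?thesis
  proof (rule cusp_singularityI[OF sing _ c c10])
    show "real_analytic_on (\<lambda>p. conga w p \<tau>) UNIV"
      unfolding real_analytic_on_def
    proof
      fix x :: real
      obtain d :: "nat \<Rightarrow> complex" where "\<And>h. (\<lambda>i. d i * of_real (h ^ i)) sums conga w (x + h) \<tau>"
        using conga_power_series[OF v \<tau>, of x] by blast
      from this[of "t - x" for t] have "\<forall>t\<in>ball x 1. (\<lambda>i. d i * of_real ((t - x) ^ i)) sums conga w t \<tau>"
        by simp
      then show "\<exists>\<delta>>0. \<exists>d :: nat \<Rightarrow> complex. \<forall>t\<in>ball x \<delta>. (\<lambda>i. d i * of_real ((t - x) ^ i)) sums conga w t \<tau>"
        using zero_less_one by blast
    qed
    show "Im (c 3 * cnj (c 2)) \<noteq> 0"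
    proof
      have Im_scale: "Im (of_real r * z) = r * Im z" for r z by simp
      assume 0: "Im (c 3 * cnj (c 2)) = 0"
      let ?y = "\<sigma> *\<^sub>R moment ?v 2 p \<sigma> - moment ?v 0 p \<sigma>"
      \<comment> \<open>The term with \<open>m\<^sub>1\<close> in \<open>c 3\<close> drops out, and what remains differs from \<open>m\<^sub>3\<close> by a real factor.\<close>
      have "c 3 * cnj (c 2) = of_real (- (K * \<sigma>^3 / 6) * (K * \<sigma> / 2)) * (moment ?v 3 p \<sigma> * cnj ?y)"
        unfolding c3 c2 m1 scaleR_conv_of_real by simp
      also have "Im \<dots> = - (K * \<sigma>^3 / 6) * (K * \<sigma> / 2) * Im (moment ?v 3 p \<sigma> * cnj ?y)"
        by (simp only: Im_scale)
      finally have "Im (moment ?v 3 p \<sigma> * cnj ?y) = 0" using 0 K \<sigma> by simp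
      then obtain \<theta> where \<theta>: "\<theta> \<in> {-2..2}" "cos \<theta> *\<^sub>R moment ?v 3 p \<sigma> + sin \<theta> *\<^sub>R ?y = 0"
        by (rule dependent_combination)
      have "degeneracy ?v (p, \<sigma>, \<theta>) = 0"
        unfolding degeneracy_eq_moments[OF v \<sigma>] using m1 \<theta>(2) by (simp add: zero_prod_def)
      then show False using nondeg[OF \<theta>(1)] by (simp add: \<sigma>_def)
    qed
  qed
qed

theorem lemma25:
  fixes M :: "'w measure" and W :: "real \<Rightarrow> 'w \<Rightarrow> complex"
  assumes "standard_planar_brownian_motion M W"
  shows "AE \<omega> in M. \<forall>\<tau>\<^sub>0>0. \<forall>p\<^sub>0>0.
    curve_singularity (\<lambda>p. conga (\<lambda>t. W t \<omega>) p \<tau>\<^sub>0) p\<^sub>0 \<longrightarrow>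
    cusp_singularity (\<lambda>p. conga (\<lambda>t. W t \<omega>) p \<tau>\<^sub>0) p\<^sub>0"
  using planar_brownian_good_path[OF assms] no_degeneracy[OF assms]
proof eventually_elim
  case (elim \<omega>)
  show ?case
  proof (intro allI impI)
    fix \<tau> p :: real
    assume "\<tau> > 0" "p > 0" "curve_singularity (\<lambda>p. conga (\<lambda>t. W t \<omega>) p \<tau>) p"
    then show "cusp_singularity (\<lambda>p. conga (\<lambda>t. W t \<omega>) p \<tau>) p"
      using elim by (intro conga_singularity_is_cusp) (auto simp: good_path_def)
  qed
qed

end
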